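(* Let $G$ be a finite simple gap-free graph on the vertex set $[n]=\{1,\dots,n\}$ with at least one edge, let $\mathrm{k}$ be a field, and let $I(G)\subseteq S=\mathrm{k}[x_1,\dots,x_n]$ be its edge ideal. Then for $s=2$ and for $s=3$, $$\operatorname{reg} I(G)^s=\max\bigl(\operatorname{reg} I(G)+s-1,\;2s\bigr).$$
   Context: $S=\mathrm{k}[x_1,\dots,x_n]$ is standard graded with maximal homogeneous ideal $\mathfrak m=(x_1,\dots,x_n)$. The edge ideal is $I(G)=(x_ix_j \mid \{i,j\}\in E(G))\subseteq S$. A gap in $G$ is a pair of disjoint edges forming an induced subgraph of $G$ (i.e. edges $\{a,b\},\{c,d\}$ on four distinct vertices with no other edge of $G$ among $a,b,c,d$); $G$ is gap-free if it has no gaps. For a finitely generated graded $S$-module $L$, $\operatorname{reg}(L)=\max\{i+j\mid H^i_{\mathfrak m}(L)_j\neq 0\}$ is the Castelnuovo-Mumford regularity; for a nonzero proper homogeneous ideal $J$, $\operatorname{reg}(J)=\operatorname{reg}(S/J)+1$. *)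

theory Defs
  imports "HOL-Algebra.Algebra" "HOL-Library.Poly_Mapping"
begin

section \<open>Gap-free graphs\<close>

text \<open>A finite simple graph on the vertex set \<open>{1..n}\<close> is given by its set of edges, each edge
  being a set of two vertices.\<close>

definition simple_graph :: "nat \<Rightarrow> nat set set \<Rightarrow> bool" where
  "simple_graph n E \<longleftrightarrow> (\<forall>e\<in>E. e \<subseteq> {1..n} \<and> card e = 2)"

definition is_gap :: "nat set set \<Rightarrow> nat set \<Rightarrow> nat set \<Rightarrow> bool" where
  "is_gap E e f \<longleftrightarrow> e \<in> E \<and> f \<in> E \<and> e \<inter> f = {} \<and> (\<forall>h\<in>E. h \<subseteq> e \<union> f \<longrightarrow> h = e \<or> h = f)"

definition gap_free :: "nat set set \<Rightarrow> bool" where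
  "gap_free E \<longleftrightarrow> (\<nexists>e f. is_gap E e f)"


section \<open>The standard graded polynomial ring\<close>

text \<open>A polynomial maps exponent vectors to coefficients; the type has a variable for every natural
  number, and \<open>mpoly_ring n\<close> is its subring of polynomials in the variables with index in \<open>{1..n}\<close>.\<close>

type_synonym 'k mpoly = "(nat \<Rightarrow>\<^sub>0 nat) \<Rightarrow>\<^sub>0 'k"

definition mpoly_ring :: "nat \<Rightarrow> 'k::field mpoly ring" where
  "mpoly_ring n =
    \<lparr>carrier = {p. \<forall>m\<in>Poly_Mapping.keys p. Poly_Mapping.keys m \<subseteq> {1..n}},
     monoid.mult = (*), one = 1, ring.zero = 0, add = (+)\<rparr>"

definition Var :: "nat \<Rightarrow> 'k::field mpoly" where
  "Var i = Poly_Mapping.single (Poly_Mapping.single i 1) 1"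

definition mon_degree :: "(nat \<Rightarrow>\<^sub>0 nat) \<Rightarrow> nat" where
  "mon_degree m = (\<Sum>i\<in>Poly_Mapping.keys m. Poly_Mapping.lookup m i)"

definition hom_part :: "nat \<Rightarrow> int \<Rightarrow> 'k::field mpoly set" where
  "hom_part n j =
    {p \<in> carrier (mpoly_ring n). \<forall>m\<in>Poly_Mapping.keys p. int (mon_degree m) = j}"

definition edge_ideal :: "nat \<Rightarrow> nat set set \<Rightarrow> 'k::field mpoly set" where
  "edge_ideal n E = genideal (mpoly_ring n) {Var i * Var j | i j. {i, j} \<in> E}"

definition ideal_power :: "nat \<Rightarrow> 'k::field mpoly set \<Rightarrow> nat \<Rightarrow> 'k mpoly set" where
  "ideal_power n I s = I [^]\<^bsub>ideals_set (mpoly_ring n)\<^esub> s"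


section \<open>Graded modules and localization\<close>

text \<open>\<open>gr M j\<close> is the homogeneous component of \<open>M\<close> of degree \<open>j\<close>.\<close>

record ('a, 'b) graded_module = "('a, 'b) module" +
  gr :: "int \<Rightarrow> 'b set"

text \<open>A homogeneous ideal as a graded module. Module records extend ring records, so the fields
  \<open>mult\<close> and \<open>one\<close> must be filled although they are never used.\<close>

definition ideal_module :: "nat \<Rightarrow> 'k::field mpoly set \<Rightarrow> ('k mpoly, 'k mpoly) graded_module" where
  "ideal_module n J =
    \<lparr>carrier = J, monoid.mult = (*), one = 1, ring.zero = 0, add = (+), smult = (*),
     gr = (\<lambda>j. J \<inter> hom_part n j)\<rparr>"

text \<open>The localization of \<open>M\<close> at the powers of \<open>f\<close>. The pair \<open>(u, a)\<close> stands for the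
  fraction with numerator \<open>u\<close> and denominator the \<open>a\<close>-th power of \<open>f\<close>.\<close>

definition loc_rel ::
  "('a, 'c) ring_scheme \<Rightarrow> ('a, 'b, 'd) module_scheme \<Rightarrow> 'a \<Rightarrow> (('b \<times> nat) \<times> ('b \<times> nat)) set" where
  "loc_rel R M f =
    {((u, a), (v, b)). u \<in> carrier M \<and> v \<in> carrier M \<and>
       (\<exists>k. (f [^]\<^bsub>R\<^esub> (k + b)) \<odot>\<^bsub>M\<^esub> u = (f [^]\<^bsub>R\<^esub> (k + a)) \<odot>\<^bsub>M\<^esub> v)}"

definition loc_frac ::
  "('a, 'c) ring_scheme \<Rightarrow> ('a, 'b, 'd) module_scheme \<Rightarrow> 'a \<Rightarrow> 'b \<Rightarrow> nat \<Rightarrow> ('b \<times> nat) set" where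
  "loc_frac R M f u a = loc_rel R M f `` {(u, a)}"

definition localization ::
  "('a, 'c) ring_scheme \<Rightarrow> ('a, 'b, 'd) module_scheme \<Rightarrow> 'a \<Rightarrow> ('a, ('b \<times> nat) set) module" where
  "localization R M f =
    \<lparr>carrier = (carrier M \<times> UNIV) // loc_rel R M f,
     monoid.mult = undefined, one = undefined,
     ring.zero = loc_frac R M f \<zero>\<^bsub>M\<^esub> 0,
     add = (\<lambda>U V. the_elem (\<Union>(u, a)\<in>U. \<Union>(v, b)\<in>V.
       {loc_frac R M f ((f [^]\<^bsub>R\<^esub> b) \<odot>\<^bsub>M\<^esub> u \<oplus>\<^bsub>M\<^esub> (f [^]\<^bsub>R\<^esub> a) \<odot>\<^bsub>M\<^esub> v) (a + b)})),
     smult = (\<lambda>r U. the_elem (\<Union>(u, a)\<in>U. {loc_frac R M f (r \<odot>\<^bsub>M\<^esub> u) a}))\<rparr>"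

text \<open>The canonical map from the localization at \<open>f\<close> to the localization at \<open>f g\<close>.\<close>

definition loc_map ::
  "('a, 'c) ring_scheme \<Rightarrow> ('a, 'b, 'd) module_scheme \<Rightarrow> 'a \<Rightarrow> 'a \<Rightarrow> ('b \<times> nat) set \<Rightarrow> ('b \<times> nat) set" where
  "loc_map R M f g U =
    the_elem (\<Union>(u, a)\<in>U. {loc_frac R M (f \<otimes>\<^bsub>R\<^esub> g) ((g [^]\<^bsub>R\<^esub> a) \<odot>\<^bsub>M\<^esub> u) a})"


section \<open>Local cohomology and regularity\<close>

text \<open>Local cohomology with support in the ideal generated by the variables is the cohomology of
  the Cech complex of \<open>M\<close> on \<open>Var 1, \<dots>, Var n\<close>: the term in cohomological degree \<open>i\<close> is the
  direct product of the localizations of \<open>M\<close> at the products \<open>var_prod \<sigma>\<close> with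
  \<open>card \<sigma> = i\<close>.\<close>

definition var_prod :: "nat set \<Rightarrow> 'k::field mpoly" where
  "var_prod \<sigma> = (\<Prod>i\<in>\<sigma>. Var i)"

definition faces :: "nat \<Rightarrow> nat \<Rightarrow> nat set set" where
  "faces n i = {\<sigma>. \<sigma> \<subseteq> {1..n} \<and> card \<sigma> = i}"

abbreviation cech_loc ::
  "nat \<Rightarrow> ('k::field mpoly, 'b) graded_module \<Rightarrow> nat set \<Rightarrow> ('k mpoly, ('b \<times> nat) set) module" where
  "cech_loc n M \<sigma> \<equiv> localization (mpoly_ring n) M (var_prod \<sigma>)"

definition cech ::
  "nat \<Rightarrow> ('k::field mpoly, 'b) graded_module \<Rightarrow> nat \<Rightarrow> (nat set \<Rightarrow> ('b \<times> nat) set) monoid" where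
  "cech n M i = product_group (faces n i) (\<lambda>\<sigma>. add_monoid (cech_loc n M \<sigma>))"

definition cech_diff ::
  "nat \<Rightarrow> ('k::field mpoly, 'b) graded_module \<Rightarrow> nat \<Rightarrow>
    (nat set \<Rightarrow> ('b \<times> nat) set) \<Rightarrow> (nat set \<Rightarrow> ('b \<times> nat) set)" where
  "cech_diff n M i c =
    (\<lambda>\<tau>\<in>faces n (Suc i). \<Oplus>\<^bsub>cech_loc n M \<tau>\<^esub>l\<in>\<tau>.
       (let y = loc_map (mpoly_ring n) M (var_prod (\<tau> - {l})) (Var l) (c (\<tau> - {l}))
        in if even (card {q\<in>\<tau>. q < l}) then y else \<ominus>\<^bsub>cech_loc n M \<tau>\<^esub> y))"

definition cech_cocycles ::
  "nat \<Rightarrow> ('k::field mpoly, 'b) graded_module \<Rightarrow> nat \<Rightarrow> (nat set \<Rightarrow> ('b \<times> nat) set) set" where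
  "cech_cocycles n M i = kernel (cech n M i) (cech n M (Suc i)) (cech_diff n M i)"

fun cech_coboundaries ::
  "nat \<Rightarrow> ('k::field mpoly, 'b) graded_module \<Rightarrow> nat \<Rightarrow> (nat set \<Rightarrow> ('b \<times> nat) set) set" where
  "cech_coboundaries n M 0 = {\<one>\<^bsub>cech n M 0\<^esub>}"
| "cech_coboundaries n M (Suc i) = cech_diff n M i ` carrier (cech n M i)"

definition local_cohomology ::
  "nat \<Rightarrow> ('k::field mpoly, 'b) graded_module \<Rightarrow> nat \<Rightarrow> (nat set \<Rightarrow> ('b \<times> nat) set) set monoid" where
  "local_cohomology n M i =
    (cech n M i)\<lparr>carrier := cech_cocycles n M i\<rparr> Mod cech_coboundaries n M i"

text \<open>A fraction has degree \<open>j\<close> if it can be written with a homogeneous numerator whose degree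
  exceeds that of the denominator by \<open>j\<close>; note that \<open>var_prod \<sigma>\<close> has degree \<open>card \<sigma>\<close>.\<close>

definition cech_loc_gr ::
  "nat \<Rightarrow> ('k::field mpoly, 'b) graded_module \<Rightarrow> nat set \<Rightarrow> int \<Rightarrow> ('b \<times> nat) set set" where
  "cech_loc_gr n M \<sigma> j =
    {loc_frac (mpoly_ring n) M (var_prod \<sigma>) u a | u a. u \<in> gr M (j + int (a * card \<sigma>))}"

definition local_cohomology_gr ::
  "nat \<Rightarrow> ('k::field mpoly, 'b) graded_module \<Rightarrow> nat \<Rightarrow> int \<Rightarrow>
    (nat set \<Rightarrow> ('b \<times> nat) set) set set" where
  "local_cohomology_gr n M i j =
    {cech_coboundaries n M i #>\<^bsub>cech n M i\<^esub> c | c.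
       c \<in> cech_cocycles n M i \<and> (\<forall>\<sigma>\<in>faces n i. c \<sigma> \<in> cech_loc_gr n M \<sigma> j)}"

definition reg :: "nat \<Rightarrow> ('k::field mpoly, 'b) graded_module \<Rightarrow> int" where
  "reg n M =
    (GREATEST r. \<exists>i j. r = int i + j \<and>
       local_cohomology_gr n M i j \<noteq> {\<one>\<^bsub>local_cohomology n M i\<^esub>})"

abbreviation ideal_reg :: "nat \<Rightarrow> 'k::field mpoly set \<Rightarrow> int" where
  "ideal_reg n J \<equiv> reg n (ideal_module n J)"

end

theory Submission
  imports Defs
begin

text \<open>
  The local cohomology of a monomial ideal \<open>J\<close> is graded by exponent vectors \<open>e\<close> with integer
  entries, and its part of degree \<open>e\<close> is the cohomology of the family of all faces \<open>\<sigma>\<close> such that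
  the monomial \<open>x^e\<close> lies in the localization of \<open>J\<close> at \<open>\<sigma>\<close>. Hence the regularity is the largest
  \<open>q + |e|\<close> such that the \<open>q\<close>-th cohomology of this family does not vanish.

  Let \<open>J\<close> be the \<open>s\<close>-th power of the edge ideal, \<open>N\<close> the set of negative coordinates of \<open>e\<close> and
  \<open>a\<close> the positive part of \<open>e\<close>. A face containing \<open>N\<close> is missed by the family iff it is stable and
  the part of \<open>a\<close> supported on its neighbourhood, together with a largest matching of the rest of
  \<open>a\<close>, has size less than \<open>s\<close>. If \<open>|a| < s\<close> then every stable face is missed, as for the edge
  ideal itself and the negative part of \<open>e\<close>; this accounts for the value \<open>reg I + s - 1\<close>. If \<open>|a|
  \<ge> s\<close> then the missed faces are covered by the sets \<open>D S\<close> of stable faces with neighbours in \<open>a\<close>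
  contained in \<open>S\<close>. Such a set is a cone if \<open>a\<close> has an isolated vertex outside \<open>S\<close>; otherwise \<open>a\<close>
  has an edge outside \<open>S\<close>, and since the graph is gap-free, \<open>D S\<close> consists of all sets between \<open>N\<close>
  and a stable set. Gluing these pieces along the possible sets \<open>S\<close>, which are governed by
  matchings of size less than three, yields \<open>q + |e| \<le> 2 s\<close>. The value \<open>2 s\<close> is attained when \<open>a\<close>
  is \<open>s - 1\<close> times an edge.
\<close>

section \<open>Cohomology of families of finite sets\<close>

text \<open>The constant \<open>2 * s\<close> comes from a balance. Let \<open>U\<close> be the set
  of copies counted by the positive exponents. Deficient sets have fewer than \<open>s\<close>
  elements, so gluing along all of them makes the missed faces acyclic from degree
  \<open>card N + s\<close> on, and the total degree is at most \<open>card U - card N\<close>. This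
  gives \<open>s + card U\<close>, which is good enough only for \<open>card U = s\<close>; every
  further element of \<open>U\<close> must be paid for by one more degree of vanishing. In most
  cases everything vanishes, because the missed faces are covered by cones whose index sets are
  closed under intersection. The exceptions are small: a triangle for \<open>s = 2\<close>, and for
  \<open>s = 3\<close> some graphs on four or five vertices, where a shorter gluing saves exactly
  the missing degrees. Finding them is a case analysis over graphs of matching number less than
  \<open>s\<close>. Gap-freeness is used twice: it turns the pieces that are not cones into
  intervals, and it excludes those matching configurations that would break the balance.\<close>

definition face_sign :: "nat set \<Rightarrow> nat \<Rightarrow> 'k::field" where
  "face_sign \<tau> l = (if even (card {q\<in>\<tau>. q < l}) then 1 else - 1)"

definition coboundary :: "(nat set \<Rightarrow> 'k::field) \<Rightarrow> nat set \<Rightarrow> 'k" where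
  "coboundary c \<tau> = (\<Sum>l\<in>\<tau>. face_sign \<tau> l * c (\<tau> - {l}))"

lemma face_sign_sq [simp]: "face_sign \<tau> l * face_sign \<tau> l = (1 :: 'k::field)"
  unfolding face_sign_def by (cases "even (card {q\<in>\<tau>. q < l})") simp_all

lemma face_sign_nonzero [simp]: "face_sign \<tau> l \<noteq> (0 :: 'k::field)"
  unfolding face_sign_def by (cases "even (card {q\<in>\<tau>. q < l})") simp_all

text \<open>Deleting \<open>l\<close> moves the larger \<open>l'\<close> one position down, whereas
  deleting \<open>l'\<close> leaves the position of the smaller \<open>l\<close> unchanged; so
  exactly one sign flips.\<close>

lemma face_sign_swap_less:
  assumes "finite \<tau>" "l \<in> \<tau>" "l < l'"
  shows "(face_sign \<tau> l :: 'k::field) * face_sign (\<tau> - {l}) l' =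
    - (face_sign \<tau> l' * face_sign (\<tau> - {l'}) l)"
proof -
  have 1: "{q \<in> \<tau> - {l}. q < l'} = {q \<in> \<tau>. q < l'} - {l}" by auto
  have "card {q \<in> \<tau>. q < l'} = Suc (card {q \<in> \<tau> - {l}. q < l'})"
    unfolding 1 using assms by (intro card.remove) auto
  moreover have "{q \<in> \<tau> - {l'}. q < l} = {q \<in> \<tau>. q < l}"
    using assms(3) by (intro Collect_cong) (metis DiffD1 DiffI not_less_iff_gr_or_eq
      order.strict_trans singletonD)
  ultimately show ?thesis unfolding face_sign_def by (simp only: even_Suc) (simp split: if_split)
qed

lemma face_sign_swap:
  assumes "finite \<tau>" "l \<in> \<tau>" "l' \<in> \<tau>" "l \<noteq> l'"
  shows "(face_sign \<tau> l :: 'k::field) * face_sign (\<tau> - {l}) l' =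
    - (face_sign \<tau> l' * face_sign (\<tau> - {l'}) l)"
proof (cases "l < l'")
  case True
  then show ?thesis using face_sign_swap_less assms by blast
next
  case False
  then have "(face_sign \<tau> l' :: 'k) * face_sign (\<tau> - {l'}) l =
    - (face_sign \<tau> l * face_sign (\<tau> - {l}) l')"
    using assms by (intro face_sign_swap_less) auto
  then show ?thesis by simp
qed

text \<open>The double sum runs over ordered pairs of deleted elements. \<open>Lo\<close> and
  \<open>Hi\<close> are the two orders; they are exchanged by swapping and contribute opposite
  signs.\<close>

lemma coboundary_coboundary:
  assumes "finite \<tau>"
  shows "coboundary (coboundary c) \<tau> = (0 :: 'k::field)"
proof -
  define f where "f = (\<lambda>(l, l'). (face_sign \<tau> l :: 'k) * (face_sign (\<tau> - {l}) l' * c (\<tau> - {l} - {l'})))"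
  define Lo where "Lo = {(l, l'). l \<in> \<tau> \<and> l' \<in> \<tau> \<and> l < l'}"
  define Hi where "Hi = {(l, l'). l \<in> \<tau> \<and> l' \<in> \<tau> \<and> l' < l}"
  have "Lo \<subseteq> \<tau> \<times> \<tau>" "Hi \<subseteq> \<tau> \<times> \<tau>" by (auto simp: Lo_def Hi_def)
  then have fin: "finite Lo" "finite Hi" using assms by (meson finite_SigmaI finite_subset)+
  have "coboundary (coboundary c) \<tau> = (\<Sum>l\<in>\<tau>. \<Sum>l'\<in>\<tau> - {l}. f (l, l'))"
    by (simp add: coboundary_def f_def sum_distrib_left)
  also have "\<dots> = sum f (Sigma \<tau> (\<lambda>l. \<tau> - {l}))"
    using assms by (subst sum.Sigma) auto
  also have "(Sigma \<tau> (\<lambda>l. \<tau> - {l})) = Lo \<union> Hi" by (auto simp: Lo_def Hi_def)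
  also have "sum f (Lo \<union> Hi) = sum f Lo + sum f Hi"
    by (intro sum.union_disjoint fin) (use Lo_def Hi_def in fastforce)
  also have "sum f Hi = (\<Sum>p\<in>Lo. f (prod.swap p))"
  proof (rule sum.reindex_bij_betw[symmetric])
    show "bij_betw prod.swap Lo Hi"
      by (rule bij_betw_byWitness[where f' = prod.swap]) (force simp: Lo_def Hi_def)+
  qed
  also have "\<dots> = (\<Sum>p\<in>Lo. - f p)"
  proof (rule sum.cong[OF refl])
    fix p assume "p \<in> Lo"
    then obtain l l' where p: "p = (l, l')" "l \<in> \<tau>" "l' \<in> \<tau>" "l < l'" by (auto simp: Lo_def)
    have "(face_sign \<tau> l :: 'k) * face_sign (\<tau> - {l}) l' * c (\<tau> - {l} - {l'}) =
        - (face_sign \<tau> l' * face_sign (\<tau> - {l'}) l) * c (\<tau> - {l} - {l'})"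
      using face_sign_swap_less[OF assms p(2,4), where 'k = 'k] by simp
    moreover have "\<tau> - {l'} - {l} = \<tau> - {l} - {l'}" by auto
    ultimately show "f (prod.swap p) = - f p" by (simp add: f_def p mult.assoc)
  qed
  finally show ?thesis by (simp add: sum_negf)
qed

lemma coboundary_cong:
  assumes "\<And>l. l \<in> \<tau> \<Longrightarrow> c (\<tau> - {l}) = c' (\<tau> - {l})"
  shows "coboundary c \<tau> = coboundary c' \<tau>"
  unfolding coboundary_def by (rule sum.cong) (simp_all add: assms)

lemma coboundary_zero:
  assumes "\<And>l. l \<in> \<tau> \<Longrightarrow> c (\<tau> - {l}) = 0"
  shows "coboundary c \<tau> = 0"
  unfolding coboundary_def by (rule sum.neutral) (simp add: assms)

lemma coboundary_add: "coboundary (\<lambda>\<sigma>. c \<sigma> + c' \<sigma>) \<tau> = coboundary c \<tau> + coboundary c' \<tau>"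
  unfolding coboundary_def by (simp add: distrib_left sum.distrib)

lemma coboundary_diff: "coboundary (\<lambda>\<sigma>. c \<sigma> - c' \<sigma>) \<tau> = coboundary c \<tau> - coboundary c' \<tau>"
  unfolding coboundary_def by (simp add: right_diff_distrib sum_subtractf)

section \<open>Cochains supported on convex families\<close>

definition convex_family :: "nat set set \<Rightarrow> bool" where
  "convex_family P \<longleftrightarrow> (\<forall>\<sigma>\<in>P. finite \<sigma>) \<and> (\<forall>\<rho> \<sigma> \<tau>. \<rho> \<in> P \<longrightarrow> \<tau> \<in> P \<longrightarrow> \<rho> \<subseteq> \<sigma> \<longrightarrow> \<sigma> \<subseteq> \<tau> \<longrightarrow> \<sigma> \<in> P)"

lemma convex_family_finite: "convex_family P \<Longrightarrow> \<sigma> \<in> P \<Longrightarrow> finite \<sigma>"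
  unfolding convex_family_def by blast

lemma convex_familyD: "convex_family P \<Longrightarrow> \<rho> \<in> P \<Longrightarrow> \<tau> \<in> P \<Longrightarrow> \<rho> \<subseteq> \<sigma> \<Longrightarrow> \<sigma> \<subseteq> \<tau> \<Longrightarrow> \<sigma> \<in> P"
  unfolding convex_family_def by blast

text \<open>A convex family is a simplicial complex minus a subcomplex, and this is its relative
  cochain complex. Cutting the coboundary off outside \<open>P\<close> loses nothing: if
  \<open>c\<close> is nonzero at \<open>\<tau> - {l} - {l'}\<close>, this set and \<tau> lie in
  \<open>P\<close>, hence so does \<open>\<tau> - {l}\<close> between them.\<close>

lemma coboundary_coboundary_convex:
  fixes c :: "nat set \<Rightarrow> 'k::field"
  assumes "convex_family P" "\<tau> \<in> P" "\<And>\<sigma>. c \<sigma> \<noteq> 0 \<Longrightarrow> \<sigma> \<in> P"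
  shows "coboundary (\<lambda>\<sigma>. if \<sigma> \<in> P then coboundary c \<sigma> else 0) \<tau> = 0"
proof -
  have "coboundary (\<lambda>\<sigma>. if \<sigma> \<in> P then coboundary c \<sigma> else 0) \<tau> = coboundary (coboundary c) \<tau>"
  proof (rule coboundary_cong)
    fix l assume l: "l \<in> \<tau>"
    show "(if \<tau> - {l} \<in> P then coboundary c (\<tau> - {l}) else 0) = coboundary c (\<tau> - {l})"
    proof (cases "\<tau> - {l} \<in> P")
      case False
      have "c (\<tau> - {l} - {l'}) = 0" for l'
      proof (rule ccontr)
        assume "c (\<tau> - {l} - {l'}) \<noteq> 0"
        then have "\<tau> - {l} - {l'} \<in> P" using assms by auto
        then have "\<tau> - {l} \<in> P" by (rule convex_familyD[OF assms(1) _ assms(2)]) auto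
        then show False using False by simp
      qed
      then show ?thesis using False by (simp add: coboundary_zero)
    qed simp
  qed
  then show ?thesis using coboundary_coboundary[OF convex_family_finite[OF assms(1,2)]] by metis
qed

text \<open>In degree 0 only \<open>b = 0\<close> is admissible: no set has cardinality \<open>-1\<close>.\<close>

definition acyclic_at :: "'k::field itself \<Rightarrow> nat set set \<Rightarrow> nat \<Rightarrow> bool" where
  "acyclic_at _ P q \<longleftrightarrow> (\<forall>c :: nat set \<Rightarrow> 'k.
     (\<forall>\<sigma>. c \<sigma> \<noteq> 0 \<longrightarrow> \<sigma> \<in> P \<and> card \<sigma> = q) \<longrightarrow> (\<forall>\<tau>\<in>P. card \<tau> = Suc q \<longrightarrow> coboundary c \<tau> = 0) \<longrightarrow>
     (\<exists>b. (\<forall>\<sigma>. b \<sigma> \<noteq> 0 \<longrightarrow> \<sigma> \<in> P \<and> Suc (card \<sigma>) = q) \<and> (\<forall>\<tau>\<in>P. card \<tau> = q \<longrightarrow> coboundary b \<tau> = c \<tau>)))"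

lemma acyclic_atI:
  assumes "\<And>c :: nat set \<Rightarrow> 'k::field. (\<And>\<sigma>. c \<sigma> \<noteq> 0 \<Longrightarrow> \<sigma> \<in> P \<and> card \<sigma> = q) \<Longrightarrow>
    (\<And>\<tau>. \<tau> \<in> P \<Longrightarrow> card \<tau> = Suc q \<Longrightarrow> coboundary c \<tau> = 0) \<Longrightarrow>
    \<exists>b. (\<forall>\<sigma>. b \<sigma> \<noteq> 0 \<longrightarrow> \<sigma> \<in> P \<and> Suc (card \<sigma>) = q) \<and> (\<forall>\<tau>\<in>P. card \<tau> = q \<longrightarrow> coboundary b \<tau> = c \<tau>)"
  shows "acyclic_at TYPE('k) P q"
  unfolding acyclic_at_def by (intro allI impI, rule assms) simp_all

lemma acyclic_atD:
  fixes c :: "nat set \<Rightarrow> 'k::field"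
  assumes "acyclic_at TYPE('k) P q" "\<And>\<sigma>. c \<sigma> \<noteq> 0 \<Longrightarrow> \<sigma> \<in> P \<and> card \<sigma> = q"
    "\<And>\<tau>. \<tau> \<in> P \<Longrightarrow> card \<tau> = Suc q \<Longrightarrow> coboundary c \<tau> = 0"
  shows "\<exists>b. (\<forall>\<sigma>. b \<sigma> \<noteq> 0 \<longrightarrow> \<sigma> \<in> P \<and> Suc (card \<sigma>) = q) \<and> (\<forall>\<tau>\<in>P. card \<tau> = q \<longrightarrow> coboundary b \<tau> = c \<tau>)"
  by (rule assms(1)[unfolded acyclic_at_def, rule_format]) (simp_all add: assms(2,3))

lemma acyclic_at_empty_degree:
  assumes "\<And>\<sigma>. \<sigma> \<in> P \<Longrightarrow> card \<sigma> \<noteq> q"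
  shows "acyclic_at TYPE('k::field) P q"
proof (rule acyclic_atI)
  fix c :: "nat set \<Rightarrow> 'k"
  have "coboundary (\<lambda>_. 0 :: 'k) \<tau> = 0" for \<tau> by (rule coboundary_zero) simp
  then show "\<exists>b :: nat set \<Rightarrow> 'k. (\<forall>\<sigma>. b \<sigma> \<noteq> 0 \<longrightarrow> \<sigma> \<in> P \<and> Suc (card \<sigma>) = q) \<and>
      (\<forall>\<tau>\<in>P. card \<tau> = q \<longrightarrow> coboundary b \<tau> = c \<tau>)"
    using assms by (intro exI[of _ "\<lambda>_. 0"]) simp
qed

lemma coboundary_degree:
  fixes b :: "nat set \<Rightarrow> 'k::field"
  assumes "\<And>\<sigma>. b \<sigma> \<noteq> 0 \<Longrightarrow> Suc (card \<sigma>) = q" "finite \<tau>" "card \<tau> \<noteq> q"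
  shows "coboundary b \<tau> = 0"
proof (rule coboundary_zero)
  fix l assume "l \<in> \<tau>"
  then have "Suc (card (\<tau> - {l})) = card \<tau>" by (rule card_Suc_Diff1[OF assms(2)])
  then show "b (\<tau> - {l}) = 0" using assms by metis
qed

section \<open>The long exact sequence of a lower part\<close>

definition lower_part :: "nat set set \<Rightarrow> nat set set \<Rightarrow> bool" where
  "lower_part Q P \<longleftrightarrow> Q \<subseteq> P \<and> (\<forall>\<sigma>\<in>P. \<forall>\<tau>\<in>Q. \<sigma> \<subseteq> \<tau> \<longrightarrow> \<sigma> \<in> Q)"

lemma lower_partD: "lower_part Q P \<Longrightarrow> \<tau> \<in> Q \<Longrightarrow> \<sigma> \<in> P \<Longrightarrow> \<sigma> \<subseteq> \<tau> \<Longrightarrow> \<sigma> \<in> Q"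
  by (auto simp: lower_part_def)

text \<open>The coboundary passes from smaller to larger sets, so the cochains on
  \<open>P - Q\<close> form a subcomplex of those on \<open>P\<close>, with quotient the cochains on
  \<open>Q\<close>. This lemma and the next two are the exactness statements of the resulting long
  exact sequence. Here \<open>c\<close> is first solved on \<open>Q\<close>; the remainder lives on
  \<open>P - Q\<close>.\<close>

lemma acyclic_at_extension:
  assumes P: "convex_family P" and Q: "lower_part Q P"
    and vQ: "acyclic_at TYPE('k::field) Q q" and vR: "acyclic_at TYPE('k) (P - Q) q"
  shows "acyclic_at TYPE('k) P q"
proof (rule acyclic_atI)
  fix c :: "nat set \<Rightarrow> 'k"
  assume c: "\<And>\<sigma>. c \<sigma> \<noteq> 0 \<Longrightarrow> \<sigma> \<in> P \<and> card \<sigma> = q"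
    and dc: "\<And>\<tau>. \<tau> \<in> P \<Longrightarrow> card \<tau> = Suc q \<Longrightarrow> coboundary c \<tau> = 0"
  have QP: "Q \<subseteq> P" using Q by (simp add: lower_part_def)
  have fin: "finite \<sigma>" if "\<sigma> \<in> P" for \<sigma> using convex_family_finite[OF P that] .
  define c1 where "c1 = (\<lambda>\<sigma>. if \<sigma> \<in> Q then c \<sigma> else 0)"
  have A1: "coboundary c1 \<tau> = 0" if \<tau>: "\<tau> \<in> Q" "card \<tau> = Suc q" for \<tau>
  proof -
    have "coboundary c1 \<tau> = coboundary c \<tau>"
      using lower_partD[OF Q \<tau>(1)] c by (intro coboundary_cong) (auto simp: c1_def)
    then show ?thesis using dc \<tau> QP by auto
  qed
  have A2: "\<sigma> \<in> Q \<and> card \<sigma> = q" if "c1 \<sigma> \<noteq> 0" for \<sigma>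
    using that c by (auto simp: c1_def split: if_splits)
  obtain b1 where b1: "\<And>\<sigma>. b1 \<sigma> \<noteq> 0 \<Longrightarrow> \<sigma> \<in> Q \<and> Suc (card \<sigma>) = q"
    and db1: "\<And>\<tau>. \<tau> \<in> Q \<Longrightarrow> card \<tau> = q \<Longrightarrow> coboundary b1 \<tau> = c1 \<tau>"
    using acyclic_atD[OF vQ A2 A1] by blast
  define c2 where "c2 = (\<lambda>\<sigma>. c \<sigma> - (if \<sigma> \<in> P then coboundary b1 \<sigma> else 0))"
  have c2: "\<sigma> \<in> P - Q \<and> card \<sigma> = q" if nz: "c2 \<sigma> \<noteq> 0" for \<sigma>
  proof -
    have "\<sigma> \<in> P" using nz c by (auto simp: c2_def split: if_splits)
    moreover have "card \<sigma> = q"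
    proof (rule ccontr)
      assume "card \<sigma> \<noteq> q"
      then have "coboundary b1 \<sigma> = 0" "c \<sigma> = 0"
        using coboundary_degree[of b1 q \<sigma>] b1 fin \<open>\<sigma> \<in> P\<close> c by auto
      then show False using nz by (simp add: c2_def split: if_splits)
    qed
    moreover have "\<sigma> \<notin> Q"
      using nz db1 \<open>card \<sigma> = q\<close> \<open>\<sigma> \<in> P\<close> by (auto simp: c2_def c1_def)
    ultimately show ?thesis by simp
  qed
  have A3: "coboundary c2 \<tau> = 0" if \<tau>: "\<tau> \<in> P - Q" "card \<tau> = Suc q" for \<tau>
  proof -
    have "coboundary (\<lambda>\<sigma>. if \<sigma> \<in> P then coboundary b1 \<sigma> else 0) \<tau> = 0"
      by (rule coboundary_coboundary_convex[OF P]) (use \<tau> b1 QP in blast)+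
    then show ?thesis unfolding c2_def coboundary_diff using dc \<tau> by simp
  qed
  obtain b2 where b2: "\<And>\<sigma>. b2 \<sigma> \<noteq> 0 \<Longrightarrow> \<sigma> \<in> P - Q \<and> Suc (card \<sigma>) = q"
    and db2: "\<And>\<tau>. \<tau> \<in> P - Q \<Longrightarrow> card \<tau> = q \<Longrightarrow> coboundary b2 \<tau> = c2 \<tau>"
    using acyclic_atD[OF vR c2 A3] by blast
  show "\<exists>b. (\<forall>\<sigma>. b \<sigma> \<noteq> 0 \<longrightarrow> \<sigma> \<in> P \<and> Suc (card \<sigma>) = q) \<and> (\<forall>\<tau>\<in>P. card \<tau> = q \<longrightarrow> coboundary b \<tau> = c \<tau>)"
  proof (intro exI[of _ "\<lambda>\<sigma>. b1 \<sigma> + b2 \<sigma>"] conjI allI impI ballI)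
    fix \<sigma> assume "b1 \<sigma> + b2 \<sigma> \<noteq> 0"
    then have "b1 \<sigma> \<noteq> 0 \<or> b2 \<sigma> \<noteq> 0" by auto
    then show "\<sigma> \<in> P" "Suc (card \<sigma>) = q" using b1 b2 QP by blast+
  next
    fix \<tau> assume \<tau>: "\<tau> \<in> P" "card \<tau> = q"
    show "coboundary (\<lambda>\<sigma>. b1 \<sigma> + b2 \<sigma>) \<tau> = c \<tau>"
    proof (cases "\<tau> \<in> Q")
      case True
      have "coboundary b2 \<tau> = 0"
        by (rule coboundary_zero) (use b2 lower_partD[OF Q True] in blast)
      then show ?thesis using db1 True \<tau> by (simp add: coboundary_add c1_def)
    next
      case False
      then show ?thesis using db2 \<tau> by (simp add: coboundary_add c2_def)
    qed
  qed
qed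

text \<open>A cocycle on \<open>P - Q\<close> is bounded on \<open>P\<close> by some
  \<open>b\<close>. The restriction of \<open>b\<close> to \<open>Q\<close> is a cocycle one degree
  lower, and subtracting the coboundary of its solution \<open>b0\<close> moves \<open>b\<close> off
  \<open>Q\<close>.\<close>

lemma acyclic_at_upper_part:
  assumes P: "convex_family P" and Q: "lower_part Q P"
    and vP: "acyclic_at TYPE('k::field) P q" and vQ: "q > 0 \<Longrightarrow> acyclic_at TYPE('k) Q (q - 1)"
  shows "acyclic_at TYPE('k) (P - Q) q"
proof (rule acyclic_atI)
  fix c :: "nat set \<Rightarrow> 'k"
  assume c: "\<And>\<sigma>. c \<sigma> \<noteq> 0 \<Longrightarrow> \<sigma> \<in> P - Q \<and> card \<sigma> = q"
    and dc: "\<And>\<tau>. \<tau> \<in> P - Q \<Longrightarrow> card \<tau> = Suc q \<Longrightarrow> coboundary c \<tau> = 0"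
  have QP: "Q \<subseteq> P" using Q by (simp add: lower_part_def)
  have A1: "coboundary c \<tau> = 0" if "\<tau> \<in> P" "card \<tau> = Suc q" for \<tau>
  proof (cases "\<tau> \<in> Q")
    case True
    show ?thesis by (rule coboundary_zero) (use c lower_partD[OF Q True] in blast)
  qed (use dc that in auto)
  have A2: "\<sigma> \<in> P \<and> card \<sigma> = q" if "c \<sigma> \<noteq> 0" for \<sigma> using c[OF that] by blast
  obtain b where b: "\<And>\<sigma>. b \<sigma> \<noteq> 0 \<Longrightarrow> \<sigma> \<in> P \<and> Suc (card \<sigma>) = q"
    and db: "\<And>\<tau>. \<tau> \<in> P \<Longrightarrow> card \<tau> = q \<Longrightarrow> coboundary b \<tau> = c \<tau>"
    using acyclic_atD[OF vP A2 A1] by blast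
  show "\<exists>b. (\<forall>\<sigma>. b \<sigma> \<noteq> 0 \<longrightarrow> \<sigma> \<in> P - Q \<and> Suc (card \<sigma>) = q) \<and> (\<forall>\<tau>\<in>P - Q. card \<tau> = q \<longrightarrow>
    coboundary b \<tau> = c \<tau>)"
  proof (cases q)
    case 0
    then show ?thesis using b db by (intro exI[of _ b]) auto
  next
    case (Suc p)
    define b1 where "b1 = (\<lambda>\<sigma>. if \<sigma> \<in> Q then b \<sigma> else 0)"
    have A3: "coboundary b1 \<tau> = 0" if \<tau>: "\<tau> \<in> Q" "card \<tau> = Suc p" for \<tau>
    proof -
      have "coboundary b1 \<tau> = coboundary b \<tau>"
        using lower_partD[OF Q \<tau>(1)] b by (intro coboundary_cong) (auto simp: b1_def)
      also have "\<dots> = c \<tau>" using db \<tau> QP Suc by auto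
      also have "\<dots> = 0" using c \<tau> by blast
      finally show ?thesis .
    qed
    have A4: "\<sigma> \<in> Q \<and> card \<sigma> = p" if "b1 \<sigma> \<noteq> 0" for \<sigma>
      using that b Suc by (auto simp: b1_def split: if_splits)
    have A5: "acyclic_at TYPE('k) Q p" using vQ Suc by simp
    obtain b0 where b0: "\<And>\<sigma>. b0 \<sigma> \<noteq> 0 \<Longrightarrow> \<sigma> \<in> Q \<and> Suc (card \<sigma>) = p"
      and db0: "\<And>\<tau>. \<tau> \<in> Q \<Longrightarrow> card \<tau> = p \<Longrightarrow> coboundary b0 \<tau> = b1 \<tau>"
      using acyclic_atD[OF A5 A4 A3] by blast
    define b2 where "b2 = (\<lambda>\<sigma>. b \<sigma> - (if \<sigma> \<in> P then coboundary b0 \<sigma> else 0))"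
    have fin: "finite \<sigma>" if "\<sigma> \<in> P" for \<sigma> using convex_family_finite[OF P that] .
    have "\<sigma> \<in> P - Q \<and> Suc (card \<sigma>) = q" if nz: "b2 \<sigma> \<noteq> 0" for \<sigma>
    proof -
      have "\<sigma> \<in> P" using nz b by (auto simp: b2_def split: if_splits)
      moreover have "card \<sigma> = p"
      proof (rule ccontr)
        assume "card \<sigma> \<noteq> p"
        then have "coboundary b0 \<sigma> = 0" "b \<sigma> = 0"
          using coboundary_degree[of b0 p \<sigma>] b0 fin \<open>\<sigma> \<in> P\<close> b Suc by auto
        then show False using nz by (simp add: b2_def split: if_splits)
      qed
      moreover have "\<sigma> \<notin> Q"
        using nz db0 \<open>card \<sigma> = p\<close> \<open>\<sigma> \<in> P\<close> by (auto simp: b2_def b1_def)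
      ultimately show ?thesis using Suc by simp
    qed
    moreover have "coboundary b2 \<tau> = c \<tau>" if "\<tau> \<in> P - Q" "card \<tau> = q" for \<tau>
    proof -
      have "coboundary (\<lambda>\<sigma>. if \<sigma> \<in> P then coboundary b0 \<sigma> else 0) \<tau> = 0"
        by (rule coboundary_coboundary_convex[OF P]) (use that b0 QP in blast)+
      then show ?thesis unfolding b2_def coboundary_diff using db that by simp
    qed
    ultimately show ?thesis by blast
  qed
qed

text \<open>The connecting homomorphism: the coboundary in \<open>P\<close> of a cocycle of
  \<open>Q\<close> is a cocycle on \<open>P - Q\<close> one degree higher. If \<open>b\<close>
  bounds it, then \<open>c - b\<close> is a cocycle on \<open>P\<close>, and its solution restricts
  to one for \<open>c\<close>.\<close>

lemma acyclic_at_lower_part: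
  assumes P: "convex_family P" and Q: "lower_part Q P"
    and vP: "acyclic_at TYPE('k::field) P q" and vR: "acyclic_at TYPE('k) (P - Q) (Suc q)"
  shows "acyclic_at TYPE('k) Q q"
proof (rule acyclic_atI)
  fix c :: "nat set \<Rightarrow> 'k"
  assume c: "\<And>\<sigma>. c \<sigma> \<noteq> 0 \<Longrightarrow> \<sigma> \<in> Q \<and> card \<sigma> = q"
    and dc: "\<And>\<tau>. \<tau> \<in> Q \<Longrightarrow> card \<tau> = Suc q \<Longrightarrow> coboundary c \<tau> = 0"
  have QP: "Q \<subseteq> P" using Q by (simp add: lower_part_def)
  have fin: "finite \<sigma>" if "\<sigma> \<in> P" for \<sigma> using convex_family_finite[OF P that] .
  define c' where "c' = (\<lambda>\<sigma>. if \<sigma> \<in> P then coboundary c \<sigma> else 0)"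
  have c': "\<sigma> \<in> P - Q \<and> card \<sigma> = Suc q" if nz: "c' \<sigma> \<noteq> 0" for \<sigma>
  proof -
    have "\<sigma> \<in> P" using nz by (auto simp: c'_def split: if_splits)
    moreover have "card \<sigma> = Suc q"
    proof (rule ccontr)
      assume "card \<sigma> \<noteq> Suc q"
      then have "coboundary c \<sigma> = 0"
        using coboundary_degree[of c "Suc q" \<sigma>] fin \<open>\<sigma> \<in> P\<close> c by auto
      then show False using nz by (simp add: c'_def split: if_splits)
    qed
    ultimately show ?thesis using nz dc by (auto simp: c'_def)
  qed
  have A1: "coboundary c' \<tau> = 0" if "\<tau> \<in> P - Q" for \<tau>
    unfolding c'_def by (rule coboundary_coboundary_convex[OF P]) (use that c QP in blast)+
  obtain b where b: "\<And>\<sigma>. b \<sigma> \<noteq> 0 \<Longrightarrow> \<sigma> \<in> P - Q \<and> Suc (card \<sigma>) = Suc q"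
    and db: "\<And>\<tau>. \<tau> \<in> P - Q \<Longrightarrow> card \<tau> = Suc q \<Longrightarrow> coboundary b \<tau> = c' \<tau>"
    using acyclic_atD[OF vR c' A1] by blast
  have bQ: "coboundary b \<tau> = 0" if "\<tau> \<in> Q" for \<tau>
    by (rule coboundary_zero) (use b lower_partD[OF Q that] in blast)
  have A2: "coboundary (\<lambda>\<sigma>. c \<sigma> - b \<sigma>) \<tau> = 0" if "\<tau> \<in> P" "card \<tau> = Suc q" for \<tau>
    using that dc bQ db by (cases "\<tau> \<in> Q") (auto simp: coboundary_diff c'_def)
  have A3: "\<sigma> \<in> P \<and> card \<sigma> = q" if "c \<sigma> - b \<sigma> \<noteq> 0" for \<sigma>
  proof -
    have "c \<sigma> \<noteq> 0 \<or> b \<sigma> \<noteq> 0" using that by auto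
    then show ?thesis using b c QP by auto
  qed
  obtain b' where b': "\<And>\<sigma>. b' \<sigma> \<noteq> 0 \<Longrightarrow> \<sigma> \<in> P \<and> Suc (card \<sigma>) = q"
    and db': "\<And>\<tau>. \<tau> \<in> P \<Longrightarrow> card \<tau> = q \<Longrightarrow> coboundary b' \<tau> = c \<tau> - b \<tau>"
    using acyclic_atD[OF vP, of "\<lambda>\<sigma>. c \<sigma> - b \<sigma>"] A2 A3 by blast
  show "\<exists>b. (\<forall>\<sigma>. b \<sigma> \<noteq> 0 \<longrightarrow> \<sigma> \<in> Q \<and> Suc (card \<sigma>) = q) \<and> (\<forall>\<tau>\<in>Q. card \<tau> = q \<longrightarrow> coboundary b \<tau> = c \<tau>)"
  proof (intro exI[of _ "\<lambda>\<sigma>. if \<sigma> \<in> Q then b' \<sigma> else 0"] conjI allI impI ballI)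
    fix \<tau> assume \<tau>: "\<tau> \<in> Q" "card \<tau> = q"
    have "coboundary (\<lambda>\<sigma>. if \<sigma> \<in> Q then b' \<sigma> else 0) \<tau> = coboundary b' \<tau>"
      using lower_partD[OF Q \<tau>(1)] b' by (intro coboundary_cong) auto
    also have "\<dots> = c \<tau> - b \<tau>" using db' \<tau> QP by auto
    also have "b \<tau> = 0" using b \<tau> by blast
    finally show "coboundary (\<lambda>\<sigma>. if \<sigma> \<in> Q then b' \<sigma> else 0) \<tau> = c \<tau>" by simp
  qed (use b' in \<open>auto split: if_splits\<close>)
qed

section \<open>Cones and contracting homotopies\<close>

lemma sign_transfer:
  fixes a b c d :: "'k::field"
  assumes "a * b = - (c * d)" "a * a = 1" "d * d = 1"
  shows "b * d = - (a * c)"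
proof -
  have "b * d = (a * a) * (b * d)" by (simp only: assms(2) mult_1_left)
  also have "\<dots> = (a * b) * (a * d)" by (simp only: ac_simps)
  also have "\<dots> = - (a * c) * (d * d)" unfolding assms(1) by (simp add: ac_simps)
  finally show ?thesis by (simp only: assms(3) mult_1_right)
qed

text \<open>Membership in \<open>P\<close> does not depend on \<open>v\<close>, so evaluating
  \<open>c\<close> after adding \<open>v\<close>, up to sign, is a contracting homotopy. On sets
  containing \<open>v\<close> the identity is immediate; on the others it is the cocycle condition
  at \<open>insert v \<tau>\<close>.\<close>

lemma acyclic_at_cone:
  assumes fin: "\<And>\<sigma>. \<sigma> \<in> P \<Longrightarrow> finite \<sigma>"
    and cone: "\<And>\<sigma>. insert v \<sigma> \<in> P \<longleftrightarrow> \<sigma> - {v} \<in> P"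
  shows "acyclic_at TYPE('k::field) P q"
proof (rule acyclic_atI)
  fix c :: "nat set \<Rightarrow> 'k"
  assume c: "\<And>\<sigma>. c \<sigma> \<noteq> 0 \<Longrightarrow> \<sigma> \<in> P \<and> card \<sigma> = q"
    and dc: "\<And>\<tau>. \<tau> \<in> P \<Longrightarrow> card \<tau> = Suc q \<Longrightarrow> coboundary c \<tau> = 0"
  define b where "b = (\<lambda>\<sigma>. if v \<in> \<sigma> then 0 else face_sign (insert v \<sigma>) v * c (insert v \<sigma>))"
  show "\<exists>b. (\<forall>\<sigma>. b \<sigma> \<noteq> 0 \<longrightarrow> \<sigma> \<in> P \<and> Suc (card \<sigma>) = q) \<and> (\<forall>\<tau>\<in>P. card \<tau> = q \<longrightarrow> coboundary b \<tau> = c \<tau>)"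
  proof (intro exI[of _ b] conjI allI impI ballI)
    fix \<sigma> assume "b \<sigma> \<noteq> 0"
    then have v: "v \<notin> \<sigma>" "c (insert v \<sigma>) \<noteq> 0" by (auto simp: b_def split: if_splits)
    then have *: "insert v \<sigma> \<in> P" "card (insert v \<sigma>) = q" using c by auto
    then show "\<sigma> \<in> P" using cone[of \<sigma>] v by simp
    then show "Suc (card \<sigma>) = q" using * v fin by simp
  next
    fix \<tau> assume \<tau>: "\<tau> \<in> P" "card \<tau> = q"
    have f: "finite \<tau>" using fin \<tau> by simp
    show "coboundary b \<tau> = c \<tau>"
    proof (cases "v \<in> \<tau>")
      case True
      have "coboundary b \<tau> = (\<Sum>l\<in>\<tau>. if l = v then c \<tau> else 0)"
        unfolding coboundary_def
      proof (rule sum.cong[OF refl])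
        fix l assume "l \<in> \<tau>"
        have "insert v (\<tau> - {v}) = \<tau>" using True by auto
        then show "face_sign \<tau> l * b (\<tau> - {l}) = (if l = v then c \<tau> else 0)"
          using True by (auto simp: b_def mult.assoc[symmetric])
      qed
      then show ?thesis using True f by simp
    next
      case False
      let ?t = "insert v \<tau>"
      have "?t \<in> P" using cone[of \<tau>] False \<tau> by simp
      then have "coboundary c ?t = 0" using dc False f \<tau> by simp
      moreover have "coboundary c ?t = face_sign ?t v * c \<tau> + (\<Sum>l\<in>\<tau>. face_sign ?t l * c (?t - {l}))"
        using False f by (simp add: coboundary_def)
      ultimately have "face_sign ?t v * c \<tau> = - (\<Sum>l\<in>\<tau>. face_sign ?t l * c (?t - {l}))"
        by (simp only: eq_neg_iff_add_eq_0)
      then have "(face_sign ?t v * face_sign ?t v) * c \<tau> =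
        - (face_sign ?t v * (\<Sum>l\<in>\<tau>. face_sign ?t l * c (?t - {l})))"
        by (simp only: mult.assoc mult_minus_right)
      then have "c \<tau> = (\<Sum>l\<in>\<tau>. - (face_sign ?t v * face_sign ?t l * c (?t - {l})))"
        by (simp only: face_sign_sq mult_1_left mult.assoc sum_distrib_left sum_negf)
      also have "\<dots> = coboundary b \<tau>"
        unfolding coboundary_def
      proof (rule sum.cong[OF refl])
        fix l assume l: "l \<in> \<tau>"
        have ne: "l \<noteq> v" using l False by auto
        have e1: "?t - {v} = \<tau>" using False by auto
        have e2: "insert v (\<tau> - {l}) = ?t - {l}" using ne by auto
        have "(face_sign ?t v :: 'k) * face_sign (?t - {v}) l =
          - (face_sign ?t l * face_sign (?t - {l}) v)"
          using l ne f by (intro face_sign_swap) auto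
        then have "(face_sign ?t v :: 'k) * face_sign \<tau> l =
          - (face_sign ?t l * face_sign (?t - {l}) v)" by (simp only: e1)
        then have s: "face_sign \<tau> l * face_sign (?t - {l}) v =
          - (face_sign ?t v * face_sign ?t l :: 'k)"
          by (rule sign_transfer) simp_all
        have "b (\<tau> - {l}) = face_sign (?t - {l}) v * c (?t - {l})"
          using False by (simp add: b_def e2)
        then have "face_sign \<tau> l * b (\<tau> - {l}) =
          (face_sign \<tau> l * face_sign (?t - {l}) v) * c (?t - {l})"
          by (simp only: mult.assoc)
        then show "- (face_sign ?t v * face_sign ?t l * c (?t - {l})) = face_sign \<tau> l * b (\<tau> - {l})"
          by (simp only: s mult_minus_left)
      qed
      finally show ?thesis by simp
    qed
  qed
qed

section \<open>Gluing complexes by Mayer-Vietoris\<close>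

definition acyclic_from :: "'k::field itself \<Rightarrow> nat set set \<Rightarrow> nat \<Rightarrow> bool" where
  "acyclic_from K P m \<longleftrightarrow> (\<forall>q\<ge>m. acyclic_at K P q)"

lemma acyclic_from_mono: "acyclic_from K P m \<Longrightarrow> m \<le> m' \<Longrightarrow> acyclic_from K P m'"
  by (simp add: acyclic_from_def)

text \<open>Simplicial complexes whose faces are all enlarged by a fixed set \<open>N\<close>; this
  shift is why \<open>card N\<close> appears in the vanishing bounds.\<close>

definition downset :: "nat set \<Rightarrow> nat set set \<Rightarrow> bool" where
  "downset N P \<longleftrightarrow> (\<forall>\<sigma>\<in>P. N \<subseteq> \<sigma> \<and> finite \<sigma> \<and> (\<forall>\<rho>. N \<subseteq> \<rho> \<longrightarrow> \<rho> \<subseteq> \<sigma> \<longrightarrow> \<rho> \<in> P))"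

lemma downsetI:
  assumes "\<And>\<sigma>. \<sigma> \<in> P \<Longrightarrow> N \<subseteq> \<sigma>" "\<And>\<sigma>. \<sigma> \<in> P \<Longrightarrow> finite \<sigma>"
    "\<And>\<rho> \<sigma>. \<sigma> \<in> P \<Longrightarrow> N \<subseteq> \<rho> \<Longrightarrow> \<rho> \<subseteq> \<sigma> \<Longrightarrow> \<rho> \<in> P"
  shows "downset N P"
  using assms unfolding downset_def by blast

lemma downset_finite: "downset N P \<Longrightarrow> \<sigma> \<in> P \<Longrightarrow> finite \<sigma>"
  unfolding downset_def by blast

lemma downsetD: "downset N P \<Longrightarrow> \<sigma> \<in> P \<Longrightarrow> N \<subseteq> \<rho> \<Longrightarrow> \<rho> \<subseteq> \<sigma> \<Longrightarrow> \<rho> \<in> P"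
  unfolding downset_def by blast

lemma downset_base: "downset N P \<Longrightarrow> \<sigma> \<in> P \<Longrightarrow> N \<subseteq> \<sigma>"
  unfolding downset_def by blast

lemma downset_convex: "downset N P \<Longrightarrow> convex_family P"
  unfolding convex_family_def
  by (intro conjI ballI allI impI) (erule (1) downset_finite, metis downsetD downset_base
    order_trans)

lemma downset_UN:
  assumes "\<And>i. i \<in> I \<Longrightarrow> downset N (A i)"
  shows "downset N (\<Union>i\<in>I. A i)"
proof (rule downsetI)
  fix \<sigma> assume "\<sigma> \<in> (\<Union>i\<in>I. A i)"
  then obtain i where i: "i \<in> I" "\<sigma> \<in> A i" by (rule UN_E)
  show "N \<subseteq> \<sigma>" "finite \<sigma>" using downset_base[OF assms i(2)] downset_finite[OF assms i(2)] i(1)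
    by simp_all
next
  fix \<rho> \<sigma> assume "\<sigma> \<in> (\<Union>i\<in>I. A i)" and *: "N \<subseteq> \<rho>" "\<rho> \<subseteq> \<sigma>"
  then obtain i where i: "i \<in> I" "\<sigma> \<in> A i" by (elim UN_E)
  then show "\<rho> \<in> (\<Union>i\<in>I. A i)" using downsetD[OF assms[OF i(1)] i(2) *] by (intro UN_I)
qed

lemma downset_Un:
  assumes "downset N A" "downset N B"
  shows "downset N (A \<union> B)"
  using assms unfolding downset_def by (metis Un_iff)

lemma downset_Int:
  assumes "downset N A" "downset N B"
  shows "downset N (A \<inter> B)"
  using assms unfolding downset_def by (metis Int_iff)

lemma downset_lower_part:
  assumes "downset N Q" "downset N P" "Q \<subseteq> P"
  shows "lower_part Q P"
  unfolding lower_part_def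
proof (intro conjI ballI impI)
  fix \<sigma> \<tau> assume "\<sigma> \<in> P" "\<tau> \<in> Q" "\<sigma> \<subseteq> \<tau>"
  then show "\<sigma> \<in> Q" using downsetD[OF assms(1) _ downset_base[OF assms(2)]] by simp
qed (rule assms(3))

text \<open>Mayer-Vietoris by way of \<open>A \<union> B - A = B - A \<inter> B\<close>: the long
  exact sequence of \<open>B\<close> handles the difference, and extension by \<open>A\<close> gives
  the union. The connecting map is why the intersection has to vanish from one degree lower.\<close>

lemma acyclic_from_Un:
  assumes A: "downset N A" and B: "downset N B"
    and vA: "acyclic_from TYPE('k::field) A m" and vB: "acyclic_from TYPE('k) B m"
    and vAB: "acyclic_from TYPE('k) (A \<inter> B) (m - 1)"
  shows "acyclic_from TYPE('k) (A \<union> B) m"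
  unfolding acyclic_from_def
proof (intro allI impI)
  fix q assume q: "m \<le> q"
  have AB: "downset N (A \<inter> B)" by (rule downset_Int[OF A B])
  have "acyclic_at TYPE('k) (B - A \<inter> B) q"
    by (rule acyclic_at_upper_part[OF downset_convex[OF B] downset_lower_part[OF AB B]])
      (use q vB vAB in \<open>auto simp: acyclic_from_def\<close>)
  moreover have "A \<union> B - A = B - A \<inter> B" by auto
  ultimately have "acyclic_at TYPE('k) (A \<union> B - A) q" by simp
  then show "acyclic_at TYPE('k) (A \<union> B) q"
    by (intro acyclic_at_extension[OF downset_convex[OF downset_Un[OF A B]] downset_lower_part[OF A
      downset_Un[OF A B]]])
      (use q vA in \<open>auto simp: acyclic_from_def\<close>)
qed

lemma acyclic_from_empty: "acyclic_from TYPE('k::field) {} m"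
  unfolding acyclic_from_def by (auto intro: acyclic_at_empty_degree)

text \<open>If \<open>S\<close> is maximal in \<open>F\<close>, then \<open>D S\<close> meets the union of the other pieces in the union of the
  pieces strictly below \<open>S\<close>, whose bounds are smaller than that of \<open>S\<close>.\<close>

lemma acyclic_from_Union:
  fixes h :: "'u set \<Rightarrow> nat"
  assumes D: "\<And>S. downset N (D S)" and DI: "\<And>S T. D S \<inter> D T = D (S \<inter> T)"
  assumes "finite F" and "\<And>S T. S \<in> F \<Longrightarrow> T \<in> F \<Longrightarrow> S \<inter> T \<in> F"
    and "\<And>S. S \<in> F \<Longrightarrow> acyclic_from TYPE('k::field) (D S) (h S)"
    and "\<And>S T. S \<in> F \<Longrightarrow> T \<in> F \<Longrightarrow> T \<subset> S \<Longrightarrow> h T = 0 \<or> h T < h S"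
    and "\<And>S. S \<in> F \<Longrightarrow> h S \<le> m"
  shows "acyclic_from TYPE('k) (\<Union>S\<in>F. D S) m"
  using assms(3-)
proof (induction "card F" arbitrary: F m rule: less_induct)
  case less
  show ?case
  proof (cases "F = {}")
    case True
    then show ?thesis by (simp add: acyclic_from_empty)
  next
    case False
    obtain S where S: "S \<in> F" and max: "\<And>T. T \<in> F \<Longrightarrow> S \<subseteq> T \<Longrightarrow> S = T"
      using finite_has_maximal[OF less.prems(1) False] by blast
    define F1 where "F1 = F - {S}"
    define F2 where "F2 = {T \<in> F. T \<subset> S}"
    have sub: "F1 \<subseteq> F" "F2 \<subseteq> F" "S \<notin> F1" "S \<notin> F2" by (auto simp: F1_def F2_def)
    have fin: "finite F1" "finite F2" using sub less.prems(1) by (auto intro: finite_subset)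
    have "F1 \<subset> F" "F2 \<subset> F" using sub S by auto
    then have lt: "card F1 < card F" "card F2 < card F" using less.prems(1)
      by (auto intro: psubset_card_mono)
    have cl1: "T \<inter> T' \<in> F1" if "T \<in> F1" "T' \<in> F1" for T T'
    proof -
      have "T \<inter> T' \<in> F" using that sub less.prems(2) by blast
      moreover have "T \<inter> T' \<noteq> S"
      proof
        assume "T \<inter> T' = S"
        then have "S \<subseteq> T" by blast
        then show False using max[of T] that sub by blast
      qed
      ultimately show ?thesis by (simp add: F1_def)
    qed
    have v1: "acyclic_from TYPE('k) (\<Union>T\<in>F1. D T) m"
      by (rule less.hyps[OF lt(1) fin(1) cl1]) (use sub less.prems(3-) in blast)+
    have cl2: "T \<inter> T' \<in> F2" if "T \<in> F2" "T' \<in> F2" for T T'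
      using that less.prems(2)[of T T'] unfolding F2_def by blast
    have v2: "acyclic_from TYPE('k) (\<Union>T\<in>F2. D T) (m - 1)"
    proof (rule less.hyps[OF lt(2) fin(2) cl2])
      fix T assume "T \<in> F2"
      \<comment> \<open>A piece with bound 0 vanishes in every degree, so it fits under
        \<open>m - 1\<close> without a strict drop, also when \<open>m = 0\<close>.\<close>
      then have "h T = 0 \<or> h T < h S" "h S \<le> m" using less.prems(4,5) S by (auto simp: F2_def)
      then show "h T \<le> m - 1" by auto
    next
      fix T assume "T \<in> F2"
      then show "acyclic_from TYPE('k) (D T) (h T)" using less.prems(3) sub(2)
        by (simp add: subsetD)
    next
      fix T T' assume "T \<in> F2" "T' \<in> F2" "T' \<subset> T"
      then show "h T' = 0 \<or> h T' < h T" using less.prems(4) sub(2) by (simp add: subsetD)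
    qed
    have "(\<Union>T\<in>F1. D T) \<inter> D S = (\<Union>T\<in>F2. D T)"
    proof (intro equalityI subsetI)
      fix x assume "x \<in> (\<Union>T\<in>F1. D T) \<inter> D S"
      then obtain T where T: "T \<in> F1" "x \<in> D T" "x \<in> D S" by blast
      then have "x \<in> D (T \<inter> S)" using DI[of T S] by blast
      moreover have "T \<inter> S \<in> F2"
        using T(1) less.prems(2)[of T S] S max[of T] unfolding F1_def F2_def by blast
      ultimately show "x \<in> (\<Union>T\<in>F2. D T)" by blast
    next
      fix x assume "x \<in> (\<Union>T\<in>F2. D T)"
      then obtain T where T: "T \<in> F" "T \<subset> S" "x \<in> D T" by (auto simp: F2_def)
      moreover have "D T \<inter> D S = D T" using DI[of T S] T(2)
        by (simp add: Int_absorb2 psubset_imp_subset)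
      ultimately show "x \<in> (\<Union>T\<in>F1. D T) \<inter> D S" unfolding F1_def by blast
    qed
    then have v3: "acyclic_from TYPE('k) ((\<Union>T\<in>F1. D T) \<inter> D S) (m - 1)" using v2 by simp
    have "acyclic_from TYPE('k) ((\<Union>T\<in>F1. D T) \<union> D S) m"
      by (rule acyclic_from_Un[OF downset_UN[OF D] D v1 _ v3]) (use acyclic_from_mono
        less.prems(3,5) S in blast)
    moreover have "(\<Union>T\<in>F1. D T) \<union> D S = (\<Union>T\<in>F. D T)" using S by (auto simp: F1_def)
    ultimately show ?thesis by simp
  qed
qed

text \<open>A nontrivial interval is a cone over any element of \<open>W - N\<close>; an interval
  with one member has cohomology in degree \<open>card N\<close> only.\<close>

lemma acyclic_at_interval:
  assumes "finite W" "N \<noteq> W \<or> q \<noteq> card N"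
  shows "acyclic_at TYPE('k::field) {\<sigma>. N \<subseteq> \<sigma> \<and> \<sigma> \<subseteq> W} q"
proof (cases "N \<subset> W")
  case True
  then obtain w where "w \<in> W" "w \<notin> N" by blast
  then show ?thesis
    by (intro acyclic_at_cone[where v = w]) (use finite_subset[OF _ assms(1)] in blast)+
next
  case False
  show ?thesis
  proof (rule acyclic_at_empty_degree)
    fix \<sigma> assume "\<sigma> \<in> {\<sigma>. N \<subseteq> \<sigma> \<and> \<sigma> \<subseteq> W}"
    then have "\<sigma> = N" "N = W" using False by auto
    then show "card \<sigma> \<noteq> q" using assms(2) by auto
  qed
qed

section \<open>Matchings in gap-free graphs\<close>

primrec has_matching :: "('u \<Rightarrow> 'u \<Rightarrow> bool) \<Rightarrow> nat \<Rightarrow> 'u set \<Rightarrow> bool" where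
  "has_matching h 0 W = True"
| "has_matching h (Suc k) W = (\<exists>u\<in>W. \<exists>v\<in>W. h u v \<and> has_matching h k (W - {u, v}))"

text \<open>The elements of \<open>S\<close> count fully because a face adjacent to them may be used arbitrarily
  often in the localization.\<close>

definition deficient :: "('u \<Rightarrow> 'u \<Rightarrow> bool) \<Rightarrow> nat \<Rightarrow> 'u set \<Rightarrow> 'u set set" where
  "deficient h s U = {S. S \<subseteq> U \<and> \<not> has_matching h (s - card S) (U - S)}"

definition isolates :: "('u \<Rightarrow> 'u \<Rightarrow> bool) \<Rightarrow> 'u set \<Rightarrow> 'u set \<Rightarrow> bool" where
  "isolates h U S \<longleftrightarrow> (\<exists>v\<in>U - S. \<forall>w\<in>U - S. \<not> h v w)"

text \<open>This is what makes the missed faces vanish in all degrees. Pieces grow with their index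
  set, so a cofinal \<open>F\<close> covers everything; pieces intersect as their index sets do, so
  closure under intersection allows gluing; and each piece is a cone over an isolated
  vertex.\<close>

definition isolating_cover :: "('u \<Rightarrow> 'u \<Rightarrow> bool) \<Rightarrow> nat \<Rightarrow> 'u set \<Rightarrow> bool" where
  "isolating_cover h s U \<longleftrightarrow> (\<exists>F\<subseteq>deficient h s U. (\<forall>S\<in>F. \<forall>T\<in>F. S \<inter> T \<in> F) \<and>
     (\<forall>S\<in>deficient h s U. \<exists>T\<in>F. S \<subseteq> T) \<and> (\<forall>S\<in>F. isolates h U S))"

section \<open>Matchings and deficient sets\<close>

lemma has_matching_mono: "has_matching h k W \<Longrightarrow> W \<subseteq> W' \<Longrightarrow> has_matching h k W'"
proof (induction k arbitrary: W W')
  case (Suc k)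
  then obtain u v where "u \<in> W" "v \<in> W" "h u v" "has_matching h k (W - {u, v})" by auto
  moreover from this have "has_matching h k (W' - {u, v})" using Suc.IH Suc.prems(2)
    by (meson Diff_mono order_refl)
  ultimately show ?case using Suc.prems(2) by auto
qed simp

lemma has_matching_SucD: "has_matching h (Suc k) W \<Longrightarrow> has_matching h k W"
  using has_matching_mono[of h k _ W] by auto

lemma has_matching_le: "has_matching h k W \<Longrightarrow> j \<le> k \<Longrightarrow> has_matching h j W"
  by (induction k) (use has_matching_SucD le_Suc_eq in blast)+

text \<open>At most one edge of a matching contains \<open>x\<close>, and only that edge is
  lost.\<close>

lemma has_matching_remove: "has_matching h k W \<Longrightarrow> has_matching h (k - 1) (W - {x})"
proof (induction k arbitrary: W)
  case (Suc k)
  then obtain u v where uv: "u \<in> W" "v \<in> W" "h u v" "has_matching h k (W - {u, v})" by auto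
  show ?case
  proof (cases "x = u \<or> x = v")
    case True
    then have "W - {u, v} \<subseteq> W - {x}" by auto
    then show ?thesis using has_matching_mono[OF uv(4)] by simp
  next
    case False
    have *: "has_matching h (k - 1) (W - {u, v} - {x})" by (rule Suc.IH[OF uv(4)])
    have "W - {u, v} - {x} = W - {x} - {u, v}" by auto
    then have "has_matching h (Suc (k - 1)) (W - {x})" using uv * False by auto
    then show ?thesis by (cases k) simp_all
  qed
qed simp

lemma has_matching_remove_set:
  assumes "finite S" "has_matching h k W"
  shows "has_matching h (k - card S) (W - S)"
  using assms
proof (induction S rule: finite_induct)
  case (insert x S)
  then have "has_matching h (k - card S - 1) (W - S - {x})" by (intro has_matching_remove) auto
  moreover have "W - S - {x} = W - insert x S" by auto
  ultimately show ?case using insert by simp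
qed simp

lemma has_matching_1_iff: "has_matching h 1 W \<longleftrightarrow> (\<exists>u\<in>W. \<exists>v\<in>W. h u v)"
  by simp

lemma has_matching_2_iff: "has_matching h 2 W \<longleftrightarrow>
  (\<exists>a\<in>W. \<exists>b\<in>W. \<exists>c\<in>W. \<exists>d\<in>W. h a b \<and> h c d \<and> a \<noteq> c \<and> a \<noteq> d \<and> b \<noteq> c \<and> b \<noteq> d)"
  by (simp add: numeral_2_eq_2) blast

lemma has_matching_3_iff: "has_matching h 3 W \<longleftrightarrow> (\<exists>a\<in>W. \<exists>b\<in>W. h a b \<and> has_matching h 2 (W - {a, b}))"
  by (simp add: eval_nat_numeral)

lemma has_matching_2I: "a \<in> W \<Longrightarrow> b \<in> W \<Longrightarrow> c \<in> W \<Longrightarrow> d \<in> W \<Longrightarrow> h a b \<Longrightarrow> h c d \<Longrightarrow> a \<noteq> c \<Longrightarrow> a \<noteq> d \<Longrightarrow>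
    b \<noteq> c \<Longrightarrow> b \<noteq> d \<Longrightarrow> has_matching h 2 W"
  unfolding has_matching_2_iff by blast

lemma has_matching_3I: "h a b \<Longrightarrow> h c d \<Longrightarrow> h e f \<Longrightarrow> {a, b, c, d, e, f} \<subseteq> W \<Longrightarrow>
    {a, b} \<inter> {c, d} = {} \<Longrightarrow> {a, b} \<inter> {e, f} = {} \<Longrightarrow> {c, d} \<inter> {e, f} = {} \<Longrightarrow> has_matching h 3 W"
  unfolding has_matching_3_iff
    by (intro bexI conjI, assumption, rule has_matching_2I[of c _ d e f]) auto

text \<open>The sum of \<open>card S\<close> and the matching number of \<open>U - S\<close> cannot
  decrease as \<open>S\<close> grows: a vertex moved into \<open>S\<close> destroys at most one
  matching edge and counts for one itself.\<close>

lemma deficient_down: "finite U \<Longrightarrow> T \<in> deficient h s U \<Longrightarrow> S \<subseteq> T \<Longrightarrow> S \<in> deficient h s U"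
proof -
  assume U: "finite U" and T: "T \<in> deficient h s U" and ST: "S \<subseteq> T"
  have fin: "finite T" "finite S" using U T ST by (auto simp: deficient_def intro: finite_subset)
  have "has_matching h (s - card T) (U - T)" if "has_matching h (s - card S) (U - S)"
  proof -
    have "has_matching h (s - card S - card (T - S)) (U - S - (T - S))"
      by (rule has_matching_remove_set[OF _ that]) (use fin in simp)
    moreover have "U - S - (T - S) = U - T" using ST by auto
    moreover have "s - card S - card (T - S) = s - card T"
      using fin ST by (simp add: card_Diff_subset card_mono)
    ultimately show ?thesis by simp
  qed
  then show ?thesis using T ST unfolding deficient_def by blast
qed

lemma deficient_card: "S \<in> deficient h s U \<Longrightarrow> card S < s"
  by (rule ccontr) (simp add: deficient_def)

lemma deficientI: "S \<subseteq> U \<Longrightarrow> card S + k = s \<Longrightarrow> \<not> has_matching h k (U - S) \<Longrightarrow> S \<in> deficient h s U"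
  unfolding deficient_def by auto

lemma deficientD: "S \<in> deficient h s U \<Longrightarrow> card S + k = s \<Longrightarrow> \<not> has_matching h k (U - S)"
  unfolding deficient_def by auto

lemma deficient_subset: "S \<in> deficient h s U \<Longrightarrow> S \<subseteq> U"
  unfolding deficient_def by auto

lemma isolatesI: "v \<in> U - S \<Longrightarrow> (\<And>w. w \<in> U - S \<Longrightarrow> \<not> h v w) \<Longrightarrow> isolates h U S"
  unfolding isolates_def by blast

text \<open>Take for \<open>F\<close> the deficient sets containing a fixed set \<open>R\<close>.
  They are closed under intersection because subsets of deficient sets are deficient, and cofinal
  because \<open>R\<close> can always be added.\<close>

lemma isolating_cover_cone:
  assumes "finite U" "\<And>S. S \<in> deficient h s U \<Longrightarrow> S \<union> R \<in> deficient h s U"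
    "\<And>S. S \<in> deficient h s U \<Longrightarrow> R \<subseteq> S \<Longrightarrow> isolates h U S"
  shows "isolating_cover h s U"
  unfolding isolating_cover_def
proof (intro exI[of _ "{S \<in> deficient h s U. R \<subseteq> S}"] conjI ballI)
  fix S T assume "S \<in> {S \<in> deficient h s U. R \<subseteq> S}" "T \<in> {S \<in> deficient h s U. R \<subseteq> S}"
  then show "S \<inter> T \<in> {S \<in> deficient h s U. R \<subseteq> S}"
    using deficient_down[OF assms(1), of S h s "S \<inter> T"] by simp
next
  fix S assume "S \<in> deficient h s U"
  then show "\<exists>T\<in>{S \<in> deficient h s U. R \<subseteq> S}. S \<subseteq> T" using assms(2)[of S]
    by (intro bexI[of _ "S \<union> R"]) auto
qed (use assms(3) in auto)

lemma isolating_cover_all: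
  assumes "finite U" "\<And>S. S \<in> deficient h s U \<Longrightarrow> isolates h U S"
  shows "isolating_cover h s U"
  by (rule isolating_cover_cone[OF assms(1), of h s "{}"]) (use assms in auto)

text \<open>If \<open>p\<close> were in \<open>S\<close>, the other \<open>card S - 1\<close>
  elements would destroy at most that many of the \<open>s - 1\<close> edges avoiding
  \<open>p\<close>, and \<open>s - card S\<close> disjoint edges would survive outside
  \<open>S\<close>.\<close>

lemma deficient_avoids:
  assumes "finite U" "p \<in> U" "has_matching h (s - 1) (U - {p})" "S \<in> deficient h s U"
  shows "p \<notin> S"
proof
  assume p: "p \<in> S"
  have fin: "finite S" using finite_subset[OF deficient_subset[OF assms(4)] assms(1)] .
  have "has_matching h (s - 1 - card (S - {p})) (U - {p} - (S - {p}))"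
    by (rule has_matching_remove_set[OF _ assms(3)]) (use fin in simp)
  moreover have "U - {p} - (S - {p}) = U - S" using p by auto
  moreover have "s - 1 - card (S - {p}) = s - card S" using p fin card_Suc_Diff1[OF fin p] by simp
  ultimately show False using assms(4) by (simp add: deficient_def)
qed

lemma has_matching_isolated:
  assumes "has_matching h k W" "\<And>w. w \<in> W \<Longrightarrow> \<not> h p w \<and> \<not> h w p"
  shows "has_matching h k (W - {p})"
  using assms
proof (induction k arbitrary: W)
  case (Suc k)
  then obtain u v where uv: "u \<in> W" "v \<in> W" "h u v" "has_matching h k (W - {u, v})" by auto
  have "has_matching h k (W - {u, v} - {p})" by (rule Suc.IH[OF uv(4)]) (use Suc.prems in auto)
  moreover have "W - {u, v} - {p} = W - {p} - {u, v}" by auto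
  moreover have "u \<noteq> p" "v \<noteq> p" using uv Suc.prems(2) by auto
  ultimately show ?case using uv by auto
qed simp

text \<open>An abstract relation, since it will be applied to copies of vertices: repeating vertices
  creates no gaps.\<close>

locale gapfree =
  fixes h :: "'u \<Rightarrow> 'u \<Rightarrow> bool"
  assumes sym: "h u v \<Longrightarrow> h v u"
    and irr: "\<not> h u u"
    and gf: "h a b \<Longrightarrow> h c d \<Longrightarrow> h a c \<or> h a d \<or> h b c \<or> h b d"
begin

section \<open>Isolating covers in gap-free graphs\<close>

lemma isolating_cover_isolated:
  assumes "finite U" "p \<in> U" "\<And>w. w \<in> U \<Longrightarrow> \<not> h p w" "has_matching h (s - 1) U"
  shows "isolating_cover h s U"
proof (rule isolating_cover_all[OF assms(1)])
  fix S assume S: "S \<in> deficient h s U"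
  \<comment> \<open>No matching uses the isolated vertex \<open>p\<close>, so \<open>p\<close> lies
    in no deficient set and remains as isolated vertex of every \<open>U - S\<close>.\<close>
  have "has_matching h (s - 1) (U - {p})"
    by (rule has_matching_isolated[OF assms(4)]) (use assms(3) sym in blast)
  then have "p \<notin> S" by (rule deficient_avoids[OF assms(1,2) _ S])
  then show "isolates h U S" by (intro isolatesI[of p]) (use assms in auto)
qed

lemma isolating_cover_matching:
  assumes "finite U" "has_matching h s U"
  shows "isolating_cover h s U"
proof (rule isolating_cover_all[OF assms(1)])
  fix S assume S: "S \<in> deficient h s U"
  have "finite S" using finite_subset[OF deficient_subset[OF S] assms(1)] .
  then have "has_matching h (s - card S) (U - S)" by (rule has_matching_remove_set[OF _ assms(2)])
  then show "isolates h U S" using S by (simp add: deficient_def)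
qed

lemma isolating_cover_stable:
  assumes "finite U" "s \<le> card U" "\<not> has_matching h 1 U"
  shows "isolating_cover h s U"
proof (rule isolating_cover_all[OF assms(1)])
  fix S assume S: "S \<in> deficient h s U"
  then have "card S < card U" "S \<subseteq> U" using deficient_card[OF S] deficient_subset[OF S] assms(2)
    by auto
  then obtain v where "v \<in> U - S" by (metis Diff_eq_empty_iff equals0I less_irrefl subset_antisym)
  then show "isolates h U S" by (rule isolatesI) (use assms(3) \<open>v \<in> U - S\<close> in auto)
qed

text \<open>If no vertex meets all edges, take an edge \<open>u v\<close>. An edge avoiding
  \<open>u\<close> and an edge avoiding \<open>v\<close> must both meet it; they are
  \<open>v w\<close> and \<open>u t\<close>, and \<open>t = w\<close>, as otherwise they would be
  disjoint. Every further edge meets all three sides of this triangle and therefore lies in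
  it.\<close>

lemma star_or_triangle:
  assumes "has_matching h 1 W" "\<not> has_matching h 2 W"
  shows "(\<exists>c\<in>W. \<forall>u\<in>W - {c}. \<forall>v\<in>W - {c}. \<not> h u v) \<or>
    (\<exists>x\<in>W. \<exists>y\<in>W. \<exists>z\<in>W. h x y \<and> h y z \<and> h x z \<and> (\<forall>u\<in>W. \<forall>v\<in>W. h u v \<longrightarrow> {u, v} \<subseteq> {x, y, z}))"
proof (cases "\<exists>c\<in>W. \<forall>u\<in>W - {c}. \<forall>v\<in>W - {c}. \<not> h u v")
  case False
  have no2: False if "a \<in> W" "b \<in> W" "c \<in> W" "d \<in> W" "h a b" "h c d" "a \<noteq> c" "a \<noteq> d" "b \<noteq> c" "b \<noteq> d"
    for a b c d
    using has_matching_2I[of a W b c d h] that assms(2) by blast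
  have avoid: "\<exists>p q. p \<in> W \<and> q \<in> W \<and> p \<noteq> c \<and> q \<noteq> c \<and> h p q" if "c \<in> W" for c
    using False that by blast
  obtain u v where uv: "u \<in> W" "v \<in> W" "h u v" using assms(1) by auto
  have ne: "u \<noteq> v" using uv irr by metis
  obtain p q where pq: "p \<in> W" "q \<in> W" "p \<noteq> u" "q \<noteq> u" "h p q" using avoid[OF uv(1)] by blast
  have "p = v \<or> q = v" using no2[of u v p q] uv pq by blast
  then obtain w where w: "w \<in> W" "w \<noteq> u" "w \<noteq> v" "h v w" using pq sym irr by metis
  obtain p q where pq: "p \<in> W" "q \<in> W" "p \<noteq> v" "q \<noteq> v" "h p q" using avoid[OF uv(2)] by blast
  have "p = u \<or> q = u" using no2[of u v p q] uv pq by blast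
  then obtain t where t: "t \<in> W" "t \<noteq> u" "t \<noteq> v" "h u t" using pq sym irr by metis
  have "t = w" using no2[of v w u t] uv w t ne by blast
  then have tri: "h u v" "h v w" "h u w" using uv w t by auto
  have "{a, b} \<subseteq> {u, v, w}" if ab: "a \<in> W" "b \<in> W" "h a b" for a b
  proof -
    have "a \<in> {u, v} \<or> b \<in> {u, v}" using no2[of u v a b] uv ab by blast
    moreover have "a \<in> {v, w} \<or> b \<in> {v, w}" using no2[of v w a b] uv ab w by blast
    moreover have "a \<in> {u, w} \<or> b \<in> {u, w}" using no2[of u w a b] uv ab w tri by blast
    ultimately show ?thesis using irr[of a] ab(3) ne w by auto
  qed
  then show ?thesis using uv w tri by blast
qed simp

lemma isolating_cover_1:
  assumes "finite U" "1 \<le> card U"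
  shows "isolating_cover h 1 U"
proof (cases "has_matching h 1 U")
  case True
  then show ?thesis using assms(1) by (rule isolating_cover_matching[rotated])
next
  case False
  then show ?thesis using assms isolating_cover_stable by blast
qed

lemma adjacent_distinct: "h x y \<Longrightarrow> x \<noteq> y"
  using irr by auto

text \<open>What remains after the easy cases is a star or a triangle without further vertices. In a
  star with at least two leaves only subsets of the centre are deficient, and removing the centre
  isolates the leaves. In a triangle deleting any vertex leaves an edge, so only the empty set is
  deficient, and it isolates nothing.\<close>

lemma isolating_cover_2:
  assumes U: "finite U" "3 \<le> card U"
  shows "isolating_cover h 2 U \<or> card U = 3 \<and> deficient h 2 U \<subseteq> {{}}"
proof (rule disjCI)
  assume no: "\<not> (card U = 3 \<and> deficient h 2 U \<subseteq> {{}})"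
  show "isolating_cover h 2 U"
  proof (cases "has_matching h 2 U \<or> \<not> has_matching h 1 U \<or> (\<exists>p\<in>U. \<forall>w\<in>U. \<not> h p w)")
    case True
    moreover have "isolating_cover h 2 U" if "p \<in> U" "\<forall>w\<in>U. \<not> h p w" "has_matching h 1 U" for p
      using isolating_cover_isolated[OF U(1) that(1), of 2] that by simp
    moreover have "isolating_cover h 2 U" if "has_matching h 2 U"
      using isolating_cover_matching[OF U(1) that] .
    moreover have "isolating_cover h 2 U" if "\<not> has_matching h 1 U"
      using isolating_cover_stable[OF U(1) _ that] U by simp
    ultimately show ?thesis by blast
  next
    case False
    then have "has_matching h 1 U" "\<not> has_matching h 2 U" and noiso: "\<And>p. p \<in> U \<Longrightarrow> \<exists>w\<in>U. h p w"
      by blast+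
    from star_or_triangle[OF this(1,2)] show ?thesis
    proof (elim disjE bexE conjE)
      fix c assume c: "c \<in> U" and ind: "\<forall>u\<in>U - {c}. \<forall>v\<in>U - {c}. \<not> h u v"
      have cB: "h c p" if "p \<in> U - {c}" for p using noiso[of p] ind that sym by blast
      have cg: "{c} \<in> deficient h 2 U" using ind c by (intro deficientI[where k = 1]) auto
      have cU: "card (U - {c}) = card U - 1" using c U by simp
      have sub: "S \<subseteq> {c}" if S: "S \<in> deficient h 2 U" for S
      proof (rule ccontr)
        assume "\<not> S \<subseteq> {c}"
        then obtain p where p: "p \<in> S" "p \<noteq> c" by auto
        have fS: "finite S" using finite_subset[OF deficient_subset[OF S] U(1)] .
        have "S = {p}"
          using deficient_card[OF S] p(1) fS card_le_Suc0_iff_eq[OF fS] by auto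
        \<comment> \<open>A second leaf exists as \<open>card U\<close> is at least 3, and its edge
          to \<open>c\<close> survives the removal of \<open>p\<close>.\<close>
        moreover have "U - {c} - {p} \<noteq> {}"
        proof
          assume "U - {c} - {p} = {}"
          then have "U \<subseteq> {c, p}" by auto
          then have "card U \<le> 2" using card_mono[of "{c, p}" U] card_insert_le_m1[of 2 "{p}" c]
            by simp
          then show False using U by simp
        qed
        ultimately obtain q where "q \<in> U - S" "q \<noteq> c" by auto
        then have "has_matching h 1 (U - S)" using cB[of q] c p \<open>S = {p}\<close> by auto
        moreover have "card S + 1 = 2" using \<open>S = {p}\<close> by simp
        ultimately show False using deficientD[OF S] by blast
      qed
      show ?thesis
      proof (rule isolating_cover_cone[OF U(1), of _ _ "{c}"])
        fix S assume S: "S \<in> deficient h 2 U"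
        have "S \<union> {c} = {c}" using sub[OF S] by auto
        then show "S \<union> {c} \<in> deficient h 2 U" using cg by (simp only:)
        assume "{c} \<subseteq> S"
        then have "S = {c}" using sub[OF S] by auto
        moreover have "card (U - {c}) \<noteq> 0" using cU U by simp
        then have "U - {c} \<noteq> {}" by (metis card.empty)
        then obtain q where "q \<in> U - {c}" by blast
        ultimately show "isolates h U S" by (intro isolatesI[of q]) (use ind in auto)
      qed
    next
      fix x y z assume xyz: "x \<in> U" "y \<in> U" "z \<in> U" "h x y" "h y z" "h x z"
        and all: "\<forall>u\<in>U. \<forall>v\<in>U. h u v \<longrightarrow> {u, v} \<subseteq> {x, y, z}"
      have ne: "x \<noteq> y" "y \<noteq> z" "x \<noteq> z" using xyz adjacent_distinct by blast+
      have UT: "U = {x, y, z}" using noiso all xyz by blast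
      have "card U = 3" using UT ne by simp
      moreover have "S = {}" if S: "S \<in> deficient h 2 U" for S
      proof (rule ccontr)
        assume "S \<noteq> {}"
        then obtain p where p: "p \<in> S" by auto
        have fS: "finite S" using finite_subset[OF deficient_subset[OF S] U(1)] .
        have Sp: "S = {p}"
          using deficient_card[OF S] p(1) fS card_le_Suc0_iff_eq[OF fS] by auto
        have "p \<in> {x, y, z}" using p deficient_subset[OF S] UT by auto
        then have "has_matching h 1 (U - S)" unfolding Sp UT has_matching_1_iff using ne xyz(4-6)
          by auto
        moreover have "card S + 1 = 2" using Sp by simp
        ultimately show False using deficientD[OF S] by blast
      qed
      ultimately show ?thesis using no by blast
    qed
  qed
qed

lemma diff_nonempty:
  assumes "finite A" "card A < card B"
  shows "\<exists>v. v \<in> B - A"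
proof (rule ccontr)
  assume "\<nexists>v. v \<in> B - A"
  then have "B \<subseteq> A" by auto
  then have "card B \<le> card A" by (rule card_mono[OF assms(1)])
  then show False using assms(2) by linarith
qed

text \<open>In a star the critical sets are deficient pairs \<open>S0\<close> avoiding the centre
  \<open>c\<close>: they meet all edges, so every vertex other than \<open>c\<close> and outside
  \<open>S0\<close> is isolated in \<open>U\<close>. There are \<open>card U - 3\<close> such
  vertices. If \<open>card U = 4\<close> there is just one, which a deficient set may contain, so
  only the empty set is certain to isolate it.\<close>

lemma isolating_cover_matching_number_1:
  assumes U: "finite U" "4 \<le> card U" and m: "has_matching h 1 U" "\<not> has_matching h 2 U"
  shows "isolating_cover h 3 U \<or> card U = 4 \<and> isolates h U {}"
  using star_or_triangle[OF m]
proof (elim disjE bexE conjE)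
  fix c assume c: "c \<in> U" and ind: "\<forall>u\<in>U - {c}. \<forall>v\<in>U - {c}. \<not> h u v"
  have fin: "finite S" if "S \<in> deficient h 3 U" for S
    using finite_subset[OF deficient_subset[OF that] U(1)] .
  have good_c: "isolates h U S" if S: "S \<in> deficient h 3 U" "c \<in> S" for S
  proof -
    have "card S < card U" using deficient_card[OF S(1)] U by simp
    then obtain v where "v \<in> U - S" using diff_nonempty[OF fin[OF S(1)]] by blast
    then show ?thesis by (rule isolatesI) (use ind S(2) \<open>v \<in> U - S\<close> in blast)
  qed
  show ?thesis
  proof (cases "\<exists>S0\<in>deficient h 3 U. c \<notin> S0 \<and> card S0 = 2")
    case True
    then obtain S0 where S0: "S0 \<in> deficient h 3 U" "c \<notin> S0" "card S0 = 2" by blast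
    have "\<not> has_matching h 1 (U - S0)" using deficientD[OF S0(1), of 1] S0(3) by simp
    then have iso: "\<not> h p w" if "p \<in> U - S0 - {c}" "w \<in> U" for p w
    proof (cases "w = c")
      case True
      then show ?thesis using \<open>\<not> has_matching h 1 (U - S0)\<close> that c S0(2)
        unfolding has_matching_1_iff by blast
    next
      case False
      then show ?thesis using ind that by blast
    qed
    have cc: "card (U - S0 - {c}) = card U - 3"
      using S0 c U fin[OF S0(1)] deficient_subset[OF S0(1)] by (simp add: card_Diff_subset)
    show ?thesis
    proof (cases "card U = 4")
      case True
      then have "card (U - S0 - {c}) \<noteq> 0" using cc by simp
      then have "U - S0 - {c} \<noteq> {}" by (metis card.empty)
      then obtain p where "p \<in> U - S0 - {c}" by blast
      then have "isolates h U {}" by (intro isolatesI[of p]) (use iso in auto)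
      then show ?thesis using True by simp
    next
      case False
      have "isolates h U S" if S: "S \<in> deficient h 3 U" for S
      proof -
        consider "c \<in> S" | "c \<notin> S" "card S \<le> 1" | "c \<notin> S" "card S = 2" using deficient_card[OF S]
          by linarith
        then show ?thesis
        proof cases
          case 2
          have "card S < card (U - S0 - {c})" using 2 cc False U by simp
          then obtain p where "p \<in> U - S0 - {c} - S" using diff_nonempty[OF fin[OF S]] by blast
          then show ?thesis by (intro isolatesI[of p]) (use iso in auto)
        next
          \<comment> \<open>No edge survives outside \<open>S\<close>, and \<open>c\<close> is still
            there to serve as the isolated vertex.\<close>
          case 3
          then have "\<not> has_matching h 1 (U - S)" using deficientD[OF S, of 1] by simp
          then show ?thesis using 3 c by (intro isolatesI[of c]) auto
        qed (rule good_c[OF S])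
      qed
      then show ?thesis using isolating_cover_all[OF U(1)] by blast
    qed
  next
    case False
    \<comment> \<open>Without such a pair, a deficient set avoiding \<open>c\<close> has at most one
      element; adding \<open>c\<close> kills all edges and keeps the size below 3.\<close>
    have "isolating_cover h 3 U"
    proof (rule isolating_cover_cone[OF U(1), of _ _ "{c}"])
      fix S assume S: "S \<in> deficient h 3 U"
      show "S \<union> {c} \<in> deficient h 3 U"
      proof (cases "c \<in> S")
        case True
        then show ?thesis using S by (simp add: insert_absorb)
      next
        case cS: False
        then have "card S \<le> 1" using False S deficient_card[OF S] by force
        moreover have "card (S \<union> {c}) = card S + 1" using cS fin[OF S] by simp
        moreover have "\<not> has_matching h 1 (U - (S \<union> {c}))" using ind by auto
        ultimately have "\<not> has_matching h (3 - card (S \<union> {c})) (U - (S \<union> {c}))"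
          using has_matching_le[of h "3 - card (S \<union> {c})" "U - (S \<union> {c})" 1] by linarith
        then show ?thesis using deficient_subset[OF S] c unfolding deficient_def by auto
      qed
      show "isolates h U S" if "{c} \<subseteq> S" using good_c[OF S] that by blast
    qed
    then show ?thesis by simp
  qed
next
  fix x y z assume xyz: "x \<in> U" "y \<in> U" "z \<in> U" "h x y" "h y z" "h x z"
    and all: "\<forall>u\<in>U. \<forall>v\<in>U. h u v \<longrightarrow> {u, v} \<subseteq> {x, y, z}"
  have ne: "x \<noteq> y" "y \<noteq> z" "x \<noteq> z" using xyz adjacent_distinct by blast+
  define P where "P = U - {x, y, z}"
  have iso: "\<not> h p w" if "p \<in> P" "w \<in> U" for p w using all that unfolding P_def by blast
  have "card {x, y, z} = 3" using ne by simp
  then have cP: "card P = card U - 3" unfolding P_def using xyz by (subst card_Diff_subset) auto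
  show ?thesis
  proof (cases "card U = 4")
    case True
    then have "card P \<noteq> 0" using cP by simp
    then have "P \<noteq> {}" by (metis card.empty)
    then obtain p where "p \<in> P" by blast
    then have "isolates h U {}" by (intro isolatesI[of p]) (use iso P_def in auto)
    then show ?thesis using True by simp
  next
    case False
    \<comment> \<open>At least two isolated vertices lie outside the triangle. A deficient set
      containing them all would consist of exactly two of them and leave the edges of the triangle
      intact.\<close>
    have "isolates h U S" if S: "S \<in> deficient h 3 U" for S
    proof (cases "P \<subseteq> S")
      case True
      have fS: "finite S" using finite_subset[OF deficient_subset[OF S] U(1)] .
      have "card P \<ge> 2" using cP False U by simp
      then have "S = P" using deficient_card[OF S] card_seteq[OF fS True] by simp
      then have "card S + 1 = 3" using \<open>card P \<ge> 2\<close> deficient_card[OF S] by simp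
      moreover have "has_matching h 1 (U - S)" unfolding \<open>S = P\<close> P_def has_matching_1_iff
        using xyz ne by auto
      ultimately show ?thesis using deficientD[OF S] by blast
    next
      case False
      then obtain p where "p \<in> P" "p \<notin> S" by blast
      then show ?thesis by (intro isolatesI[of p]) (use iso P_def in auto)
    qed
    then show ?thesis using isolating_cover_all[OF U(1)] by blast
  qed
qed

text \<open>The deficient pair \<open>{x, y}\<close> meets every edge. Besides a matching
  \<open>x p\<close>, \<open>y q\<close> there is a fifth vertex \<open>l\<close>, contained in no
  deficient set, whose neighbours \<open>R\<close> lie in \<open>{x, y}\<close>. Adding
  \<open>R\<close> to a deficient set isolates \<open>l\<close>; the work is to see that the result
  is still deficient.\<close>

lemma isolating_cover_of_pair:
  assumes U: "finite U" "5 \<le> card U" and m: "has_matching h 2 U"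
    and S0: "S0 \<in> deficient h 3 U" "card S0 = 2"
  shows "isolating_cover h 3 U"
proof -
  have fin: "finite S" if "S \<in> deficient h 3 U" for S
    using finite_subset[OF deficient_subset[OF that] U(1)] .
  obtain x y where xy: "S0 = {x, y}" "x \<noteq> y" using S0(2) by (auto simp: card_2_iff)
  have xyU: "x \<in> U" "y \<in> U" using deficient_subset[OF S0(1)] xy by auto
  have "\<not> has_matching h 1 (U - S0)" using deficientD[OF S0(1), of 1] S0(2) by simp
  then have ind: "u \<in> {x, y} \<or> v \<in> {x, y}" if "u \<in> U" "v \<in> U" "h u v" for u v
    using that unfolding has_matching_1_iff xy(1) by blast
  obtain a b c d where abcd: "a \<in> U" "b \<in> U" "c \<in> U" "d \<in> U" "h a b" "h c d"
    "a \<noteq> c" "a \<noteq> d" "b \<noteq> c" "b \<noteq> d" using m unfolding has_matching_2_iff by blast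
  have ab: "a \<noteq> b" "c \<noteq> d" using abcd adjacent_distinct by blast+
  have "\<exists>p q. p \<in> U - {x, y} \<and> q \<in> U - {x, y} \<and> h x p \<and> h y q \<and> p \<noteq> q"
    using ind[OF abcd(1,2,5)] ind[OF abcd(3,4,6)] abcd ab sym[OF abcd(5)] sym[OF abcd(6)] by auto
  then obtain p q where pq: "p \<in> U" "q \<in> U" "p \<notin> {x, y}" "q \<notin> {x, y}" "h x p" "h y q" "p \<noteq> q"
    by blast
  have "card {x, y, p, q} = 4" using pq xy by auto
  then obtain l where l: "l \<in> U" "l \<notin> {x, y, p, q}"
    using diff_nonempty[of "{x, y, p, q}" U] U by fastforce
  have "has_matching h 2 (U - {l})"
    by (rule has_matching_2I[of x _ p y q]) (use pq l xy xyU in auto)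
  then have avoid: "l \<notin> S" if "S \<in> deficient h 3 U" for S
    using deficient_avoids[OF U(1) l(1) _ that] by simp
  define R where "R = {w \<in> U. h l w}"
  have RS: "R \<subseteq> {x, y}" using ind l unfolding R_def by blast
  show ?thesis
  proof (rule isolating_cover_cone[OF U(1), of _ _ R])
    fix S assume S: "S \<in> deficient h 3 U"
    have lS: "l \<notin> S" using avoid[OF S] .
    show "isolates h U S" if "R \<subseteq> S" by (rule isolatesI[of l]) (use that l lS R_def in auto)
    show "S \<union> R \<in> deficient h 3 U"
    proof (cases "S \<subseteq> {x, y} \<or> R \<subseteq> S")
      case True
      then show ?thesis
      proof
        assume "S \<subseteq> {x, y}"
        then have "S \<union> R \<subseteq> S0" using RS xy by auto
        then show ?thesis by (rule deficient_down[OF U(1) S0(1)])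
      next
        assume "R \<subseteq> S"
        then have "S \<union> R = S" by auto
        then show ?thesis using S by (simp only:)
      qed
    next
      case False
      then obtain r where r: "r \<in> R" "r \<notin> S" by blast
      have "card S \<noteq> 2"
      proof
        assume "card S = 2"
        then have "\<not> has_matching h 1 (U - S)" using deficientD[OF S, of 1] by simp
        then show False using r l lS unfolding R_def has_matching_1_iff by blast
      qed
      then have "card S \<le> 1" using deficient_card[OF S] by linarith
      \<comment> \<open>Now \<open>S\<close> is a single vertex \<open>l'\<close> outside
        \<open>{x, y}\<close>, and its removal leaves no two disjoint edges.\<close>
      then obtain l' where l': "S = {l'}" "l' \<notin> {x, y}" "l' \<in> U"
        using False fin[OF S] card_le_Suc0_iff_eq[OF fin[OF S]] deficient_subset[OF S]
        by (metis One_nat_def empty_subsetI insert_subset is_singletonI' is_singleton_the_elem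
          subset_singletonD subsetI)
      have nm: "\<not> has_matching h 2 (U - {l'})" using deficientD[OF S, of 2] l' by simp
      have no2: False if "h a b" "h c d" "{a, b, c, d} \<subseteq> U - {l'}" "a \<noteq> c" "a \<noteq> d" "b \<noteq> c" "b \<noteq> d"
        for a b c d
        using has_matching_2I[of a "U - {l'}" b c d h] that nm by blast
      have ll: "l \<noteq> l'" using lS l' by blast
      have one: "S \<union> R \<in> deficient h 3 U" if R: "R = {x'}" and x'y': "{x', y'} = {x, y}" "x' \<noteq> y'"
        for x' y'
      proof -
        have lx: "h x' l" using R sym unfolding R_def by blast
        have mem: "x' \<in> {x, y}" "y' \<in> {x, y}" using x'y'(1) by blast+
        have yl: "y' \<noteq> l'" "x' \<noteq> l'" "y' \<in> U" "x' \<in> U" "y' \<noteq> l" "x' \<noteq> l"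
          using mem l'(2) xyU l(2) by auto
        have "y' \<notin> R" using R x'y'(2) by simp
        then have ly: "\<not> h l y'" using yl(3) unfolding R_def by simp
        \<comment> \<open>A surviving edge would join \<open>y'\<close> to some \<open>w\<close>;
          with \<open>x' l\<close> it would form a matching of size two avoiding
          \<open>l'\<close>.\<close>
        have "\<not> has_matching h 1 (U - {l', x'})"
        proof
          assume "has_matching h 1 (U - {l', x'})"
          then obtain u v where uv: "u \<in> U" "v \<in> U" "u \<notin> {l', x'}" "v \<notin> {l', x'}" "h u v"
            unfolding has_matching_1_iff by blast
          then have "u \<in> {x', y'} \<or> v \<in> {x', y'}" using ind[of u v] unfolding x'y'(1) by blast
          then have "u = y' \<or> v = y'" using uv by blast
          then obtain w where w: "w \<in> U" "w \<notin> {l', x'}" "h y' w" using uv sym by blast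
          have "w \<noteq> l" using ly w sym by blast
          show False by (rule no2[OF lx w(3)]) (use w yl ll \<open>w \<noteq> l\<close> x'y' l in auto)
        qed
        moreover have "S \<union> R = {l', x'}" using l' R by auto
        ultimately show ?thesis using l'(3) yl by (simp only:) (rule deficientI[where k = 1]; simp)
      qed
      \<comment> \<open>If \<open>l\<close> were joined to both, whichever of \<open>x p\<close>,
        \<open>y q\<close> avoids \<open>l'\<close> could be combined with the edge from
        \<open>l\<close> to the other one of \<open>x\<close> and \<open>y\<close>.\<close>
      have "R \<noteq> {x, y}"
      proof
        assume R: "R = {x, y}"
        then have lxy: "h x l" "h y l" using sym unfolding R_def by blast+
        show False
        proof (cases "p = l'")
          case True
          show False by (rule no2[OF pq(6) lxy(1)]) (use pq l l' ll xy xyU True in auto)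
        next
          case False
          show False by (rule no2[OF pq(5) lxy(2)]) (use pq l l' ll xy xyU False in auto)
        qed
      qed
      then have "R = {x} \<or> R = {y}" using RS r by blast
      then show ?thesis using one[of x y] one[of y x] xy(2) by (metis insert_commute)
    qed
  qed
qed

text \<open>Removing \<open>x\<close> leaves matching number one. A star with centre
  \<open>c\<close> would make \<open>{x, c}\<close> a deficient pair, so the remaining edges form a
  triangle. A fifth vertex \<open>p\<close> can be joined only to \<open>x\<close>, and as
  \<open>p x\<close> forms no gap with a side of the triangle, \<open>x\<close> is joined to the
  triangle. Hence all deficient sets lie in \<open>{x}\<close>, and removing \<open>x\<close>
  isolates \<open>p\<close>.\<close>

lemma isolating_cover_of_singleton:
  assumes U: "finite U" "5 \<le> card U" and m: "has_matching h 2 U"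
    and iso: "\<And>p. p \<in> U \<Longrightarrow> \<exists>w\<in>U. h p w"
    and small: "\<And>S. S \<in> deficient h 3 U \<Longrightarrow> card S \<le> 1" and x: "{x} \<in> deficient h 3 U"
  shows "isolating_cover h 3 U"
proof -
  have xU: "x \<in> U" using deficient_subset[OF x] by simp
  have m1: "has_matching h 1 (U - {x})" using has_matching_remove[OF m, of x] by simp
  have m2: "\<not> has_matching h 2 (U - {x})" using deficientD[OF x, of 2] by simp
  from star_or_triangle[OF m1 m2] show ?thesis
  proof (elim disjE bexE conjE)
    fix c assume c: "c \<in> U - {x}" and ind: "\<forall>u\<in>U - {x} - {c}. \<forall>v\<in>U - {x} - {c}. \<not> h u v"
    have "{x, c} \<in> deficient h 3 U" by (rule deficientI[where k = 1]) (use c xU ind in auto)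
    then have "card {x, c} \<le> 1" by (rule small)
    then show ?thesis using c by auto
  next
    fix a b d assume abd: "a \<in> U - {x}" "b \<in> U - {x}" "d \<in> U - {x}" "h a b" "h b d" "h a d"
      and all: "\<forall>u\<in>U - {x}. \<forall>v\<in>U - {x}. h u v \<longrightarrow> {u, v} \<subseteq> {a, b, d}"
    have ne: "a \<noteq> b" "b \<noteq> d" "a \<noteq> d" using abd adjacent_distinct by blast+
    have "card {x, a, b, d} = 4" using ne abd by auto
    then obtain p where p: "p \<in> U" "p \<notin> {x, a, b, d}"
      using diff_nonempty[of "{x, a, b, d}" U] U by auto
    have px: "\<not> h p w" if "w \<in> U - {x}" for w using all p that by blast
    then have hpx: "h p x" using iso[OF p(1)] by blast
    have gx: "h x t \<or> h x t'" if "t \<in> U - {x}" "t' \<in> U - {x}" "h t t'" for t t'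
      using gf[OF hpx that(3)] px that(1,2) by blast
    have "\<exists>t t' t''. {t, t', t''} = {a, b, d} \<and> h x t \<and> h t' t''"
    proof (cases "h x a")
      case True
      then show ?thesis using abd(5) by blast
    next
      case False
      then have "h x b" using gx[OF abd(1,2,4)] by simp
      moreover have "{b, a, d} = {a, b, d}" by blast
      ultimately show ?thesis using abd(6) by blast
    qed
    then obtain t t' t'' where t: "{t, t', t''} = {a, b, d}" "h x t" "h t' t''" by blast
    have cT: "card {t, t', t''} = 3" unfolding t(1) using ne by simp
    have tne: "t \<noteq> t'" "t \<noteq> t''" "t' \<noteq> t''"
      using cT card_insert_le_m1[of 3] by (auto simp: card_insert_if split: if_splits)
    have "{t, t', t''} \<subseteq> U - {x}" unfolding t(1) using abd by simp
    then have tU: "t \<in> U - {x}" "t' \<in> U - {x}" "t'' \<in> U - {x}" by simp_all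
    have sub: "S \<subseteq> {x}" if S: "S \<in> deficient h 3 U" for S
    proof
      fix q assume q: "q \<in> S"
      have fS: "finite S" using finite_subset[OF deficient_subset[OF S] U(1)] .
      have Sq: "S = {q}" using small[OF S] q card_le_Suc0_iff_eq[OF fS] by auto
      have qU: "q \<in> U" using q deficient_subset[OF S] by blast
      have nm: "\<not> has_matching h 2 (U - {q})" using deficientD[OF S, of 2] Sq by simp
      show "q \<in> {x}"
      proof (rule ccontr)
        assume qx: "q \<notin> {x}"
        show False
        \<comment> \<open>Deleting a vertex \<open>q\<close> off the triangle leaves
          \<open>x t\<close> and \<open>t' t''\<close>; deleting a vertex of the triangle leaves
          \<open>p x\<close> and the opposite side.\<close>
        proof (cases "q \<in> {a, b, d}")
          case False
          then have "q \<notin> {t, t', t''}" using t(1) by simp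
          then have "has_matching h 2 (U - {q})"
            by (intro has_matching_2I[of x _ t t' t'']) (use t tU tne xU qx in auto)
          then show False using nm by simp
        next
          case True
          then obtain r r' where r: "r \<in> {a, b, d}" "r' \<in> {a, b, d}" "r \<noteq> q" "r' \<noteq> q" "h r r'"
            using abd(4-6) ne by blast
          then have "has_matching h 2 (U - {q})"
            by (intro has_matching_2I[of p _ x r r']) (use p hpx qx abd xU True in auto)
          then show False using nm by simp
        qed
      qed
    qed
    show ?thesis
    proof (rule isolating_cover_cone[OF U(1), of _ _ "{x}"])
      fix S assume S: "S \<in> deficient h 3 U"
      have "S \<union> {x} = {x}" using sub[OF S] by auto
      then show "S \<union> {x} \<in> deficient h 3 U" using x by (simp only:)
      show "isolates h U S" if "{x} \<subseteq> S"
        by (rule isolatesI[of p]) (use px p sub[OF S] that in auto)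
    qed
  qed
qed

text \<open>A direct proof of Gallai's lemma in the only case needed: if every vertex of a connected
  graph is missed by some maximum matching, then no maximum matching misses two vertices.\<close>

lemma no_two_missed_vertices:
  assumes U: "finite U" "6 \<le> card U" and m: "has_matching h 2 U" "\<not> has_matching h 3 U"
    and iso: "\<And>p. p \<in> U \<Longrightarrow> \<exists>w\<in>U. h p w"
    and missed: "\<And>x. x \<in> U \<Longrightarrow> has_matching h 2 (U - {x})"
  shows False
proof -
  have no3: False if "h a b" "h c d" "h e f" "{a, b, c, d, e, f} \<subseteq> U"
    "{a, b} \<inter> {c, d} = {}" "{a, b} \<inter> {e, f} = {}" "{c, d} \<inter> {e, f} = {}" for a b c d e f
    using has_matching_3I[OF that] m(2) by simp
  have miss: "\<exists>p q p' q'. h p q \<and> h p' q' \<and> {p, q, p', q'} \<subseteq> U - {x} \<and> {p, q} \<inter> {p', q'} = {}"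
    if "x \<in> U" for x
    using missed[OF that] unfolding has_matching_2_iff by blast
  \<comment> \<open>A maximum matching \<open>u v\<close>, \<open>w z\<close> together with two
    vertices \<open>t\<close>, \<open>t'\<close> that it misses.\<close>
  define cfg where "cfg = (\<lambda>u v w z t t'. h u v \<and> h w z \<and> {u, v, w, z, t, t'} \<subseteq> U \<and>
    distinct [u, v, w, z, t, t'])"
  have nb: "a \<in> {u, v, w, z}" if c: "cfg u v w z t t'" and a: "a \<in> U" "h t a" for u v w z t t' a
  proof (rule ccontr)
    assume "a \<notin> {u, v, w, z}"
    then show False using c a adjacent_distinct[OF a(2)] unfolding cfg_def
      by (intro no3[of u v w z t a]) auto
  qed
  have swapt: "cfg u v w z t' t" if "cfg u v w z t t'" for u v w z t t' using that unfolding cfg_def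
    by auto
  have swape: "cfg w z u v t t'" if "cfg u v w z t t'" for u v w z t t' using that unfolding cfg_def
    by auto
  have swapu: "cfg v u w z t t'" if "cfg u v w z t t'" for u v w z t t' using that sym
    unfolding cfg_def by auto
  \<comment> \<open>A matching of size two missing \<open>u\<close> must cover all neighbours of
    \<open>u\<close>, in particular \<open>t\<close> and \<open>t'\<close>. Their partners are
    \<open>w\<close> and \<open>z\<close> in some order, and together with \<open>u v\<close> this
    makes three disjoint edges.\<close>
  have common: False if c: "cfg u v w z t t'" and tu: "h t u" and t'u: "h t' u" for u v w z t t'
  proof -
    have d: "h u v" "h w z" "{u, v, w, z, t, t'} \<subseteq> U" "distinct [u, v, w, z, t, t']" using c
      unfolding cfg_def by auto
    have "u \<in> U" using d by simp
    obtain p q p' q' where N: "h p q" "h p' q'" "{p, q, p', q'} \<subseteq> U - {u}" "{p, q} \<inter> {p', q'} = {}"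
      using miss[OF \<open>u \<in> U\<close>] by blast
    have cov: "s \<in> {p, q, p', q'}" if "h s u" "s \<in> U" for s
    proof (rule ccontr)
      assume "s \<notin> {p, q, p', q'}"
      then show False using no3[OF that(1) N(1,2)] N(3,4) that \<open>u \<in> U\<close> by auto
    qed
    have tv: "\<not> h t v" using no3[of t v t' u w z] d t'u by auto
    have tv': "\<not> h t' v" using no3[of t' v t u w z] d tu by auto
    have tt: "\<not> h t t'" "\<not> h t' t" using nb[OF c, of t'] nb[OF swapt[OF c], of t] d by auto
    have wz: "a \<in> {w, z}" if "h t a" "a \<in> U - {u}" for a using nb[OF c, of a] that tv by auto
    have wz': "a \<in> {w, z}" if "h t' a" "a \<in> U - {u}" for a using nb[OF swapt[OF c], of a] that tv'
      by auto
    have part: "\<exists>a b. h t a \<and> h t' b \<and> a \<noteq> b \<and> a \<in> U - {u} \<and> b \<in> U - {u}"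
    proof -
      have "t \<in> {p, q, p', q'}" "t' \<in> {p, q, p', q'}" using cov d tu t'u by auto
      then show ?thesis
        using N tt sym[OF N(1)] sym[OF N(2)] d(4) by auto
    qed
    then obtain a b where ab: "h t a" "h t' b" "a \<noteq> b" "a \<in> U - {u}" "b \<in> U - {u}" by blast
    show False using no3[OF ab(1,2) d(1)] ab wz[OF ab(1,4)] wz'[OF ab(2,5)] d by auto
  qed
  \<comment> \<open>As \<open>t u\<close> and \<open>t' w\<close> form no gap, \<open>u\<close> and
    \<open>w\<close> are adjacent. Matchings missing \<open>u\<close> and missing \<open>w\<close>
    provide \<open>t\<close> and \<open>t'\<close> with second neighbours, which can only be
    \<open>v\<close> and \<open>z\<close>; then \<open>t v\<close>, \<open>u w\<close>,
    \<open>t' z\<close> are disjoint.\<close>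
  have far: False if c: "cfg u v w z t t'" and tu: "h t u" and t'w: "h t' w" for u v w z t t'
  proof -
    have d: "h u v" "h w z" "{u, v, w, z, t, t'} \<subseteq> U" "distinct [u, v, w, z, t, t']" using c
      unfolding cfg_def by auto
    have tt: "\<not> h t t'" using nb[OF c, of t'] d by auto
    have tw: "\<not> h t w" using common[OF swape[OF c]] t'w by blast
    have ut: "\<not> h t' u" using common[OF c] tu by blast
    have uw: "h u w" using gf[OF tu t'w] tt tw ut sym by blast
    have cov: "\<exists>a. h s a \<and> a \<in> U - {r}" if sr: "h s r" "s \<in> U" "r \<in> U" for s r
    proof -
      obtain p q p' q' where N: "h p q" "h p' q'" "{p, q, p', q'} \<subseteq> U - {r}"
        "{p, q} \<inter> {p', q'} = {}"
        using miss[OF sr(3)] by blast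
      have "s \<in> {p, q, p', q'}"
      proof (rule ccontr)
        assume "s \<notin> {p, q, p', q'}"
        then show False using no3[OF sr(1) N(1,2)] N(3,4) sr by auto
      qed
      then show ?thesis using N sym[OF N(1)] sym[OF N(2)] by auto
    qed
    obtain a where a: "h t a" "a \<in> U - {u}" using cov[OF tu] d by auto
    have "a \<noteq> z" using no3[of t z w t' u v] a d t'w sym by auto
    then have tv: "h t v" using nb[OF c, of a] a tw by auto
    obtain b where b: "h t' b" "b \<in> U - {w}" using cov[OF t'w] d by auto
    have "b \<noteq> v" using no3[of t' v t u w z] b d tu by auto
    then have t'z: "h t' z" using nb[OF swapt[OF c], of b] b ut by auto
    show False using no3[OF tv uw t'z] d by auto
  qed
  obtain u v w z where uvwz: "u \<in> U" "v \<in> U" "w \<in> U" "z \<in> U" "h u v" "h w z"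
    "u \<noteq> w" "u \<noteq> z" "v \<noteq> w" "v \<noteq> z" using m(1) unfolding has_matching_2_iff by blast
  have ne: "u \<noteq> v" "w \<noteq> z" using uvwz adjacent_distinct by blast+
  have "card {u, v, w, z} = 4" using uvwz ne by auto
  then obtain t where t: "t \<in> U" "t \<notin> {u, v, w, z}" using diff_nonempty[of "{u, v, w, z}" U] U
    by auto
  have "card {t, u, v, w, z} = 5" using uvwz ne t by auto
  then obtain t' where t': "t' \<in> U" "t' \<notin> {t, u, v, w, z}"
    using diff_nonempty[of "{t, u, v, w, z}" U] U by auto
  have c: "cfg u v w z t t'" using uvwz ne t t' unfolding cfg_def by auto
  \<comment> \<open>Relabelling the matching makes \<open>u\<close> a neighbour of \<open>t\<close>;
    after that every possible neighbour of \<open>t'\<close> is excluded.\<close>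
  have "\<exists>u v w z. cfg u v w z t t' \<and> h t u"
  proof -
    obtain a where "a \<in> U" "h t a" using iso[OF t(1)] by blast
    then show ?thesis using nb[OF c, of a] c swapu[OF c] swape[OF c] swapu[OF swape[OF c]] by auto
  qed
  then obtain u v w z where c: "cfg u v w z t t'" and tu: "h t u" by blast
  obtain a where a: "a \<in> U" "h t' a" using iso[OF t'(1)] by blast
  then have "a \<in> {u, v, w, z}" using nb[OF swapt[OF c]] by blast
  moreover have "a \<noteq> u" using common[OF c tu] a by blast
  moreover have "a \<noteq> v" using no3[of t u t' v w z] tu a c unfolding cfg_def by auto
  moreover have "a \<noteq> w" using far[OF c tu] a by blast
  moreover have "a \<noteq> z" using far[OF swape[OF swapu[OF swape[OF c]]] tu] a by blast
  ultimately show False by blast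
qed

text \<open>At most three of the four transversal pairs of a perfect matching are deficient, since its
  two edges do not form a gap.\<close>

lemma deficient_of_perfect_matching:
  assumes U: "finite U" "card U = 4" and m: "has_matching h 2 U"
  shows "\<exists>u v w z. distinct [u, v, w, z] \<and> deficient h 3 U \<subseteq> Pow {u, z} \<union> Pow {z, v} \<union> Pow {v, w}"
proof -
  \<comment> \<open>Given the edges \<open>u v\<close>, \<open>w z\<close> and \<open>v z\<close>,
    each of the pairs \<open>{u, v}\<close>, \<open>{w, z}\<close>, \<open>{u, w}\<close> misses one
    of them. The three pairs left over form a path \<open>u\<close>, \<open>z\<close>,
    \<open>v\<close>, \<open>w\<close>.\<close>
  have main: "deficient h 3 U \<subseteq> Pow {u, z} \<union> Pow {z, v} \<union> Pow {v, w}"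
    if U': "U = {u, v, w, z}" and d: "distinct [u, v, w, z]" and e: "h u v" "h w z" "h v z"
      for u v w z
  proof
    fix S assume S: "S \<in> deficient h 3 U"
    have no: "\<not> (a \<in> S \<and> b \<in> S)" if "a \<noteq> b" "r \<in> U - {a, b}" "r' \<in> U - {a, b}" "h r r'" for a b r r'
    proof
      assume ab: "a \<in> S \<and> b \<in> S"
      then have "{a, b} \<in> deficient h 3 U" using deficient_down[OF U(1) S] by simp
      then have "\<not> has_matching h 1 (U - {a, b})" by (rule deficientD) (use that in simp)
      then show False using that unfolding has_matching_1_iff by blast
    qed
    have "\<not> (u \<in> S \<and> v \<in> S)" by (rule no[of u v w z]) (use U' d e in auto)
    moreover have "\<not> (w \<in> S \<and> z \<in> S)" by (rule no[of w z u v]) (use U' d e in auto)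
    moreover have "\<not> (u \<in> S \<and> w \<in> S)" by (rule no[of u w v z]) (use U' d e in auto)
    moreover have "S \<subseteq> {u, v, w, z}" using deficient_subset[OF S] U' by simp
    ultimately show "S \<in> Pow {u, z} \<union> Pow {z, v} \<union> Pow {v, w}" by blast
  qed
  obtain u v w z where uvwz: "u \<in> U" "v \<in> U" "w \<in> U" "z \<in> U" "h u v" "h w z"
    "u \<noteq> w" "u \<noteq> z" "v \<noteq> w" "v \<noteq> z" using m unfolding has_matching_2_iff by blast
  have ne: "u \<noteq> v" "w \<noteq> z" using uvwz adjacent_distinct by blast+
  have "card {u, v, w, z} = 4" using uvwz ne by auto
  moreover have "{u, v, w, z} \<subseteq> U" using uvwz by blast
  ultimately have UU: "U = {u, v, w, z}" using card_subset_eq[OF U(1)] U(2) by metis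
  have "\<exists>u v w z. U = {u, v, w, z} \<and> distinct [u, v, w, z] \<and> h u v \<and> h w z \<and> h v z"
    using gf[OF uvwz(5,6)]
  proof (elim disjE)
    assume "h u w"
    then have "U = {v, u, z, w} \<and> distinct [v, u, z, w] \<and> h v u \<and> h z w \<and> h u w"
      using UU uvwz ne sym by auto
    then show ?thesis by blast
  next
    assume "h u z"
    then have "U = {v, u, w, z} \<and> distinct [v, u, w, z] \<and> h v u \<and> h w z \<and> h u z"
      using UU uvwz ne sym by auto
    then show ?thesis by blast
  next
    assume "h v w"
    then have "U = {u, v, z, w} \<and> distinct [u, v, z, w] \<and> h u v \<and> h z w \<and> h v w"
      using UU uvwz ne sym by auto
    then show ?thesis by blast
  next
    assume "h v z"
    then have "U = {u, v, w, z} \<and> distinct [u, v, w, z] \<and> h u v \<and> h w z \<and> h v z"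
      using UU uvwz ne by auto
    then show ?thesis by blast
  qed
  then show ?thesis using main by blast
qed

text \<open>The last three alternatives keep just enough structure to lower the vanishing bound: to
  \<open>card N + 2\<close> when \<open>card U = 4\<close> and to \<open>card N + 1\<close> when
  \<open>card U = 5\<close>. For matching number two, at least five vertices and none isolated, the
  cases follow the largest size of a deficient set; size 0 is possible only on five vertices, by the
  Gallai argument.\<close>

lemma isolating_cover_3:
  assumes U: "finite U" "4 \<le> card U"
  shows "isolating_cover h 3 U \<or> card U = 4 \<and> isolates h U {} \<or> card U = 5 \<and>
    deficient h 3 U \<subseteq> {{}} \<or>
    card U = 4 \<and> (\<exists>u v w z. distinct [u, v, w, z] \<and> deficient h 3 U \<subseteq> Pow {u, z} \<union> Pow {z, v} \<union> Pow
      {v, w})"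
proof -
  consider "has_matching h 3 U" | "\<not> has_matching h 1 U" | "has_matching h 1 U"
    "\<not> has_matching h 2 U" | "has_matching h 2 U" "\<not> has_matching h 3 U" by blast
  then show ?thesis
  proof cases
    case 1
    then show ?thesis using isolating_cover_matching[OF U(1)] by blast
  next
    case 2
    have "3 \<le> card U" using U by simp
    then show ?thesis using isolating_cover_stable[OF U(1) _ 2] by blast
  next
    case 3
    then show ?thesis using isolating_cover_matching_number_1[OF U] by blast
  next
    case 4
    show ?thesis
    proof (cases "card U = 4 \<or> (\<exists>p\<in>U. \<forall>w\<in>U. \<not> h p w)")
      case True
      then show ?thesis
      proof
        assume "card U = 4"
        then show ?thesis using deficient_of_perfect_matching[OF U(1) _ 4(1)] by blast
      next
        assume "\<exists>p\<in>U. \<forall>w\<in>U. \<not> h p w"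
        moreover have "has_matching h (3 - 1) U" using 4(1) by simp
        ultimately have "isolating_cover h 3 U" using isolating_cover_isolated[OF U(1)] by blast
        then show ?thesis by blast
      qed
    next
      case False
      then have iso: "\<And>p. p \<in> U \<Longrightarrow> \<exists>w\<in>U. h p w" and U5: "5 \<le> card U" using U by auto
      show ?thesis
      proof (cases "deficient h 3 U \<subseteq> {{}}")
        case True
        have "has_matching h 2 (U - {x})" if "x \<in> U" for x
        proof (rule ccontr)
          assume "\<not> has_matching h 2 (U - {x})"
          then have "{x} \<in> deficient h 3 U" by (intro deficientI[where k = 2]) (use that in auto)
          then show False using True by blast
        qed
        then have "\<not> 6 \<le> card U" using no_two_missed_vertices[OF U(1) _ 4 iso] by blast
        then show ?thesis using True U5 by simp
      next
        case False
        then obtain S where S: "S \<in> deficient h 3 U" "S \<noteq> {}" by blast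
        have "isolating_cover h 3 U"
        proof (cases "\<exists>S0\<in>deficient h 3 U. card S0 = 2")
          case True
          then show ?thesis using isolating_cover_of_pair[OF U(1) U5 4(1)] by blast
        next
          case no2: False
          have small: "card T \<le> 1" if "T \<in> deficient h 3 U" for T
            using no2 deficient_card[OF that] that by force
          obtain x where "x \<in> S" using S(2) by blast
          then have "{x} \<in> deficient h 3 U" using deficient_down[OF U(1) S(1)] by simp
          then show ?thesis using isolating_cover_of_singleton[OF U(1) U5 4(1) iso small] by blast
        qed
        then show ?thesis by blast
      qed
    qed
  qed
qed

end

section \<open>Faces missed by a power of the edge ideal\<close>

definition stable :: "nat set set \<Rightarrow> nat set \<Rightarrow> bool" where
  "stable E \<sigma> \<longleftrightarrow> (\<forall>u\<in>\<sigma>. \<forall>v\<in>\<sigma>. {u, v} \<notin> E)"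

definition nbhd :: "nat set set \<Rightarrow> nat set \<Rightarrow> nat set" where
  "nbhd E \<sigma> = {v. \<exists>u\<in>\<sigma>. {u, v} \<in> E}"

text \<open>The second component is a copy number; in a simple graph the copies of one vertex are
  pairwise nonadjacent.\<close>

definition copy_adj :: "nat set set \<Rightarrow> nat \<times> nat \<Rightarrow> nat \<times> nat \<Rightarrow> bool" where
  "copy_adj E p q \<longleftrightarrow> {fst p, fst q} \<in> E"

lemma simple_graph_edge:
  assumes "simple_graph n E" "{u, v} \<in> E"
  shows "u \<noteq> v" "u \<in> {1..n}" "v \<in> {1..n}"
  using assms unfolding simple_graph_def by force+

text \<open>The edges may share a vertex; then one of them is itself the required
  connection.\<close>

lemma gap_free_cross:
  assumes "simple_graph n E" "gap_free E" "{a, b} \<in> E" "{c, d} \<in> E"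
  shows "{a, c} \<in> E \<or> {a, d} \<in> E \<or> {b, c} \<in> E \<or> {b, d} \<in> E"
proof (cases "{a, b} \<inter> {c, d} = {}")
  case True
  have "\<not> is_gap E {a, b} {c, d}" using assms(2) by (simp add: gap_free_def)
  then obtain f where f: "f \<in> E" "f \<subseteq> {a, b, c, d}" "f \<noteq> {a, b}" "f \<noteq> {c, d}"
    using assms(3,4) True unfolding is_gap_def by auto
  obtain x y where xy: "f = {x, y}" "x \<noteq> y"
    using assms(1) f(1) unfolding simple_graph_def by (metis card_2_iff)
  then have "x \<in> {a, b, c, d}" "y \<in> {a, b, c, d}" using f(2) by auto
  then show ?thesis using f xy by (auto simp: insert_commute)
next
  case False
  then show ?thesis using assms(3,4) by (auto simp: insert_commute)
qed

lemma gapfree_copy_adj: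
  assumes "simple_graph n E" "gap_free E"
  shows "gapfree (copy_adj E)"
proof
  show "copy_adj E u v \<Longrightarrow> copy_adj E v u" for u v by (simp add: copy_adj_def insert_commute)
  show "\<not> copy_adj E u u" for u using simple_graph_edge(1)[OF assms(1)] unfolding copy_adj_def
    by blast
  show "copy_adj E a b \<Longrightarrow> copy_adj E c d \<Longrightarrow>
    copy_adj E a c \<or> copy_adj E a d \<or> copy_adj E b c \<or> copy_adj E b d" for a b c d
    unfolding copy_adj_def by (rule gap_free_cross[OF assms])
qed

section \<open>The pieces of the missed faces\<close>

definition piece :: "nat \<Rightarrow> nat set set \<Rightarrow> nat set \<Rightarrow> (nat \<times> nat) set \<Rightarrow> (nat \<times> nat) set \<Rightarrow> nat set set"
  where
  "piece n E N U S = {\<sigma>. N \<subseteq> \<sigma> \<and> \<sigma> \<subseteq> {1..n} \<and> stable E \<sigma> \<and> (\<forall>p\<in>U. fst p \<in> nbhd E \<sigma> \<longrightarrow> p \<in> S)}"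

definition missed_faces :: "nat \<Rightarrow> nat set set \<Rightarrow> nat set \<Rightarrow> (nat \<times> nat) set \<Rightarrow> nat \<Rightarrow> nat set set" where
  "missed_faces n E N U s = {\<sigma>. N \<subseteq> \<sigma> \<and> \<sigma> \<subseteq> {1..n} \<and> stable E \<sigma> \<and>
    {p \<in> U. fst p \<in> nbhd E \<sigma>} \<in> deficient (copy_adj E) s U}"

lemma stable_mono: "stable E \<sigma> \<Longrightarrow> \<rho> \<subseteq> \<sigma> \<Longrightarrow> stable E \<rho>"
  unfolding stable_def by blast

lemma nbhd_mono: "\<rho> \<subseteq> \<sigma> \<Longrightarrow> nbhd E \<rho> \<subseteq> nbhd E \<sigma>"
  unfolding nbhd_def by blast

lemma piece_downset: "downset N (piece n E N U S)"
proof (rule downsetI)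
  fix \<rho> \<sigma> assume *: "\<sigma> \<in> piece n E N U S" "N \<subseteq> \<rho>" "\<rho> \<subseteq> \<sigma>"
  show "\<rho> \<in> piece n E N U S"
    unfolding piece_def
  proof (intro CollectI conjI ballI impI)
    show "\<rho> \<subseteq> {1..n}" "stable E \<rho>" using * stable_mono unfolding piece_def by blast+
    show "p \<in> S" if "p \<in> U" "fst p \<in> nbhd E \<rho>" for p
      using that * nbhd_mono[OF *(3)] unfolding piece_def by blast
  qed (rule *(2))
qed (auto simp: piece_def intro: finite_subset)

lemma piece_Int: "piece n E N U S \<inter> piece n E N U T = piece n E N U (S \<inter> T)"
  unfolding piece_def by blast

lemma piece_mono: "S \<subseteq> T \<Longrightarrow> piece n E N U S \<subseteq> piece n E N U T"
  unfolding piece_def by blast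

text \<open>The copies lying in the neighbourhood of a missed face form the smallest index whose
  piece contains it, and pieces grow with their index; so a cofinal family of deficient sets
  suffices.\<close>

lemma missed_faces_eq:
  assumes "finite U" "F \<subseteq> deficient (copy_adj E) s U"
    "\<And>S. S \<in> deficient (copy_adj E) s U \<Longrightarrow> \<exists>T\<in>F. S \<subseteq> T"
  shows "missed_faces n E N U s = (\<Union>S\<in>F. piece n E N U S)"
proof (intro equalityI subsetI)
  fix \<sigma> assume \<sigma>: "\<sigma> \<in> missed_faces n E N U s"
  then obtain T where "T \<in> F" "{p \<in> U. fst p \<in> nbhd E \<sigma>} \<subseteq> T" using assms(3)
    unfolding missed_faces_def by blast
  then show "\<sigma> \<in> (\<Union>S\<in>F. piece n E N U S)" using \<sigma> unfolding missed_faces_def piece_def by blast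
next
  fix \<sigma> assume "\<sigma> \<in> (\<Union>S\<in>F. piece n E N U S)"
  then obtain S where S: "S \<in> F" "\<sigma> \<in> piece n E N U S" by blast
  then have "{p \<in> U. fst p \<in> nbhd E \<sigma>} \<subseteq> S" "S \<in> deficient (copy_adj E) s U" using assms(2)
    unfolding piece_def by blast+
  then have "{p \<in> U. fst p \<in> nbhd E \<sigma>} \<in> deficient (copy_adj E) s U"
    using deficient_down[OF assms(1)] by blast
  then show "\<sigma> \<in> missed_faces n E N U s" using S(2) unfolding missed_faces_def piece_def by blast
qed

text \<open>The apex is the vertex \<open>v\<close> below an isolated \<open>p\<close> of
  \<open>U - S\<close>. It has no neighbour in \<open>\<sigma> - {v}\<close> because
  \<open>p\<close> is not in \<open>S\<close>, its own neighbours in \<open>U\<close> already lie in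
  \<open>S\<close>, and it is not in \<open>N\<close>.\<close>

lemma acyclic_at_piece_isolates:
  assumes sg: "simple_graph n E" and U: "fst ` U \<subseteq> {1..n}" "N \<inter> fst ` U = {}"
    and g: "isolates (copy_adj E) U S"
  shows "acyclic_at TYPE('k::field) (piece n E N U S) q"
proof -
  obtain p where p: "p \<in> U" "p \<notin> S" and iso: "\<And>w. w \<in> U \<Longrightarrow> {fst p, fst w} \<in> E \<Longrightarrow> w \<in> S"
    using g unfolding isolates_def copy_adj_def by blast
  define v where "v = fst p"
  have v: "v \<in> {1..n}" "v \<notin> N" using U p unfolding v_def by auto
  show ?thesis
  proof (rule acyclic_at_cone[where v = v])
    fix \<sigma> assume "\<sigma> \<in> piece n E N U S"
    then show "finite \<sigma>" by (rule downset_finite[OF piece_downset])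
  next
    fix \<sigma>
    show "insert v \<sigma> \<in> piece n E N U S \<longleftrightarrow> \<sigma> - {v} \<in> piece n E N U S"
    proof
      assume *: "insert v \<sigma> \<in> piece n E N U S"
      then have "N \<subseteq> insert v \<sigma>" unfolding piece_def by blast
      then have "N \<subseteq> \<sigma> - {v}" using v(2) by blast
      then show "\<sigma> - {v} \<in> piece n E N U S" by (rule downsetD[OF piece_downset *]) blast
    next
      assume *: "\<sigma> - {v} \<in> piece n E N U S"
      then have sub: "N \<subseteq> \<sigma> - {v}" "\<sigma> - {v} \<subseteq> {1..n}" and ind: "stable E (\<sigma> - {v})"
        and nb: "\<And>q. q \<in> U \<Longrightarrow> fst q \<in> nbhd E (\<sigma> - {v}) \<Longrightarrow> q \<in> S" unfolding piece_def by blast+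
      have vn: "{u, v} \<notin> E" if "u \<in> \<sigma> - {v}" for u using nb[OF p(1)] p(2) that
        unfolding nbhd_def v_def by blast
      have vv: "{v, v} \<notin> E" using simple_graph_edge(1)[OF sg] by blast
      have "stable E (insert v \<sigma>)"
        unfolding stable_def
      proof (intro ballI)
        fix x y assume "x \<in> insert v \<sigma>" "y \<in> insert v \<sigma>"
        then consider "x = v" "y = v" | "x = v" "y \<in> \<sigma> - {v}" | "x \<in> \<sigma> - {v}" "y = v" |
          "x \<in> \<sigma> - {v}" "y \<in> \<sigma> - {v}" by blast
        then show "{x, y} \<notin> E"
        proof cases
          case 2
          then show ?thesis using vn[of y] by (simp add: insert_commute)
        qed (use vv vn ind in \<open>auto simp: stable_def\<close>)
      qed
      moreover have "q \<in> S" if q: "q \<in> U" "fst q \<in> nbhd E (insert v \<sigma>)" for q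
      proof -
        obtain u where u: "u \<in> insert v \<sigma>" "{u, fst q} \<in> E" using q(2) unfolding nbhd_def by blast
        show ?thesis
        proof (cases "u = v")
          case True
          then show ?thesis using iso[OF q(1)] u(2) unfolding v_def by simp
        next
          case False
          then show ?thesis using nb[OF q(1)] u unfolding nbhd_def by blast
        qed
      qed
      ultimately show "insert v \<sigma> \<in> piece n E N U S" using sub v(1) unfolding piece_def by blast
    qed
  qed
qed

text \<open>\<open>W\<close> consists of the vertices all of whose neighbours in \<open>U\<close>
  lie in \<open>S\<close>. An edge inside \<open>W\<close> would, by gap-freeness, be joined to the
  edge \<open>p p'\<close> outside \<open>S\<close>, which is impossible. So \<open>W\<close> is
  stable, and the piece is the full interval from \<open>N\<close> to \<open>W\<close>.\<close>

lemma acyclic_at_piece: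
  assumes sg: "simple_graph n E" "gap_free E"
    and S: "U - S \<noteq> {}" and g: "\<not> isolates (copy_adj E) U S" and q: "card N < q"
  shows "acyclic_at TYPE('k::field) (piece n E N U S) q"
proof -
  obtain p p' where p: "p \<in> U - S" "p' \<in> U - S" "{fst p, fst p'} \<in> E"
    using S g unfolding isolates_def copy_adj_def by blast
  define W where "W = {y \<in> {1..n}. \<forall>p\<in>U. {y, fst p} \<in> E \<longrightarrow> p \<in> S}"
  have ind: "stable E W"
    unfolding stable_def
  proof (intro ballI notI)
    fix y y' assume y: "y \<in> W" "y' \<in> W" "{y, y'} \<in> E"
    then show False using gap_free_cross[OF sg y(3) p(3)] p(1,2) unfolding W_def by blast
  qed
  have "piece n E N U S = {\<sigma>. N \<subseteq> \<sigma> \<and> \<sigma> \<subseteq> W}"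
  proof (intro equalityI subsetI)
    fix \<sigma> assume "\<sigma> \<in> piece n E N U S"
    then show "\<sigma> \<in> {\<sigma>. N \<subseteq> \<sigma> \<and> \<sigma> \<subseteq> W}" unfolding piece_def W_def nbhd_def by blast
  next
    fix \<sigma> assume \<sigma>: "\<sigma> \<in> {\<sigma>. N \<subseteq> \<sigma> \<and> \<sigma> \<subseteq> W}"
    then have "stable E \<sigma>" using stable_mono[OF ind] by blast
    then show "\<sigma> \<in> piece n E N U S" using \<sigma> unfolding piece_def W_def nbhd_def by blast
  qed
  moreover have "finite W" unfolding W_def by simp
  ultimately show ?thesis using acyclic_at_interval[of W N q] q by simp
qed

text \<open>Every piece vanishes above degree \<open>card N\<close>, and gluing costs one degree for
  each step in a chain of index sets. The proof therefore looks for short chains, the shorter the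
  larger \<open>card U\<close> is.\<close>

lemma acyclic_from_missed_faces:
  assumes sg: "simple_graph n E" "gap_free E"
    and U: "finite U" "fst ` U \<subseteq> {1..n}" "N \<inter> fst ` U = {}"
    and s: "s \<in> {1, 2, 3}" "s \<le> card U"
  shows "\<exists>m. acyclic_from TYPE('k::field) (missed_faces n E N U s) m \<and> (m = 0 \<or> s \<noteq> 1 \<and>
    m + card U \<le> card N + 2 * s)"
proof -
  let ?h = "copy_adj E"
  interpret gapfree ?h by (rule gapfree_copy_adj[OF sg])
  have good: "acyclic_from TYPE('k) (piece n E N U S) m" if "isolates ?h U S" for S m
    unfolding acyclic_from_def using acyclic_at_piece_isolates[OF sg(1) U(2,3) that] by blast
  have bad: "acyclic_from TYPE('k) (piece n E N U S) m" if "S \<in> deficient ?h s U" "card N < m"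
    for S m
  proof (cases "isolates ?h U S")
    case False
    have "S \<noteq> U" using deficient_card[OF that(1)] s(2) by auto
    then have "U - S \<noteq> {}" using deficient_subset[OF that(1)] by blast
    then show ?thesis unfolding acyclic_from_def using acyclic_at_piece[OF sg _ False] that(2)
      by (meson less_le_trans)
  qed (rule good)
  have fing: "finite (deficient ?h s U)"
    by (rule finite_subset[of _ "Pow U"]) (simp_all add: U(1) deficient_def Collect_mono Pow_def)
  have cl: "S \<inter> T \<in> deficient ?h s U" if "S \<in> deficient ?h s U" for S T
    using deficient_down[OF U(1) that] by simp
  have keq: "missed_faces n E N U s = (\<Union>S\<in>deficient ?h s U. piece n E N U S)"
    by (rule missed_faces_eq[OF U(1)]) auto
  have acyclic: "acyclic_from TYPE('k) (missed_faces n E N U s) 0" if ac: "isolating_cover ?h s U"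
  proof -
    obtain F where F: "F \<subseteq> deficient ?h s U" "\<forall>S\<in>F. \<forall>T\<in>F. S \<inter> T \<in> F"
      "\<forall>S\<in>deficient ?h s U. \<exists>T\<in>F. S \<subseteq> T" "\<forall>S\<in>F. isolates ?h U S" using ac
        unfolding isolating_cover_def by blast
    have "acyclic_from TYPE('k) (\<Union>S\<in>F. piece n E N U S) 0"
      by (rule acyclic_from_Union[OF piece_downset piece_Int finite_subset[OF F(1) fing],
        where h = "\<lambda>_. 0"])
        (use F(2,4) good in auto)
    moreover have "missed_faces n E N U s = (\<Union>S\<in>F. piece n E N U S)"
      by (rule missed_faces_eq[OF U(1) F(1)]) (use F(3) in blast)
    ultimately show ?thesis by simp
  qed
  \<comment> \<open>Bounds have to increase along inclusions, so they are tied to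
    \<open>card S\<close>. For \<open>k = 1\<close> the empty index set is assumed to give a cone,
    with bound 0, and the count starts at singletons.\<close>
  have graded: "acyclic_from TYPE('k) (missed_faces n E N U s) (card N + m)"
    if h: "\<And>S. S \<in> deficient ?h s U \<Longrightarrow> (isolates ?h U S \<and> S = {} \<or> k \<le> card S) \<and> card S + 1 - k \<le> m"
    and k: "k \<le> 1" for k m
  proof -
    define w where "w = (\<lambda>S :: (nat \<times> nat) set. if isolates ?h U S \<and> S =
      {} then 0 else card N + (card S + 1 - k))"
    have fS: "finite S" if "S \<in> deficient ?h s U" for S
      using finite_subset[OF deficient_subset[OF that] U(1)] .
    have "acyclic_from TYPE('k) (\<Union>S\<in>deficient ?h s U. piece n E N U S) (card N + m)"
    proof (rule acyclic_from_Union[OF piece_downset piece_Int fing, where h = w])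
      fix S assume S: "S \<in> deficient ?h s U"
      show "acyclic_from TYPE('k) (piece n E N U S) (w S)"
        using good[of S] bad[OF S, of "w S"] h[OF S] k
          by (cases "isolates ?h U S \<and> S = {}") (auto simp: w_def)
      show "w S \<le> card N + m" using h[OF S] by (auto simp: w_def)
      fix T assume T: "T \<in> deficient ?h s U" "T \<subset> S"
      have "card T < card S" using psubset_card_mono[OF fS[OF S] T(2)] .
      then have "card T + 1 - k < card S + 1 - k" using k by arith
      moreover have "w S = card N + (card S + 1 - k)" using T(2) by (auto simp: w_def)
      moreover have "w T = 0 \<or> w T = card N + (card T + 1 - k)" by (simp add: w_def)
      ultimately show "w T = 0 \<or> w T < w S" by linarith
    qed (rule cl)
    then show ?thesis by (simp add: keq)
  qed
  \<comment> \<open>A deficient set has at most \<open>s - 1\<close> elements; this bound suffices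
    when \<open>card U = s\<close>.\<close>
  have crude: "acyclic_from TYPE('k) (missed_faces n E N U s) (card N + s)"
    by (rule graded[of 0]) (use deficient_card in force)+
  have single: "acyclic_from TYPE('k) (missed_faces n E N U s) (card N + 1)"
    if "deficient ?h s U \<subseteq> {{}}"
    by (rule graded[of 0]) (use that in auto)
  consider "s = 1" | "s = 2" "card U = 2" | "s = 2" "3 \<le> card U" | "s = 3" "card U = 3" | "s = 3"
    "4 \<le> card U"
    using s by force
  then show ?thesis
  proof cases
    case 1
    then have "isolating_cover ?h s U" using isolating_cover_1[OF U(1)] s(2) by simp
    then show ?thesis using acyclic by blast
  next
    case 2
    then show ?thesis using crude by (intro exI[of _ "card N + s"]) simp
  next
    case 3
    have "isolating_cover ?h s U \<or> card U = 3 \<and> deficient ?h s U \<subseteq> {{}}"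
      using isolating_cover_2[OF U(1) 3(2)] unfolding 3(1) .
    then consider "isolating_cover ?h s U" | "card U = 3" "deficient ?h s U \<subseteq> {{}}" by blast
    then show ?thesis
    proof cases
      case 1
      then show ?thesis using acyclic by blast
    next
      case 2
      then show ?thesis using single 3 by (intro exI[of _ "card N + 1"]) simp
    qed
  next
    case 4
    then show ?thesis using crude by (intro exI[of _ "card N + s"]) simp
  next
    case 5
    have "isolating_cover ?h s U \<or> card U = 4 \<and> isolates ?h U {} \<or> card U = 5 \<and>
      deficient ?h s U \<subseteq> {{}} \<or>
      card U = 4 \<and> (\<exists>u v w z. distinct [u, v, w, z] \<and> deficient ?h s U \<subseteq> Pow {u, z} \<union> Pow {z, v} \<union>
        Pow {v, w})"
      using isolating_cover_3[OF U(1) 5(2)] unfolding 5(1) .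
    then consider "isolating_cover ?h s U" | "card U = 4" "isolates ?h U {}" | "card U = 5"
      "deficient ?h s U \<subseteq> {{}}"
      | u v w z where "card U = 4" "distinct [u, v, w, z]"
        "deficient ?h s U \<subseteq> Pow {u, z} \<union> Pow {z, v} \<union> Pow {v, w}"
      by blast
    then show ?thesis
    proof cases
      case 1
      then show ?thesis using acyclic by blast
    next
      case 2
      have "acyclic_from TYPE('k) (missed_faces n E N U s) (card N + 2)"
      proof (rule graded[of 1])
        fix S assume S: "S \<in> deficient ?h s U"
        have "S = {} \<or> 1 \<le> card S" using finite_subset[OF deficient_subset[OF S] U(1)]
          by (simp add: Suc_le_eq card_gt_0_iff)
        then show "(isolates ?h U S \<and> S = {} \<or> 1 \<le> card S) \<and> card S + 1 - 1 \<le> 2"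
          using 2(2) deficient_card[OF S] 5(1) by auto
      qed simp
      then show ?thesis using 2 5 by (intro exI[of _ "card N + 2"]) simp
    next
      case 3
      then show ?thesis using single 5 by (intro exI[of _ "card N + 1"]) simp
    next
      case (4 u v w z)
      define D where "D = piece n E N U"
      define G where "G = deficient ?h s U"
      \<comment> \<open>Gluing over all deficient sets at once would give only
        \<open>card N + 3\<close>. Grouping them by the three pairs, which form a path, saves one
        degree: consecutive groups meet in the pieces below a common singleton.\<close>
      define Q where "Q = (\<lambda>a b. \<Union>S\<in>G \<inter> Pow {a, b}. D S)"
      have dclQ: "downset N (Q a b)" for a b unfolding Q_def D_def
        by (rule downset_UN[OF piece_downset])
      have vQ: "acyclic_from TYPE('k) (Q a b) (card N + 2)" if ab: "a \<noteq> b" for a b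
      \<comment> \<open>If the pair itself is deficient, its piece contains all others of the group;
        otherwise only index sets with at most one element occur.\<close>
      proof (cases "{a, b} \<in> G")
        case True
        have "Q a b = D {a, b}"
          unfolding Q_def D_def using True piece_mono by blast
        then show ?thesis using bad[of "{a, b}"] True unfolding G_def D_def by simp
      next
        case False
        define w where "w = (\<lambda>S :: (nat \<times> nat) set. card N + (card S + 1))"
        have small: "card S \<le> 1" if S: "S \<in> G \<inter> Pow {a, b}" for S
        proof -
          have "S \<subset> {a, b}" using S False by auto
          then have "card S < card {a, b}" by (intro psubset_card_mono) auto
          then show ?thesis using ab by simp
        qed
        have "acyclic_from TYPE('k) (\<Union>S\<in>G \<inter> Pow {a, b}. D S) (card N + 2)"
          unfolding D_def
        proof (rule acyclic_from_Union[OF piece_downset piece_Int, where h = w])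
          show "finite (G \<inter> Pow {a, b})" by simp
          fix S assume S: "S \<in> G \<inter> Pow {a, b}"
          show "acyclic_from TYPE('k) (piece n E N U S) (w S)" using bad S unfolding G_def w_def
            by simp
          show "w S \<le> card N + 2" using small[OF S] unfolding w_def by simp
          fix T assume T: "T \<in> G \<inter> Pow {a, b}"
          show "S \<inter> T \<in> G \<inter> Pow {a, b}" using cl S T unfolding G_def by blast
          assume "T \<subset> S"
          moreover have "finite S" using S finite_subset by auto
          ultimately show "w T = 0 \<or> w T < w S" unfolding w_def using psubset_card_mono by simp
        qed
        then show ?thesis by (simp add: Q_def)
      qed
      have QI: "(\<Union>S\<in>A. D S) \<inter> (\<Union>S\<in>B. D S) = (\<Union>S\<in>G \<inter> P. D S)"
        if A: "A = G \<inter> PA" "B = G \<inter> PB" "PA \<inter> PB = P"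
          and dn: "\<And>S T. S \<in> PA \<Longrightarrow> S \<inter> T \<in> PA" "\<And>S T. S \<in> PB \<Longrightarrow> S \<inter> T \<in> PB" for A B PA PB P
      proof (intro equalityI subsetI)
        fix \<sigma> assume "\<sigma> \<in> (\<Union>S\<in>A. D S) \<inter> (\<Union>S\<in>B. D S)"
        then obtain S T where S: "S \<in> A" "T \<in> B" "\<sigma> \<in> D S" "\<sigma> \<in> D T" by blast
        then have "\<sigma> \<in> D (S \<inter> T)" unfolding D_def using piece_Int[of n E N U S T] by blast
        moreover have "S \<inter> T \<in> G" using S(1) A(1) cl unfolding G_def by blast
        moreover have "S \<inter> T \<in> P" using S(1,2) A dn(1)[of S T] dn(2)[of T S]
          by (auto simp: Int_commute)
        ultimately show "\<sigma> \<in> (\<Union>S\<in>G \<inter> P. D S)" by blast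
      next
        fix \<sigma> assume "\<sigma> \<in> (\<Union>S\<in>G \<inter> P. D S)"
        then show "\<sigma> \<in> (\<Union>S\<in>A. D S) \<inter> (\<Union>S\<in>B. D S)" using A by blast
      qed
      \<comment> \<open>The deficient subsets of a singleton have a largest member unless there are
        none, so this union is a single piece or empty.\<close>
      have v1: "acyclic_from TYPE('k) (\<Union>S\<in>G \<inter> Pow {c}. D S) (card N + 2 - 1)" for c
      proof -
        consider "{c} \<in> G" | "{c} \<notin> G" "{} \<in> G" | "{c} \<notin> G" "{} \<notin> G" by blast
        then show ?thesis
        proof cases
          case 1
          have "(\<Union>S\<in>G \<inter> Pow {c}. D S) = D {c}" unfolding D_def using 1 piece_mono by blast
          then show ?thesis using bad[of "{c}"] 1 unfolding G_def D_def by simp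
        next
          case 2
          have "G \<inter> Pow {c} = {{}}" using 2 by (auto simp: subset_singleton_iff)
          then have "(\<Union>S\<in>G \<inter> Pow {c}. D S) = D {}" by simp
          then show ?thesis using bad[of "{}"] 2 unfolding G_def D_def by simp
        next
          case 3
          have "G \<inter> Pow {c} = {}" using 3 by (auto simp: subset_singleton_iff)
          then show ?thesis by (simp add: acyclic_from_empty)
        qed
      qed
      have d: "u \<noteq> v" "u \<noteq> w" "u \<noteq> z" "v \<noteq> w" "v \<noteq> z" "w \<noteq> z" using 4(2) by auto
      have A1: "Q u z \<inter> Q z v = (\<Union>S\<in>G \<inter> Pow {z}. D S)"
        unfolding Q_def by (rule QI[OF refl refl]) (use d in auto)
      have vA: "acyclic_from TYPE('k) (Q u z \<union> Q z v) (card N + 2)"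
        by (rule acyclic_from_Un[OF dclQ dclQ]) (use vQ d v1 A1 in auto)
      have "Q u z \<union> Q z v = (\<Union>S\<in>G \<inter> (Pow {u, z} \<union> Pow {z, v}). D S)" unfolding Q_def by blast
      moreover have "(\<Union>S\<in>G \<inter> (Pow {u, z} \<union> Pow {z, v}). D S) \<inter> Q v w = (\<Union>S\<in>G \<inter> Pow {v}. D S)"
        unfolding Q_def by (rule QI[OF refl refl]) (use d in auto)
      ultimately have A2: "(Q u z \<union> Q z v) \<inter> Q v w = (\<Union>S\<in>G \<inter> Pow {v}. D S)" by simp
      have "acyclic_from TYPE('k) ((Q u z \<union> Q z v) \<union> Q v w) (card N + 2)"
        by (rule acyclic_from_Un[OF downset_Un[OF dclQ dclQ] dclQ vA]) (use vQ[OF d(4)] v1 A2 in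
          auto)
      moreover have "(Q u z \<union> Q z v) \<union> Q v w = missed_faces n E N U s"
        unfolding keq Q_def using 4(3) unfolding G_def D_def by blast
      ultimately have "acyclic_from TYPE('k) (missed_faces n E N U s) (card N + 2)" by simp
      then show ?thesis using 4 5 by (intro exI[of _ "card N + 2"]) simp
    qed
  qed
qed

section \<open>Monomials in powers of the edge ideal\<close>

primrec in_power :: "nat set set \<Rightarrow> nat \<Rightarrow> (nat \<Rightarrow> nat) \<Rightarrow> bool" where
  "in_power E 0 a = True"
| "in_power E (Suc k) a = (\<exists>u v. {u, v} \<in> E \<and> 0 < a u \<and> 0 < a v \<and>
  in_power E k (a(u := a u - 1, v := a v - 1)))"

lemma in_power_mono: "in_power E k a \<Longrightarrow> (\<And>i. a i \<le> b i) \<Longrightarrow> in_power E k b"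
proof (induction k arbitrary: a b)
  case (Suc k)
  then obtain u v where uv: "{u, v} \<in> E" "0 < a u" "0 < a v"
    "in_power E k (a(u := a u - 1, v := a v - 1))" by auto
  have "in_power E k (b(u := b u - 1, v := b v - 1))"
    by (rule Suc.IH[OF uv(4)]) (use Suc.prems(2) in \<open>auto intro: diff_le_mono\<close>)
  moreover have "0 < b u" "0 < b v" using uv Suc.prems(2) by (meson less_le_trans)+
  ultimately show ?case using uv(1) by auto
qed simp

lemma in_power_SucD: "in_power E (Suc k) a \<Longrightarrow> in_power E k a"
  by (auto intro: in_power_mono)

lemma in_power_le: "in_power E k a \<Longrightarrow> j \<le> k \<Longrightarrow> in_power E j a"
  by (induction k) (use in_power_SucD le_Suc_eq in blast)+

text \<open>\<open>in_power E k a\<close> says that the monomial with exponents \<open>a\<close> is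
  divisible by a product of \<open>k\<close> edges. Giving every unit of \<open>a\<close> its own
  copy of the vertex makes these edges disjoint; since copies are interchangeable, any of them may
  be removed in the induction.\<close>

lemma in_power_iff_has_matching:
  assumes sg: "simple_graph n E"
  shows "finite U \<Longrightarrow> (\<And>x. a x = card {p \<in> U. fst p = x}) \<Longrightarrow> in_power E k a \<longleftrightarrow>
    has_matching (copy_adj E) k U"
proof (induction k arbitrary: a U)
  case (Suc k)
  have cnt: "(a(u := a u - 1, v := a v - 1)) x = card {r \<in> U - {p, q}. fst r = x}"
    if pq: "p \<in> U" "q \<in> U" "fst p = u" "fst q = v" "u \<noteq> v" for p q u v x
  proof -
    have fin: "finite {r \<in> U. fst r = x}" using Suc.prems(1) by simp
    consider "x = u" | "x = v" | "x \<noteq> u" "x \<noteq> v" by blast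
    then show ?thesis
    proof cases
      case 1
      then have "{r \<in> U - {p, q}. fst r = x} = {r \<in> U. fst r = x} - {p}" using pq by auto
      then show ?thesis using 1 pq Suc.prems(2) fin by simp
    next
      case 2
      then have "{r \<in> U - {p, q}. fst r = x} = {r \<in> U. fst r = x} - {q}" using pq by auto
      then show ?thesis using 2 pq Suc.prems(2) fin by simp
    next
      case 3
      then have "{r \<in> U - {p, q}. fst r = x} = {r \<in> U. fst r = x}" using pq by auto
      then show ?thesis using 3 Suc.prems(2) by simp
    qed
  qed
  have IH: "in_power E k (a(u := a u - 1, v := a v - 1)) \<longleftrightarrow> has_matching (copy_adj E) k (U - {p, q})"
    if pq: "p \<in> U" "q \<in> U" "fst p = u" "fst q = v" "u \<noteq> v" for p q u v
    by (rule Suc.IH) (use Suc.prems(1) cnt[OF pq] in auto)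
  show ?case
  proof
    assume "in_power E (Suc k) a"
    then obtain u v where uv: "{u, v} \<in> E" "0 < a u" "0 < a v"
      "in_power E k (a(u := a u - 1, v := a v - 1))" by auto
    have ne: "u \<noteq> v" using simple_graph_edge[OF sg uv(1)] by simp
    have "{p \<in> U. fst p = u} \<noteq> {}" "{p \<in> U. fst p = v} \<noteq> {}"
      using uv(2,3) Suc.prems(2) by (metis card.empty less_irrefl)+
    then obtain p q where pq: "p \<in> U" "q \<in> U" "fst p = u" "fst q = v" by blast
    then have "has_matching (copy_adj E) k (U - {p, q})" using IH[OF pq ne] uv(4) by simp
    moreover have "copy_adj E p q" using uv(1) pq by (simp add: copy_adj_def)
    ultimately show "has_matching (copy_adj E) (Suc k) U" using pq by auto
  next
    assume "has_matching (copy_adj E) (Suc k) U"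
    then obtain p q where pq: "p \<in> U" "q \<in> U" "copy_adj E p q"
      "has_matching (copy_adj E) k (U - {p, q})" by auto
    have e: "{fst p, fst q} \<in> E" using pq(3) by (simp add: copy_adj_def)
    have ne: "fst p \<noteq> fst q" using simple_graph_edge[OF sg e] by simp
    have "0 < a (fst r)" if "r \<in> U" for r
    proof -
      have "r \<in> {p \<in> U. fst p = fst r}" "finite {p \<in> U. fst p = fst r}" using that Suc.prems(1)
        by simp_all
      then show ?thesis unfolding Suc.prems(2) card_gt_0_iff by blast
    qed
    then have "0 < a (fst p)" "0 < a (fst q)" using pq(1,2) by simp_all
    moreover have "in_power E k (a(fst p := a (fst p) - 1, fst q := a (fst q) - 1))"
      using IH[OF pq(1,2) refl refl ne] pq(4) by simp
    ultimately show "in_power E (Suc k) a" using e by auto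
  qed
qed simp

text \<open>The exponent vector of the numerator when \<open>x^e\<close> is written with the
  \<open>m\<close>-th power of \<open>var_prod \<sigma>\<close> as denominator.\<close>

definition shift :: "(nat \<Rightarrow> int) \<Rightarrow> nat \<Rightarrow> nat set \<Rightarrow> nat \<Rightarrow> int" where
  "shift e m \<sigma> i = e i + (if i \<in> \<sigma> then int m else 0)"

text \<open>The faces \<open>\<sigma>\<close> such that \<open>x^e\<close> lies in the localization of the \<open>s\<close>-th power of the edge ideal
  at \<open>\<sigma>\<close>.\<close>

definition power_faces :: "nat \<Rightarrow> nat set set \<Rightarrow> nat \<Rightarrow> (nat \<Rightarrow> int) \<Rightarrow> nat set set" where
  "power_faces n E s e = {\<sigma>. \<sigma> \<subseteq> {1..n} \<and> (\<exists>m. (\<forall>i. 0 \<le> shift e m \<sigma> i) \<and>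
    in_power E s (\<lambda>i. nat (shift e m \<sigma> i)))}"

text \<open>Polarization: the vertex \<open>x\<close> is repeated once for each unit of its exponent.\<close>

definition copies :: "nat \<Rightarrow> (nat \<Rightarrow> int) \<Rightarrow> (nat \<times> nat) set" where
  "copies n e = Sigma {1..n} (\<lambda>x. {..<nat (e x)})"

definition zero_on :: "nat set \<Rightarrow> (nat \<Rightarrow> nat) \<Rightarrow> nat \<Rightarrow> nat" where
  "zero_on T a i = (if i \<in> T then 0 else a i)"

lemma nbhd_subset:
  assumes "simple_graph n E"
  shows "nbhd E \<sigma> \<subseteq> {1..n}"
  using simple_graph_edge(3)[OF assms] unfolding nbhd_def by blast

lemma finite_nbhd:
  assumes "simple_graph n E"
  shows "finite (nbhd E \<sigma>)"
  using finite_subset[OF nbhd_subset[OF assms]] by simp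

lemma nbhd_stable: "stable E \<sigma> \<Longrightarrow> u \<in> nbhd E \<sigma> \<Longrightarrow> u \<notin> \<sigma>"
  unfolding stable_def nbhd_def by blast

lemma sum_decrement:
  fixes a :: "nat \<Rightarrow> nat"
  assumes "finite T" "u \<in> T" "0 < a u"
  shows "sum (a(u := a u - 1)) T = sum a T - 1" "0 < sum a T"
proof -
  have "sum a T = a u + sum a (T - {u})" using assms by (simp add: sum.remove)
  moreover have "sum (a(u := a u - 1)) T = (a u - 1) + sum (a(u := a u - 1)) (T - {u})"
    using assms by (simp add: sum.remove)
  moreover have "sum (a(u := a u - 1)) (T - {u}) = sum a (T - {u})" by (rule sum.cong) auto
  ultimately show "sum (a(u := a u - 1)) T = sum a T - 1" "0 < sum a T" using assms(3) by linarith+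
qed

text \<open>Every edge meeting \<open>\<sigma>\<close> has its other end in the neighbourhood of \<open>\<sigma>\<close>, and each unit of \<open>a\<close>
  there can be completed to an edge by a vertex of \<open>\<sigma>\<close>, whose exponent is unbounded in the
  localization.\<close>

lemma in_power_reduce:
  assumes sg: "simple_graph n E" and ind: "stable E \<sigma>"
  shows "in_power E k b \<Longrightarrow> (\<And>i. i \<notin> \<sigma> \<Longrightarrow> b i \<le> a i) \<Longrightarrow>
    in_power E (k - sum a (nbhd E \<sigma>)) (zero_on (nbhd E \<sigma>) a)"
proof (induction k arbitrary: a b)
  case (Suc k)
  let ?T = "nbhd E \<sigma>"
  have hit: "in_power E (Suc k - sum a ?T) (zero_on ?T a)"
    if uv: "{u, v} \<in> E" "0 < b u" "0 < b v" "in_power E k (b(u := b u - 1, v := b v - 1))" "u \<in> ?T"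
      for u v
  proof -
    have us: "u \<notin> \<sigma>" using nbhd_stable[OF ind uv(5)] .
    have ne: "u \<noteq> v" using simple_graph_edge(1)[OF sg uv(1)] .
    have au: "0 < a u" using Suc.prems(2)[OF us] uv(2) by linarith
    have "(b(u := b u - 1, v := b v - 1)) i \<le> (a(u := a u - 1)) i" if "i \<notin> \<sigma>" for i
      using Suc.prems(2)[OF that] ne by auto
    then have "in_power E (k - sum (a(u := a u - 1)) ?T) (zero_on ?T (a(u := a u - 1)))"
      by (rule Suc.IH[OF uv(4)])
    moreover have "zero_on ?T (a(u := a u - 1)) = zero_on ?T a" using uv(5)
      by (auto simp: zero_on_def)
    moreover have "k - sum (a(u := a u - 1)) ?T = Suc k - sum a ?T"
      using sum_decrement[where a = a, OF finite_nbhd[OF sg] uv(5) au] by linarith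
    ultimately show ?thesis by simp
  qed
  obtain u v where uv: "{u, v} \<in> E" "0 < b u" "0 < b v"
    "in_power E k (b(u := b u - 1, v := b v - 1))"
    using Suc.prems(1) by auto
  have ne: "u \<noteq> v" using simple_graph_edge(1)[OF sg uv(1)] .
  have vu: "{v, u} \<in> E" using uv(1) by (simp add: insert_commute)
  consider "u \<in> ?T" | "v \<in> ?T" | "u \<notin> ?T" "v \<notin> ?T" by blast
  then show ?case
  proof cases
    case 1
    then show ?thesis by (rule hit[OF uv])
  next
    case 2
    have "in_power E k (b(v := b v - 1, u := b u - 1))" using uv(4) ne by (simp add: fun_upd_twist)
    then show ?thesis by (rule hit[OF vu uv(3,2) _ 2])
  next
    case 3
    have us: "u \<notin> \<sigma>" "v \<notin> \<sigma>" using 3 uv(1) vu unfolding nbhd_def by blast+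
    let ?a = "a(u := a u - 1, v := a v - 1)"
    have av: "0 < a u" "0 < a v" using Suc.prems(2)[OF us(1)] Suc.prems(2)[OF us(2)] uv(2,3)
      by linarith+
    have "(b(u := b u - 1, v := b v - 1)) i \<le> ?a i" if "i \<notin> \<sigma>" for i
      using Suc.prems(2)[OF that] by auto
    then have "in_power E (k - sum ?a ?T) (zero_on ?T ?a)" by (rule Suc.IH[OF uv(4)])
    moreover have "sum ?a ?T = sum a ?T" by (rule sum.cong) (use 3 in auto)
    moreover have "zero_on ?T ?a = (zero_on ?T a)(u := zero_on ?T a u - 1, v := zero_on ?T a v - 1)"
      using 3 by (auto simp: zero_on_def)
    moreover have "0 < zero_on ?T a u" "0 < zero_on ?T a v" using 3 av by (auto simp: zero_on_def)
    ultimately have "in_power E (Suc (k - sum a ?T)) (zero_on ?T a)" using uv(1) by auto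
    then show ?thesis by (rule in_power_le) linarith
  qed
qed simp

text \<open>Converse of \<open>in_power_reduce\<close>. An excess of \<open>k\<close> on each vertex
  of \<sigma> is enough, since each of the \<open>k\<close> edges takes at most one unit of it. A
  unit of \<open>a\<close> on the neighbourhood is matched with a vertex of \<sigma>; once these are
  used up, the edges come from the rest of \<open>a\<close>.\<close>

lemma in_power_extend:
  assumes sg: "simple_graph n E" and ind: "stable E \<sigma>"
  shows "in_power E (k - sum a (nbhd E \<sigma>)) (zero_on (nbhd E \<sigma>) a) \<Longrightarrow> (\<And>i. i \<notin> \<sigma> \<Longrightarrow> a i \<le> b i) \<Longrightarrow>
    (\<And>i. i \<in> \<sigma> \<Longrightarrow> a i + k \<le> b i) \<Longrightarrow> in_power E k b"
proof (induction k arbitrary: a b)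
  case (Suc k)
  let ?T = "nbhd E \<sigma>"
  have le: "a i \<le> b i" for i using Suc.prems(2,3)[of i] by (cases "i \<in> \<sigma>") auto
  show ?case
  proof (cases "sum a ?T = 0")
    case True
    then have "in_power E (Suc k) (zero_on ?T a)" using Suc.prems(1) by simp
    then show ?thesis by (rule in_power_mono) (use le in \<open>auto simp: zero_on_def\<close>)
  next
    case False
    then obtain t where t: "t \<in> ?T" "0 < a t" using finite_nbhd[OF sg, of \<sigma>] by auto
    then obtain w where w: "w \<in> \<sigma>" "{w, t} \<in> E" unfolding nbhd_def by blast
    have ts: "t \<notin> \<sigma>" using nbhd_stable[OF ind t(1)] .
    then have ne: "w \<noteq> t" using w by blast
    have "zero_on ?T (a(t := a t - 1)) = zero_on ?T a" using t(1) by (auto simp: zero_on_def)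
    moreover have "k - sum (a(t := a t - 1)) ?T = Suc k - sum a ?T"
      using sum_decrement[where a = a, OF finite_nbhd[OF sg] t] by linarith
    ultimately have 1: "in_power E (k - sum (a(t := a t - 1)) ?T) (zero_on ?T (a(t := a t - 1)))"
      using Suc.prems(1) by simp
    have "in_power E k (b(w := b w - 1, t := b t - 1))"
    proof (rule Suc.IH[OF 1])
      show "(a(t := a t - 1)) i \<le> (b(w := b w - 1, t := b t - 1)) i" if "i \<notin> \<sigma>" for i
        using le[of i] that w(1) by (auto simp: diff_le_mono)
      show "(a(t := a t - 1)) i + k \<le> (b(w := b w - 1, t := b t - 1)) i" if "i \<in> \<sigma>" for i
        using Suc.prems(3)[OF that] that ts by auto
    qed
    moreover have "0 < b w" using Suc.prems(3)[OF w(1)] by linarith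
    moreover have "0 < b t" using le[of t] t(2) by linarith
    ultimately show ?thesis using w(2) by auto
  qed
qed simp

text \<open>For faces containing an edge: both of its variables are invertible in the localization,
  so membership is automatic.\<close>

lemma in_power_edge:
  assumes "{u, v} \<in> E" "u \<noteq> v"
  shows "k \<le> b u \<Longrightarrow> k \<le> b v \<Longrightarrow> in_power E k b"
proof (induction k arbitrary: b)
  case (Suc k)
  have "in_power E k (b(u := b u - 1, v := b v - 1))"
    by (rule Suc.IH) (use Suc.prems assms(2) in auto)
  moreover have "0 < b u" "0 < b v" using Suc.prems by linarith+
  ultimately show ?case using assms(1) unfolding in_power.simps by blast
qed simp

lemma finite_copies [simp]: "finite (copies n e)"
  by (simp add: copies_def)

lemma card_copies: "card (copies n e) = (\<Sum>i\<in>{1..n}. nat (e i))"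
  by (simp add: copies_def)

lemma card_copies_on:
  assumes "T \<subseteq> {1..n}"
  shows "card {p \<in> copies n e. fst p \<in> T} = (\<Sum>i\<in>T. nat (e i))"
proof -
  have "{p \<in> copies n e. fst p \<in> T} = Sigma T (\<lambda>x. {..<nat (e x)})"
    using assms unfolding copies_def by auto
  then show ?thesis using finite_subset[OF assms] by simp
qed

lemma card_copies_fiber: "x \<in> {1..n} \<Longrightarrow> card {p \<in> copies n e. fst p = x} = nat (e x)"
proof -
  assume "x \<in> {1..n}"
  then have "{p \<in> copies n e. fst p = x} = Pair x ` {..<nat (e x)}" unfolding copies_def by auto
  then show ?thesis by (simp add: card_image inj_on_def)
qed

text \<open>For stable \<sigma>, \<open>in_power_reduce\<close> and \<open>in_power_extend\<close>
  turn membership in the localization into a matching problem on the copies outside the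
  neighbourhood of \<sigma>, which is the definition of a deficient set. Other faces containing
  \<open>N\<close> are never missed.\<close>

lemma power_faces_eq:
  assumes sg: "simple_graph n E" and e: "\<And>i. i \<notin> {1..n} \<Longrightarrow> e i = 0"
  shows "power_faces n E s e = {\<sigma>. {i. e i < 0} \<subseteq> \<sigma> \<and>
    \<sigma> \<subseteq> {1..n}} - missed_faces n E {i. e i < 0} (copies n e) s"
proof -
  \<comment> \<open>One exponent that serves for all \<open>m\<close>: large enough to clear the
    negative entries and to leave \<open>s\<close> spare units on each vertex of the face.\<close>
  define M where "M = s + (\<Sum>i\<in>{1..n}. nat \<bar>e i\<bar>)"
  have M: "int s + \<bar>e i\<bar> \<le> int M" for i
  proof (cases "i \<in> {1..n}")
    case True
    then have "nat \<bar>e i\<bar> \<le> (\<Sum>i\<in>{1..n}. nat \<bar>e i\<bar>)" by (intro member_le_sum) auto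
    then show ?thesis unfolding M_def by linarith
  next
    case False
    then show ?thesis using e unfolding M_def by simp
  qed
  have main: "(\<exists>m. (\<forall>i. 0 \<le> shift e m \<sigma> i) \<and> in_power E s (\<lambda>i. nat (shift e m \<sigma> i))) \<longleftrightarrow>
      \<not> (stable E \<sigma> \<and> {p \<in> copies n e. fst p \<in> nbhd E \<sigma>} \<in> deficient (copy_adj E) s (copies n e))"
    if \<sigma>: "{i. e i < 0} \<subseteq> \<sigma>" "\<sigma> \<subseteq> {1..n}" for \<sigma>
  proof -
    let ?T = "nbhd E \<sigma>"
    let ?a = "\<lambda>i. nat (e i)"
    define S where "S = {p \<in> copies n e. fst p \<in> ?T}"
    have pos: "0 \<le> shift e M \<sigma> i" for i
    proof (cases "i \<in> \<sigma>")
      case True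
      then have "shift e M \<sigma> i = e i + int M" by (simp add: shift_def)
      then show ?thesis using M[of i] by linarith
    next
      case False
      then have "\<not> e i < 0" using \<sigma>(1) by blast
      then show ?thesis using False unfolding shift_def by simp
    qed
    have big: "nat (e i) + s \<le> nat (shift e M \<sigma> i)" if "i \<in> \<sigma>" for i
    proof -
      have "shift e M \<sigma> i = e i + int M" using that by (simp add: shift_def)
      then show ?thesis using M[of i] by linarith
    qed
    have eq: "nat (shift e m \<sigma> i) = nat (e i)" if "i \<notin> \<sigma>" for i m using that
      by (simp add: shift_def)
    show ?thesis
    proof (cases "stable E \<sigma>")
      case False
      then obtain u v where uv: "u \<in> \<sigma>" "v \<in> \<sigma>" "{u, v} \<in> E" unfolding stable_def by blast
      have "in_power E s (\<lambda>i. nat (shift e M \<sigma> i))"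
        by (rule in_power_edge[OF uv(3) simple_graph_edge(1)[OF sg uv(3)]])
          (use big[OF uv(1)] big[OF uv(2)] in linarith)+
      then show ?thesis using pos False by blast
    next
      case True
      have "(\<exists>m. (\<forall>i. 0 \<le> shift e m \<sigma> i) \<and> in_power E s (\<lambda>i. nat (shift e m \<sigma> i))) \<longleftrightarrow>
          in_power E (s - sum ?a ?T) (zero_on ?T ?a)"
      proof
        assume "\<exists>m. (\<forall>i. 0 \<le> shift e m \<sigma> i) \<and> in_power E s (\<lambda>i. nat (shift e m \<sigma> i))"
        then obtain m where "in_power E s (\<lambda>i. nat (shift e m \<sigma> i))" by blast
        then show "in_power E (s - sum ?a ?T) (zero_on ?T ?a)"
          by (rule in_power_reduce[OF sg True]) (simp add: eq)
      next
        assume "in_power E (s - sum ?a ?T) (zero_on ?T ?a)"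
        then have "in_power E s (\<lambda>i. nat (shift e M \<sigma> i))"
          by (rule in_power_extend[OF sg True]) (use eq big in auto)
        then show "\<exists>m. (\<forall>i. 0 \<le> shift e m \<sigma> i) \<and> in_power E s (\<lambda>i. nat (shift e m \<sigma> i))" using pos
          by blast
      qed
      also have "sum ?a ?T = card S" unfolding S_def
        by (rule card_copies_on[OF nbhd_subset[OF sg], symmetric])
      also have "in_power E (s - card S) (zero_on ?T ?a) \<longleftrightarrow>
        has_matching (copy_adj E) (s - card S) (copies n e - S)"
      proof (rule in_power_iff_has_matching[OF sg])
        fix x
        show "zero_on ?T ?a x = card {p \<in> copies n e - S. fst p = x}"
        proof (cases "x \<in> {1..n} \<and> x \<notin> ?T")
          case True
          then have "{p \<in> copies n e - S. fst p = x} = {p \<in> copies n e. fst p = x}" unfolding S_def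
            by auto
          then show ?thesis using True card_copies_fiber[of x n e] by (simp add: zero_on_def)
        next
          case False
          then have "{p \<in> copies n e - S. fst p = x} = {}" unfolding S_def copies_def by auto
          then have "card {p \<in> copies n e - S. fst p = x} = 0" by (simp only: card.empty)
          then show ?thesis using False e[of x] by (auto simp: zero_on_def)
        qed
      qed simp
      also have "\<dots> \<longleftrightarrow> S \<notin> deficient (copy_adj E) s (copies n e)" unfolding deficient_def S_def
        by blast
      finally show ?thesis using True unfolding S_def by blast
    qed
  qed
  have N: "{i. e i < 0} \<subseteq> \<sigma>" if "\<forall>i. 0 \<le> shift e m \<sigma> i" for \<sigma> m
  proof
    fix i assume "i \<in> {i. e i < 0}"
    then show "i \<in> \<sigma>" using that[rule_format, of i] by (cases "i \<in> \<sigma>") (auto simp: shift_def)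
  qed
  show ?thesis
  proof (intro equalityI subsetI)
    fix \<sigma> assume "\<sigma> \<in> power_faces n E s e"
    then obtain m where m: "\<sigma> \<subseteq> {1..n}" "\<forall>i. 0 \<le> shift e m \<sigma> i"
      "in_power E s (\<lambda>i. nat (shift e m \<sigma> i))"
      unfolding power_faces_def by blast
    then show "\<sigma> \<in> {\<sigma>. {i. e i < 0} \<subseteq> \<sigma> \<and>
      \<sigma> \<subseteq> {1..n}} - missed_faces n E {i. e i < 0} (copies n e) s"
      using main[OF N[OF m(2)] m(1)] N[OF m(2)] unfolding missed_faces_def by blast
  next
    fix \<sigma> assume \<sigma>: "\<sigma> \<in> {\<sigma>. {i. e i < 0} \<subseteq> \<sigma> \<and>
      \<sigma> \<subseteq> {1..n}} - missed_faces n E {i. e i < 0} (copies n e) s"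
    then have *: "{i. e i < 0} \<subseteq> \<sigma>" "\<sigma> \<subseteq> {1..n}" by blast+
    show "\<sigma> \<in> power_faces n E s e" using main[OF *] \<sigma> * unfolding missed_faces_def power_faces_def
      by blast
  qed
qed

section \<open>Upper bounds for the degrees\<close>

definition total_deg :: "nat \<Rightarrow> (nat \<Rightarrow> int) \<Rightarrow> int" where
  "total_deg n e = (\<Sum>i\<in>{1..n}. e i)"

definition exponents :: "nat \<Rightarrow> (nat \<Rightarrow> int) set" where
  "exponents n = {e. \<forall>i. i \<notin> {1..n} \<longrightarrow> e i = 0}"

lemma exponentsD: "e \<in> exponents n \<Longrightarrow> i \<notin> {1..n} \<Longrightarrow> e i = 0"
  by (simp add: exponents_def)

lemma power_faces_missed_faces:
  assumes "simple_graph n E" "e \<in> exponents n"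
  shows "power_faces n E s e = {\<sigma>. {i. e i < 0} \<subseteq> \<sigma> \<and>
    \<sigma> \<subseteq> {1..n}} - missed_faces n E {i. e i < 0} (copies n e) s"
  by (rule power_faces_eq[OF assms(1)]) (rule exponentsD[OF assms(2)])

lemma negative_subset: "e \<in> exponents n \<Longrightarrow> {i. e i < 0} \<subseteq> {1..n}"
  using exponentsD by fastforce

text \<open>Each negative entry is at most -1 and lowers the total degree by at least one.\<close>

lemma total_deg_le:
  assumes "e \<in> exponents n"
  shows "total_deg n e \<le> int (card (copies n e)) - int (card {i. e i < 0})"
proof -
  have "card {i. e i < 0} = (\<Sum>i\<in>{i. e i < 0}. 1)" by simp
  also have "\<dots> = (\<Sum>i\<in>{1..n}. if e i < 0 then 1 else 0)"
    by (rule sum.mono_neutral_cong_left) (use negative_subset[OF assms] in auto)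
  finally have *: "card {i. e i < 0} = (\<Sum>i\<in>{1..n}. if e i < 0 then 1 else 0)" .
  have "total_deg n e \<le> (\<Sum>i\<in>{1..n}. int (nat (e i)) - int (if e i < 0 then 1 else 0))"
    unfolding total_deg_def by (rule sum_mono) auto
  also have "\<dots> = int (\<Sum>i\<in>{1..n}. nat (e i)) - int (\<Sum>i\<in>{1..n}. if e i < 0 then 1 else 0)"
    by (simp only: sum_subtractf of_nat_sum)
  finally show ?thesis unfolding * card_copies .
qed

lemma interval_downset: "downset N {\<sigma>. N \<subseteq> \<sigma> \<and> \<sigma> \<subseteq> {1..n}}"
  by (rule downsetI) (auto intro: finite_subset)

lemma missed_faces_downset:
  assumes "finite U"
  shows "downset N (missed_faces n E N U s)"
proof -
  have "missed_faces n E N U s = (\<Union>S\<in>deficient (copy_adj E) s U. piece n E N U S)"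
    by (rule missed_faces_eq[OF assms]) auto
  then show ?thesis using downset_UN[OF piece_downset] by simp
qed

lemma missed_faces_lower_part:
  assumes "finite U"
  shows "lower_part (missed_faces n E N U s) {\<sigma>. N \<subseteq> \<sigma> \<and> \<sigma> \<subseteq> {1..n}}"
  by (rule downset_lower_part[OF missed_faces_downset[OF assms] interval_downset]) (auto simp:
    missed_faces_def)

text \<open>Some vertex has positive exponent, so the interval of all faces above \<open>N\<close>
  is a cone. The cohomology of \<open>power_faces\<close> is thus that of the missed faces moved up
  one degree, and a class in degree \<open>q\<close> forces \<open>q \<le> m\<close>. For
  \<open>s = 1\<close> all missed faces cancel, so an exponent contributing to the edge ideal has no
  positive entry.\<close>

lemma total_deg_bound:
  assumes sg: "simple_graph n E" "gap_free E" and e: "e \<in> exponents n"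
    and s: "s \<in> {1, 2, 3}" "s \<le> card (copies n e)"
      and nv: "\<not> acyclic_at TYPE('k::field) (power_faces n E s e) q"
  shows "s \<noteq> 1 \<and> int q + total_deg n e \<le> 2 * int s"
proof -
  let ?N = "{i. e i < 0}" and ?U = "copies n e"
  have U: "fst ` ?U \<subseteq> {1..n}" "?N \<inter> fst ` ?U = {}" unfolding copies_def by auto
  obtain m where m: "acyclic_from TYPE('k) (missed_faces n E ?N ?U s) m"
    "m = 0 \<or> s \<noteq> 1 \<and> m + card ?U \<le> card ?N + 2 * s"
    using acyclic_from_missed_faces[OF sg finite_copies U s] by blast
  have "?U \<noteq> {}" using s by auto
  then obtain p where "p \<in> ?U" by blast
  then have "fst p \<in> {1..n}" "fst p \<notin> ?N" using U by blast+
  then have N: "?N \<noteq> {1..n}" by metis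
  have "acyclic_at TYPE('k) (power_faces n E s e) q" if q: "m = 0 \<or> m < q"
    unfolding power_faces_missed_faces[OF sg(1) e]
  proof (rule acyclic_at_upper_part[OF downset_convex[OF interval_downset]
    missed_faces_lower_part[OF finite_copies]])
    show "acyclic_at TYPE('k) {\<sigma>. ?N \<subseteq> \<sigma> \<and> \<sigma> \<subseteq> {1..n}} q"
      by (rule acyclic_at_interval) (use N in auto)
    show "acyclic_at TYPE('k) (missed_faces n E ?N ?U s) (q - 1)" if "0 < q" using m(1) q that
      unfolding acyclic_from_def by auto
  qed
  then have "m \<noteq> 0" "q \<le> m" using nv by (meson not_le)+
  then show ?thesis using m(2) total_deg_le[OF e] by auto
qed

lemma has_matching_card:
  assumes "\<And>u. \<not> h u u"
  shows "finite W \<Longrightarrow> has_matching h k W \<Longrightarrow> 2 * k \<le> card W"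
proof (induction k arbitrary: W)
  case (Suc k)
  then obtain u v where uv: "u \<in> W" "v \<in> W" "h u v" "has_matching h k (W - {u, v})" by auto
  have "u \<noteq> v" using uv(3) assms by blast
  then have two: "card {u, v} = 2" by simp
  have "card (W - {u, v}) = card W - 2" using uv(1,2) two by (subst card_Diff_subset) simp_all
  moreover have "2 \<le> card W" using card_mono[OF Suc.prems(1), of "{u, v}"] uv(1,2) unfolding two
    by simp
  moreover have "2 * k \<le> card (W - {u, v})" using Suc.IH[OF _ uv(4)] Suc.prems(1) by simp
  ultimately show ?case by arith
qed simp

text \<open>A matching of \<open>s - card S\<close> edges needs twice as many vertices, more than
  \<open>U - S\<close> has. So every subset is deficient, and the family depends neither on
  \<open>s\<close> nor on the positive exponents.\<close>

lemma power_faces_small: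
  assumes sg: "simple_graph n E" and e: "e \<in> exponents n" and s: "card (copies n e) < s"
  shows "power_faces n E s e = {\<sigma>. {i. e i < 0} \<subseteq> \<sigma> \<and> \<sigma> \<subseteq> {1..n} \<and> \<not> stable E \<sigma>}"
proof -
  have irr: "\<not> copy_adj E p p" for p using simple_graph_edge(1)[OF sg] unfolding copy_adj_def
    by blast
  have all: "S \<in> deficient (copy_adj E) s (copies n e)" if S: "S \<subseteq> copies n e" for S
  proof (rule ccontr)
    assume "S \<notin> deficient (copy_adj E) s (copies n e)"
    then have "has_matching (copy_adj E) (s - card S) (copies n e - S)" using S
      by (simp add: deficient_def)
    then have "2 * (s - card S) \<le> card (copies n e - S)"
      by (rule has_matching_card[where h = "copy_adj E", OF irr, rotated]) simp
    moreover have "card (copies n e - S) = card (copies n e) - card S"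
      using S finite_subset[OF S] by (simp add: card_Diff_subset)
    moreover have "card S \<le> card (copies n e)" using S by (simp add: card_mono)
    ultimately show False using s by linarith
  qed
  have "{p \<in> copies n e. fst p \<in> nbhd E \<sigma>} \<in> deficient (copy_adj E) s (copies n e)" for \<sigma>
    by (rule all) (rule Collect_restrict)
  then have "missed_faces n E {i. e i < 0} (copies n e) s = {\<sigma>. {i. e i < 0} \<subseteq> \<sigma> \<and> \<sigma> \<subseteq> {1..n} \<and>
    stable E \<sigma>}"
    unfolding missed_faces_def by (simp only: simp_thms)
  then show ?thesis unfolding power_faces_missed_faces[OF sg e]
    by (simp only: Diff_iff mem_Collect_eq set_eq_iff) metis
qed

text \<open>The value \<open>s - 1\<close> is the largest positive total below \<open>s\<close>,
  hence the largest that leaves the family unchanged. This transports a class of the edge ideal to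
  the power, \<open>s - 1\<close> degrees higher.\<close>

lemma power_faces_raise:
  assumes sg: "simple_graph n E" and e: "e \<in> exponents n" "\<And>i. e i \<le> 0"
    and j: "j \<in> {1..n}" "e j = 0" and s: "1 \<le> s"
  shows "power_faces n E s (e(j := int s - 1)) = power_faces n E 1 e"
    "total_deg n (e(j := int s - 1)) = total_deg n e + int s - 1"
    "e(j := int s - 1) \<in> exponents n"
proof -
  let ?e = "e(j := int s - 1)"
  show e': "?e \<in> exponents n" using e(1) j(1) by (auto simp: exponents_def)
  have "card (copies n e) = 0" unfolding card_copies using e(2) by simp
  then have 1: "card (copies n e) < 1" by simp
  have "card (copies n ?e) = nat (?e j) + (\<Sum>i\<in>{1..n} - {j}. nat (?e i))"
    unfolding card_copies using j(1) by (simp add: sum.remove)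
  also have "(\<Sum>i\<in>{1..n} - {j}. nat (?e i)) = 0" using e(2) by simp
  finally have "card (copies n ?e) = nat (?e j)" by (simp only: add_0_right)
  moreover have "nat (?e j) < s" using s by simp
  ultimately have 2: "card (copies n ?e) < s" by (simp only:)
  have "{i. ?e i < 0} = {i. e i < 0}" using s j(2) by auto
  then show "power_faces n E s ?e = power_faces n E 1 e"
    unfolding power_faces_small[OF sg e' 2] power_faces_small[OF sg e(1) 1] by simp
  have "total_deg n ?e = ?e j + (\<Sum>i\<in>{1..n} - {j}. ?e i)" unfolding total_deg_def using j(1)
    by (simp add: sum.remove)
  moreover have "total_deg n e = e j + (\<Sum>i\<in>{1..n} - {j}. e i)" unfolding total_deg_def using j(1)
    by (simp add: sum.remove)
  moreover have "(\<Sum>i\<in>{1..n} - {j}. ?e i) = (\<Sum>i\<in>{1..n} - {j}. e i)" by (rule sum.cong) auto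
  ultimately show "total_deg n ?e = total_deg n e + int s - 1" using j(2) by simp
qed

text \<open>The reverse passage: dropping a positive part of size at most \<open>s - 1\<close>
  returns to the edge ideal and lowers the degree by that size, whence the upper bound
  \<open>reg I + s - 1\<close>.\<close>

lemma power_faces_negative_part:
  assumes sg: "simple_graph n E" and e: "e \<in> exponents n" and s: "card (copies n e) < s"
  defines "e' \<equiv> \<lambda>i. min (e i) 0"
  shows "power_faces n E s e = power_faces n E 1 e'"
    "total_deg n e = total_deg n e' + int (card (copies n e))" "e' \<in> exponents n"
proof -
  show e': "e' \<in> exponents n" using e by (auto simp: exponents_def e'_def)
  have "card (copies n e') = 0" unfolding card_copies e'_def by simp
  then have 1: "card (copies n e') < 1" by simp
  have "{i. e' i < 0} = {i. e i < 0}" by (auto simp: e'_def)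
  then show "power_faces n E s e = power_faces n E 1 e'"
    unfolding power_faces_small[OF sg e s] power_faces_small[OF sg e' 1] by simp
  have "total_deg n e = (\<Sum>i\<in>{1..n}. e' i + int (nat (e i)))" unfolding total_deg_def
    by (rule sum.cong) (auto simp: e'_def)
  then show "total_deg n e = total_deg n e' + int (card (copies n e))"
    by (simp add: total_deg_def card_copies sum.distrib)
qed

section \<open>Nonvanishing classes\<close>

lemma not_acyclic_edge_ideal:
  assumes "simple_graph n E" "E \<noteq> {}"
  shows "\<exists>e\<in>exponents n. \<not> acyclic_at TYPE('k::field) (power_faces n E 1 e) n"
proof -
  \<comment> \<open>With all entries equal to -1 the full vertex set is the only face, and its
    indicator is a cocycle that nothing bounds. This provides a member of the set whose maximum is
    the regularity of the edge ideal.\<close>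
  define e where "e = (\<lambda>i. if i \<in> {1..n} then - 1 else 0 :: int)"
  have e: "e \<in> exponents n" by (simp add: exponents_def e_def)
  have "card (copies n e) = 0" unfolding card_copies e_def by simp
  then have 1: "card (copies n e) < 1" by simp
  obtain f where f: "f \<in> E" using assms(2) by blast
  then obtain u v where "f = {u, v}" using assms(1) unfolding simple_graph_def by (metis card_2_iff)
  then have uv: "{u, v} \<in> E" using f by simp
  then have "\<not> stable E {1..n}" using simple_graph_edge(2,3)[OF assms(1) uv] unfolding stable_def
    by blast
  moreover have "{i. e i < 0} = {1..n}" by (auto simp: e_def)
  ultimately have top_only: "power_faces n E 1 e = {{1..n}}"
    unfolding power_faces_small[OF assms(1) e 1] by auto
  have "\<not> acyclic_at TYPE('k) (power_faces n E 1 e) n"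
  proof
    define c where "c = (\<lambda>\<sigma>. if \<sigma> = {1..n} then 1 else 0 :: 'k)"
    assume "acyclic_at TYPE('k) (power_faces n E 1 e) n"
    then have v: "acyclic_at TYPE('k) {{1..n}} n" unfolding top_only .
    have "\<exists>b. (\<forall>\<sigma>. b \<sigma> \<noteq> 0 \<longrightarrow> \<sigma> \<in> {{1..n}} \<and> Suc (card \<sigma>) = n) \<and> (\<forall>\<tau>\<in>{{1..n}}. card \<tau> = n \<longrightarrow>
      coboundary b \<tau> = c \<tau>)"
      by (rule acyclic_atD[OF v]) (auto simp: c_def split: if_splits)
    then obtain b where b: "\<forall>\<sigma>. b \<sigma> \<noteq> 0 \<longrightarrow> \<sigma> = {1..n} \<and> Suc (card \<sigma>) = n"
      "coboundary b {1..n} = c {1..n}" by auto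
    have "b \<sigma> = 0" for \<sigma>
    proof (rule ccontr)
      assume "b \<sigma> \<noteq> 0"
      then have "\<sigma> = {1..n}" "Suc (card \<sigma>) = n" using b(1) by blast+
      then show False by simp
    qed
    then have "coboundary b {1..n} = 0" by (intro coboundary_zero) simp
    then show False using b(2) by (simp add: c_def)
  qed
  then show ?thesis using e by blast
qed

text \<open>Choose \<open>F\<close> maximal among the stable sets without neighbours of \<open>u\<close> and \<open>v\<close>, where \<open>u v\<close> is
  an edge. With exponent \<open>s - 1\<close> on \<open>u\<close> and \<open>v\<close>, the missed faces strictly containing \<open>F\<close> split
  into those without a neighbour of \<open>u\<close> and those without a neighbour of \<open>v\<close>; the two parts are
  disconnected from each other.\<close>

lemma not_acyclic_in_generator_degree:
  assumes sg: "simple_graph n E" "E \<noteq> {}" and s: "2 \<le> s"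
  shows "\<exists>e\<in>exponents n. \<exists>q. \<not> acyclic_at TYPE('k::field) (power_faces n E s e) q \<and>
    int q + total_deg n e = 2 * int s"
proof -
  obtain f where f: "f \<in> E" using sg(2) by blast
  then obtain u v where "f = {u, v}" using sg(1) unfolding simple_graph_def by (metis card_2_iff)
  then have uv: "{u, v} \<in> E" using f by simp
  have vu: "{v, u} \<in> E" using uv by (simp add: insert_commute)
  have ne: "u \<noteq> v" and uV: "u \<in> {1..n}" and vV: "v \<in> {1..n}" using simple_graph_edge[OF sg(1) uv]
    by blast+
  have irr: "{x, x} \<notin> E" for x using simple_graph_edge(1)[OF sg(1), of x x] by blast
  define Z where "Z = {F. F \<subseteq> {1..n} \<and> stable E F \<and> (\<forall>x\<in>F. {x, u} \<notin> E \<and> {x, v} \<notin> E)}"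
  have "finite Z" by (rule finite_subset[of _ "Pow {1..n}"]) (auto simp: Z_def)
  moreover have "{} \<in> Z" by (simp add: Z_def stable_def)
  ultimately obtain F where F: "F \<in> Z" and max: "\<And>G. G \<in> Z \<Longrightarrow> F \<subseteq> G \<Longrightarrow> F = G"
    using finite_has_maximal[of Z] by blast
  have FV: "F \<subseteq> {1..n}" "stable E F" and Fuv: "\<And>x. x \<in> F \<Longrightarrow> {x, u} \<notin> E \<and> {x, v} \<notin> E" using F
    unfolding Z_def by blast+
  have finF: "finite F" using finite_subset[OF FV(1)] by simp
  have uF: "u \<notin> F" "v \<notin> F" using Fuv uv vu by blast+
  \<comment> \<open>The entries -1 on \<open>F\<close> cancel \<open>card F\<close> in the
    cohomological degree \<open>card F + 2\<close>; the remaining 2 and the two entries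
    \<open>s - 1\<close> add up to \<open>2 * s\<close>.\<close>
  define e where "e = (\<lambda>i. if i = u \<or> i = v then int s - 1 else if i \<in> F then - 1 else 0)"
  have e: "e \<in> exponents n" using uV vV FV(1) by (auto simp: exponents_def e_def)
  have N: "{i. e i < 0} = F" using uF s by (auto simp: e_def)
  let ?U = "copies n e" and ?h = "copy_adj E"
  have Umem: "p \<in> ?U \<longleftrightarrow> fst p \<in> {u, v} \<and> snd p < s - 1" for p
    using uV vV s by (cases p) (auto simp: copies_def e_def nat_diff_distrib)
  have fu: "fst p = u \<or> fst p = v" if "p \<in> ?U" for p using Umem that by blast
  have lcoeff: "card {p \<in> ?U. fst p = u} = s - 1" "card {p \<in> ?U. fst p = v} = s - 1"
    using card_copies_fiber[OF uV, of e] card_copies_fiber[OF vV, of e]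
      by (simp_all add: e_def nat_diff_distrib)
  have split: "?U = {p \<in> ?U. fst p = u} \<union> {p \<in> ?U. fst p = v}" using Umem by blast
  have cU: "card ?U = 2 * (s - 1)"
  proof -
    have "card ({p \<in> ?U. fst p = u} \<union> {p \<in> ?U. fst p = v}) = card {p \<in> ?U. fst p =
      u} + card {p \<in> ?U. fst p = v}"
      by (rule card_Un_disjoint) (use ne in auto)
    then show ?thesis using split lcoeff by simp
  qed
  have irrh: "\<not> ?h p p" for p using irr by (simp add: copy_adj_def)
  \<comment> \<open>The copies of one endpoint are \<open>s - 1\<close> many and leave no edge, so
    they are deficient; the copies of both are \<open>2 * (s - 1)\<close> many, which is at least
    \<open>s\<close>, so they are not.\<close>
  have K: "\<sigma> \<in> missed_faces n E F ?U s \<longleftrightarrow>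
    F \<subseteq> \<sigma> \<and> \<sigma> \<subseteq> {1..n} \<and> stable E \<sigma> \<and> \<not> (u \<in> nbhd E \<sigma> \<and> v \<in> nbhd E \<sigma>)" for \<sigma>
  proof -
    define S where "S = {p \<in> ?U. fst p \<in> nbhd E \<sigma>}"
    have one: "S \<in> deficient ?h s ?U" if w: "S = {p \<in> ?U. fst p = w}" "{w, w'} = {u, v}" for w w'
    proof -
      have "card S = s - 1" using w lcoeff by (auto simp: doubleton_eq_iff)
      moreover have "\<not> has_matching ?h 1 (?U - S)"
      proof
        assume "has_matching ?h 1 (?U - S)"
        then obtain p q where pq: "p \<in> ?U - S" "q \<in> ?U - S" "{fst p, fst q} \<in> E"
          unfolding has_matching_1_iff copy_adj_def by blast
        then have "fst p \<in> {w, w'}" "fst q \<in> {w, w'}" unfolding w(2) using Umem by blast+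
        then have "fst p = w'" "fst q = w'" using pq(1,2) w(1) by blast+
        then show False using pq(3) irr by simp
      qed
      ultimately show ?thesis by (intro deficientI[where k = 1]) (use s in \<open>auto simp: S_def\<close>)
    qed
    have "S \<in> deficient ?h s ?U \<longleftrightarrow> \<not> (u \<in> nbhd E \<sigma> \<and> v \<in> nbhd E \<sigma>)"
    proof (cases "u \<in> nbhd E \<sigma>"; cases "v \<in> nbhd E \<sigma>")
      assume a: "u \<in> nbhd E \<sigma>" "v \<in> nbhd E \<sigma>"
      then have "S = ?U" unfolding S_def by (auto dest: fu)
      then show ?thesis using a deficient_card[of S ?h s ?U] cU s by auto
    next
      assume a: "u \<in> nbhd E \<sigma>" "v \<notin> nbhd E \<sigma>"
      then have "S = {p \<in> ?U. fst p = u}" unfolding S_def by (auto dest: fu)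
      then show ?thesis using one[of u v] a by simp
    next
      assume a: "u \<notin> nbhd E \<sigma>" "v \<in> nbhd E \<sigma>"
      then have "S = {p \<in> ?U. fst p = v}" unfolding S_def by (auto dest: fu)
      then show ?thesis using one[of v u] a by (simp add: insert_commute)
    next
      assume a: "u \<notin> nbhd E \<sigma>" "v \<notin> nbhd E \<sigma>"
      then have "S = {}" unfolding S_def by (auto dest: fu)
      moreover have "\<not> has_matching ?h s ?U"
        using has_matching_card[where h = ?h, OF irrh finite_copies, of s n e] cU s by auto
      ultimately show ?thesis using a by (simp add: deficient_def)
    qed
    then show ?thesis unfolding missed_faces_def S_def by blast
  qed
  define Q where "Q = missed_faces n E F ?U s"
  have Qd: "downset F Q" unfolding Q_def by (rule missed_faces_downset) simp
  let ?q = "card F + 1"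
  have "\<not> acyclic_at TYPE('k) (power_faces n E s e) (Suc ?q)"
  proof
    assume "acyclic_at TYPE('k) (power_faces n E s e) (Suc ?q)"
    then have R: "acyclic_at TYPE('k) ({\<sigma>. F \<subseteq> \<sigma> \<and> \<sigma> \<subseteq> {1..n}} - missed_faces n E F ?U s) (Suc ?q)"
      unfolding power_faces_missed_faces[OF sg(1) e] N .
    have "F \<noteq> {1..n}" using uF uV by blast
    then have I: "acyclic_at TYPE('k) {\<sigma>. F \<subseteq> \<sigma> \<and> \<sigma> \<subseteq> {1..n}} ?q"
      by (intro acyclic_at_interval) auto
    have vQ: "acyclic_at TYPE('k) Q ?q"
      unfolding Q_def by (rule acyclic_at_lower_part[OF downset_convex[OF interval_downset]
        missed_faces_lower_part[OF finite_copies] I R])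
    define d where "d = (\<lambda>\<sigma>. if \<sigma> = F then 1 else 0 :: 'k)"
    \<comment> \<open>The coboundary of the indicator of \<open>F\<close>, kept only on faces
      without a neighbour of \<open>u\<close>. A cochain bounding \<open>c\<close> would live on
      \<open>F\<close> alone and take the value 1 there because of \<open>insert u F\<close>, but 0
      because of \<open>insert v F\<close>.\<close>
    define c where "c = (\<lambda>\<sigma>. if \<sigma> \<in> Q \<and> card \<sigma> = ?q \<and> u \<notin> nbhd E \<sigma> then coboundary d \<sigma> else 0)"
    have FQ: "F \<in> Q" unfolding Q_def K using FV Fuv unfolding nbhd_def by blast
    have coc: "coboundary c \<tau> = 0" if \<tau>: "\<tau> \<in> Q" "card \<tau> = Suc ?q" for \<tau>
    proof (cases "u \<in> nbhd E \<tau>")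
      case True
      then have vn: "v \<notin> nbhd E \<tau>" using \<tau>(1) unfolding Q_def K by blast
      show ?thesis
      proof (rule coboundary_zero, rule ccontr)
        fix l assume l: "l \<in> \<tau>" "c (\<tau> - {l}) \<noteq> 0"
        then have *: "\<tau> - {l} \<in> Q" "card (\<tau> - {l}) = ?q" "u \<notin> nbhd E (\<tau> - {l})" unfolding c_def
          by (auto split: if_splits)
        have "v \<notin> nbhd E (\<tau> - {l})" using vn nbhd_mono[of "\<tau> - {l}" \<tau> E] by blast
        \<comment> \<open>A face above \<open>F\<close> with neighbours of neither \<open>u\<close>
          nor \<open>v\<close> equals \<open>F\<close> by maximality, which has the wrong size; so
          the two halves do not interact.\<close>
        then have "\<tau> - {l} \<in> Z" using *(1,3) unfolding Z_def Q_def K nbhd_def by blast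
        moreover have "F \<subseteq> \<tau> - {l}" using *(1) unfolding Q_def K by blast
        ultimately have "F = \<tau> - {l}" by (rule max)
        then show False using *(2) by simp
      qed
    next
      case False
      have fin: "finite \<tau>" by (rule downset_finite[OF Qd \<tau>(1)])
      have "coboundary c \<tau> = coboundary (\<lambda>\<sigma>. if \<sigma> \<in> Q then coboundary d \<sigma> else 0) \<tau>"
      proof (rule coboundary_cong)
        fix l assume "l \<in> \<tau>"
        then have "card (\<tau> - {l}) = ?q" using \<tau>(2) fin by simp
        moreover have "u \<notin> nbhd E (\<tau> - {l})" using False nbhd_mono[of "\<tau> - {l}" \<tau> E] by blast
        ultimately show "c (\<tau> - {l}) = (if \<tau> - {l} \<in> Q then coboundary d (\<tau> - {l}) else 0)"
          by (simp add: c_def)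
      qed
      also have "\<dots> = 0" by (rule coboundary_coboundary_convex[OF downset_convex[OF Qd] \<tau>(1)]) (use
        FQ in \<open>auto simp: d_def split: if_splits\<close>)
      finally show ?thesis .
    qed
    have "\<exists>b. (\<forall>\<sigma>. b \<sigma> \<noteq> 0 \<longrightarrow> \<sigma> \<in> Q \<and> Suc (card \<sigma>) = ?q) \<and> (\<forall>\<tau>\<in>Q. card \<tau> = ?q \<longrightarrow>
      coboundary b \<tau> = c \<tau>)"
      by (rule acyclic_atD[OF vQ _ coc]) (auto simp: c_def split: if_splits)
    then obtain b where b: "\<And>\<sigma>. b \<sigma> \<noteq> 0 \<Longrightarrow> \<sigma> \<in> Q \<and> card \<sigma> = card F"
      and db: "\<And>\<tau>. \<tau> \<in> Q \<Longrightarrow> card \<tau> = ?q \<Longrightarrow> coboundary b \<tau> = c \<tau>" by auto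
    have supp: "\<sigma> = F" if "b \<sigma> \<noteq> 0" for \<sigma>
    proof -
      have "\<sigma> \<in> Q" "card F = card \<sigma>" using b[OF that] by simp_all
      then show ?thesis using card_subset_eq[OF downset_finite[OF Qd] downset_base[OF Qd]] by metis
    qed
    have eval_F: "coboundary g (insert w F) = face_sign (insert w F) w * g F" if w: "w \<notin> F"
      and g: "\<And>\<sigma>. g \<sigma> \<noteq> 0 \<Longrightarrow> \<sigma> = F" for g :: "nat set \<Rightarrow> 'k" and w
    proof -
      have "g (insert w F - {l}) = 0" if "l \<in> F" for l
      proof (rule ccontr)
        assume "g (insert w F - {l}) \<noteq> 0"
        then have "insert w F - {l} = F" by (rule g)
        then show False using that by blast
      qed
      then have "(\<Sum>l\<in>F. face_sign (insert w F) l * g (insert w F - {l})) = 0" by simp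
      moreover have "insert w F - {w} = F" using w by simp
      ultimately show ?thesis unfolding coboundary_def using w finF by simp
    qed
    have mem: "insert w F \<in> Q" "w \<notin> nbhd E (insert w F)" if w: "w = u \<or> w = v" for w
    proof -
      have adj: "{x, w} \<notin> E" "{w, x} \<notin> E" if "x \<in> F" for x using Fuv[OF that] w
        by (auto simp: insert_commute)
      then have "stable E (insert w F)" using FV(2) irr unfolding stable_def by blast
      moreover show wn: "w \<notin> nbhd E (insert w F)" using adj irr unfolding nbhd_def by blast
      moreover have "w \<in> {1..n}" using w uV vV by blast
      ultimately show "insert w F \<in> Q" unfolding Q_def K using FV(1) w by blast
    qed
    have dF: "\<sigma> = F" if "d \<sigma> \<noteq> 0" for \<sigma> using that by (simp add: d_def split: if_splits)
    have "coboundary b (insert u F) = coboundary d (insert u F)"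
      using db[OF mem(1)[of u]] mem[of u] uF finF by (simp add: c_def)
    moreover have "coboundary b (insert u F) = face_sign (insert u F) u * b F"
      by (rule eval_F[OF uF(1)]) (rule supp)
    moreover have "coboundary d (insert u F) = face_sign (insert u F) u * d F"
      by (rule eval_F[OF uF(1)]) (rule dF)
    ultimately have "face_sign (insert u F) u * b F = face_sign (insert u F) u * (1 :: 'k)"
      by (simp add: d_def)
    then have "b F = 1" by simp
    have "u \<in> nbhd E (insert v F)" using vu unfolding nbhd_def by blast
    then have "coboundary b (insert v F) = 0" using db[OF mem(1)[of v]] uF finF by (simp add: c_def)
    moreover have "coboundary b (insert v F) = face_sign (insert v F) v * b F"
      by (rule eval_F[OF uF(2)]) (rule supp)
    ultimately have "face_sign (insert v F) v * b F = (0 :: 'k)" by simp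
    then show False using \<open>b F = 1\<close> by simp
  qed
  moreover have "int (Suc ?q) + total_deg n e = 2 * int s"
  proof -
    have "total_deg n e = (\<Sum>i\<in>{u, v} \<union> F. e i)"
      unfolding total_deg_def by (rule sum.mono_neutral_right) (use uV vV FV(1) in \<open>auto simp:
        e_def\<close>)
    also have "\<dots> = (\<Sum>i\<in>{u, v}. e i) + (\<Sum>i\<in>F. e i)"
      by (rule sum.union_disjoint) (use finF uF in auto)
    also have "(\<Sum>i\<in>F. e i) = (\<Sum>i\<in>F. - 1)" by (rule sum.cong) (use uF in \<open>auto simp: e_def\<close>)
    also have "(\<Sum>i\<in>{u, v}. e i) = 2 * (int s - 1)" using ne by (simp add: e_def)
    finally show ?thesis by simp
  qed
  ultimately show ?thesis using e by blast
qed

section \<open>Comparison of the greatest values\<close>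

definition reg_values :: "'k::field itself \<Rightarrow> nat \<Rightarrow> nat set set \<Rightarrow> nat \<Rightarrow> int set" where
  "reg_values K n E s = {r. \<exists>q. \<exists>e\<in>exponents n. r = int q + total_deg n e \<and>
    \<not> acyclic_at K (power_faces n E s e) q}"

lemma reg_valuesI: "e \<in> exponents n \<Longrightarrow> \<not> acyclic_at K (power_faces n E s e) q \<Longrightarrow>
  int q + total_deg n e \<in> reg_values K n E s"
  unfolding reg_values_def by blast

text \<open>This gives \<open>GREATEST\<close> a meaning on the integers, where an upper bound has
  to be combined with a member to obtain a finite set.\<close>

lemma int_set_has_greatest:
  fixes A :: "int set"
  assumes "A \<noteq> {}" "\<And>x. x \<in> A \<Longrightarrow> x \<le> B"
  shows "\<exists>g\<in>A. \<forall>x\<in>A. x \<le> g"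
proof -
  obtain a where a: "a \<in> A" using assms(1) by blast
  let ?A = "A \<inter> {a..B}"
  have f: "finite ?A" "?A \<noteq> {}" using a assms(2)[OF a] by auto
  have m: "Max ?A \<in> ?A" by (rule Max_in[OF f])
  have m2: "x \<le> Max ?A" if "x \<in> ?A" for x by (rule Max_ge[OF f(1) that])
  have "x \<le> Max ?A" if "x \<in> A" for x
  proof (cases "a \<le> x")
    case True
    then show ?thesis using m2[of x] that assms(2)[OF that] by simp
  next
    case False
    then show ?thesis using m by simp
  qed
  then show ?thesis using m by blast
qed

lemma Greatest_reg_values:
  assumes sg: "simple_graph n E" "gap_free E" "E \<noteq> {}" and s: "s \<in> {2, 3}"
  shows "(GREATEST r. r \<in> reg_values TYPE('k::field) n E s) =
    max ((GREATEST r. r \<in> reg_values TYPE('k) n E 1) + int s - 1) (2 * int s)"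
proof -
  let ?A = "reg_values TYPE('k) n E 1"
  \<comment> \<open>The conclusion of \<open>total_deg_bound\<close> contains
    \<open>s \<noteq> 1\<close>, so for the edge ideal its hypothesis on
    \<open>card (copies n e)\<close> must fail.\<close>
  have nonpos: "e i \<le> 0" if e: "e \<in> exponents n"
    and nv: "\<not> acyclic_at TYPE('k) (power_faces n E 1 e) q" for e q i
  proof (rule ccontr)
    assume pos: "\<not> e i \<le> 0"
    then have "i \<in> {1..n}" using exponentsD[OF e, of i] by fastforce
    then have "(i, 0) \<in> copies n e" using pos by (simp add: copies_def)
    then have "1 \<le> card (copies n e)" using card_gt_0_iff[of "copies n e"] by fastforce
    then show False using total_deg_bound[OF sg(1,2) e _ _ nv] by simp
  qed
  have bound: "r \<le> int n" if rA: "r \<in> ?A" for r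
  proof -
    obtain q e where r: "e \<in> exponents n" "r = int q + total_deg n e"
      "\<not> acyclic_at TYPE('k) (power_faces n E 1 e) q"
      using rA unfolding reg_values_def by blast
    have "total_deg n e \<le> 0" unfolding total_deg_def
      by (rule sum_nonpos) (use nonpos[OF r(1,3)] in blast)
    moreover have "q \<le> n"
    proof (rule ccontr)
      assume "\<not> q \<le> n"
      moreover have "card \<sigma> \<le> n" if "\<sigma> \<in> power_faces n E 1 e" for \<sigma>
        using card_mono[of "{1..n}" \<sigma>] that unfolding power_faces_def by simp
      ultimately have "acyclic_at TYPE('k) (power_faces n E 1 e) q"
        by (intro acyclic_at_empty_degree) auto
      then show False using r(3) by simp
    qed
    ultimately show ?thesis using r(2) by simp
  qed
  have "?A \<noteq> {}" using not_acyclic_edge_ideal[OF sg(1,3), where 'k = 'k] unfolding reg_values_def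
    by blast
  then have "\<exists>g\<in>?A. \<forall>x\<in>?A. x \<le> g" by (rule int_set_has_greatest) (rule bound)
  then obtain g where g: "g \<in> ?A" "\<And>x. x \<in> ?A \<Longrightarrow> x \<le> g" by blast
  have G1: "(GREATEST r. r \<in> ?A) = g" by (rule Greatest_equality) (use g in auto)
  have s2: "2 \<le> s" using s by auto
  let ?m = "max (g + int s - 1) (2 * int s)"
  have "(GREATEST r. r \<in> reg_values TYPE('k) n E s) = ?m"
  proof (rule Greatest_equality)
    fix r assume "r \<in> reg_values TYPE('k) n E s"
    then obtain q e where r: "e \<in> exponents n" "r = int q + total_deg n e"
      "\<not> acyclic_at TYPE('k) (power_faces n E s e) q"
      unfolding reg_values_def by blast
    show "r \<le> ?m"
    proof (cases "s \<le> card (copies n e)")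
      case True
      then show ?thesis using total_deg_bound[OF sg(1,2) r(1) _ True r(3)] s r(2) by auto
    next
      case False
      then have lt: "card (copies n e) < s" by simp
      note L = power_faces_negative_part[OF sg(1) r(1) lt]
      have "int q + total_deg n (\<lambda>i. min (e i) 0) \<in> ?A"
        by (rule reg_valuesI[OF L(3)]) (use r(3) L(1) in simp)
      then show ?thesis using g(2) L(2) r(2) lt by fastforce
    qed
  next
    have double: "2 * int s \<in> reg_values TYPE('k) n E s"
    proof -
      obtain e q where "e \<in> exponents n" "\<not> acyclic_at TYPE('k) (power_faces n E s e) q"
        "int q + total_deg n e = 2 * int s"
        using not_acyclic_in_generator_degree[OF sg(1,3) s2, where 'k = 'k] by blast
      then show ?thesis using reg_valuesI by metis
    qed
    obtain q e where r: "e \<in> exponents n" "g = int q + total_deg n e"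
      "\<not> acyclic_at TYPE('k) (power_faces n E 1 e) q"
      using g(1) unfolding reg_values_def by blast
    show "?m \<in> reg_values TYPE('k) n E s"
    proof (cases "\<exists>j\<in>{1..n}. e j = 0")
      case True
      then obtain j where j: "j \<in> {1..n}" "e j = 0" by blast
      have "1 \<le> s" using s2 by simp
      note L = power_faces_raise[OF sg(1) r(1) nonpos[OF r(1,3)] j this]
      have "g + int s - 1 \<in> reg_values TYPE('k) n E s"
      proof -
        have "int q + total_deg n (e(j := int s - 1)) \<in> reg_values TYPE('k) n E s"
          by (rule reg_valuesI[OF L(3)]) (use L(1) r(3) in simp)
        then show ?thesis unfolding L(2) r(2) by (simp add: algebra_simps)
      qed
      then show ?thesis using double by (simp add: max_def)
    next
      case False
      \<comment> \<open>Without a zero coordinate there is nothing to raise, but then all entries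
        are at most -1, so \<open>g \<le> 0\<close> and \<open>2 * s\<close> is the larger
        value.\<close>
      have "e i \<le> - 1" if "i \<in> {1..n}" for i using False nonpos[OF r(1,3), of i] that by force
      then have "total_deg n e \<le> (\<Sum>i\<in>{1..n}. - 1)" unfolding total_deg_def by (rule sum_mono)
      moreover have "q \<le> n"
      proof (rule ccontr)
        assume "\<not> q \<le> n"
        moreover have "card \<sigma> \<le> n" if "\<sigma> \<in> power_faces n E 1 e" for \<sigma>
          using card_mono[of "{1..n}" \<sigma>] that unfolding power_faces_def by simp
        ultimately have "acyclic_at TYPE('k) (power_faces n E 1 e) q"
          by (intro acyclic_at_empty_degree) auto
        then show False using r(3) by simp
      qed
      ultimately have "g \<le> 0" using r(2) by simp
      then show ?thesis using double s2 by (simp add: max_def)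
    qed
  qed
  then show ?thesis unfolding G1 .
qed

section \<open>Monomial ideals and powers of the edge ideal\<close>

text \<open>A polynomial lies in a monomial ideal iff all its monomials do, so the ideal is given by
  a predicate on exponent vectors; \<open>up_closed\<close> is the condition that makes it an
  ideal.\<close>

definition mono_ideal :: "nat \<Rightarrow> ((nat \<Rightarrow> nat) \<Rightarrow> bool) \<Rightarrow> 'k::field mpoly set" where
  "mono_ideal n P = {p. \<forall>m\<in>Poly_Mapping.keys p. Poly_Mapping.keys m \<subseteq> {1..n} \<and>
    P (Poly_Mapping.lookup m)}"

definition up_closed :: "((nat \<Rightarrow> nat) \<Rightarrow> bool) \<Rightarrow> bool" where
  "up_closed P \<longleftrightarrow> (\<forall>a b. P a \<longrightarrow> (\<forall>i. a i \<le> b i) \<longrightarrow> P b)"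

lemma up_closedD: "up_closed P \<Longrightarrow> P a \<Longrightarrow> (\<And>i. a i \<le> b i) \<Longrightarrow> P b"
  unfolding up_closed_def by blast

lemma sum_singles:
  fixes p :: "'a \<Rightarrow>\<^sub>0 'b::comm_monoid_add"
  shows "(\<Sum>m\<in>Poly_Mapping.keys p. Poly_Mapping.single m (Poly_Mapping.lookup p m)) = p"
proof (rule poly_mapping_eqI)
  fix k
  have "Poly_Mapping.lookup (\<Sum>m\<in>Poly_Mapping.keys p. Poly_Mapping.single m (Poly_Mapping.lookup p m)) k =
      (\<Sum>m\<in>Poly_Mapping.keys p. if m = k then Poly_Mapping.lookup p k else 0)"
    unfolding lookup_sum by (rule sum.cong) (auto simp: lookup_single)
  also have "\<dots> = Poly_Mapping.lookup p k" by (simp add: in_keys_iff)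
  finally show "Poly_Mapping.lookup (\<Sum>m\<in>Poly_Mapping.keys p. Poly_Mapping.single m (Poly_Mapping.lookup p m)) k =
      Poly_Mapping.lookup p k" .
qed

lemma lookup_single_mult:
  fixes p :: "'k::field mpoly"
  shows "Poly_Mapping.lookup (Poly_Mapping.single t c * p) k =
    (\<Sum>m\<in>Poly_Mapping.keys p. if t + m = k then c * Poly_Mapping.lookup p m else 0)"
proof -
  have "Poly_Mapping.single t c * p =
      (\<Sum>m\<in>Poly_Mapping.keys p. Poly_Mapping.single (t + m) (c * Poly_Mapping.lookup p m))"
    by (subst sum_singles[of p, symmetric]) (simp only: sum_distrib_left mult_single)
  then show ?thesis unfolding lookup_sum
    by (auto simp: lookup_single when_def lookup_sum intro: sum.cong)
qed

lemma lookup_single_mult_add: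
  fixes p :: "'k::field mpoly"
  shows "Poly_Mapping.lookup (Poly_Mapping.single t c * p) (t + m) = c * Poly_Mapping.lookup p m"
proof -
  have "(\<Sum>m'\<in>Poly_Mapping.keys p. if t + m' = t + m then c * Poly_Mapping.lookup p m' else 0) =
      (\<Sum>m'\<in>Poly_Mapping.keys p. if m' = m then c * Poly_Mapping.lookup p m else 0)"
    by (rule sum.cong) auto
  then show ?thesis unfolding lookup_single_mult by (simp add: in_keys_iff)
qed

lemma lookup_single_mult_zero:
  fixes p :: "'k::field mpoly"
  assumes "\<And>m. k \<noteq> t + m"
  shows "Poly_Mapping.lookup (Poly_Mapping.single t c * p) k = 0"
  unfolding lookup_single_mult using assms by (intro sum.neutral) metis

lemma mono_ideal_zero: "0 \<in> mono_ideal n P"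
  by (simp add: mono_ideal_def)

lemma mono_ideal_add: "p \<in> mono_ideal n P \<Longrightarrow> q \<in> mono_ideal n P \<Longrightarrow> p + q \<in> mono_ideal n P"
  using Poly_Mapping.keys_add[of p q] unfolding mono_ideal_def by blast

lemma mono_ideal_uminus: "p \<in> mono_ideal n P \<Longrightarrow> - p \<in> mono_ideal n P"
  by (simp add: mono_ideal_def in_keys_iff)

lemma carrier_mpoly: "carrier (mpoly_ring n) = mono_ideal n (\<lambda>_. True)"
  by (simp add: mpoly_ring_def mono_ideal_def)

lemma mpoly_ring_simps [simp]:
  "monoid.mult (mpoly_ring n) = (*)" "one (mpoly_ring n) = 1"
  "ring.zero (mpoly_ring n) = 0" "add (mpoly_ring n) = (+)"
  by (simp_all add: mpoly_ring_def)

text \<open>Depending on \<open>P\<close>, \<open>Q\<close> and \<open>T\<close>, this yields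
  closure of the ring, absorption by an ideal, and products of ideals.\<close>

lemma mono_ideal_mult:
  assumes "p \<in> mono_ideal n P" "q \<in> mono_ideal n Q"
    and "\<And>a b. P a \<Longrightarrow> Q b \<Longrightarrow> T (\<lambda>i. a i + b i)"
  shows "p * q \<in> mono_ideal n T"
  unfolding mono_ideal_def
proof (intro CollectI ballI)
  fix m assume "m \<in> Poly_Mapping.keys (p * q)"
  then obtain a b where ab: "m = a + b" "a \<in> Poly_Mapping.keys p" "b \<in> Poly_Mapping.keys q"
    using keys_mult[of p q] by blast
  have a: "Poly_Mapping.keys a \<subseteq> {1..n}" "P (Poly_Mapping.lookup a)" using assms(1) ab(2)
    unfolding mono_ideal_def by blast+
  have b: "Poly_Mapping.keys b \<subseteq> {1..n}" "Q (Poly_Mapping.lookup b)" using assms(2) ab(3)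
    unfolding mono_ideal_def by blast+
  have "Poly_Mapping.lookup m = (\<lambda>i. Poly_Mapping.lookup a i + Poly_Mapping.lookup b i)"
    unfolding ab(1) by (rule ext) (rule lookup_add)
  then show "Poly_Mapping.keys m \<subseteq> {1..n} \<and> T (Poly_Mapping.lookup m)"
    using a b assms(3) Poly_Mapping.keys_add[of a b] unfolding ab(1) by auto
qed

lemma mono_ideal_lmult:
  assumes "up_closed P" "p \<in> mono_ideal n P" "r \<in> carrier (mpoly_ring n)"
  shows "r * p \<in> mono_ideal n P"
  by (rule mono_ideal_mult[OF assms(3)[unfolded carrier_mpoly] assms(2)]) (rule up_closedD[OF
    assms(1)], auto)

lemma mono_ideal_rmult:
  assumes "up_closed P" "p \<in> mono_ideal n P" "r \<in> carrier (mpoly_ring n)"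
  shows "p * r \<in> mono_ideal n P"
  using mono_ideal_lmult[OF assms] by (simp add: mult.commute)

lemma mono_ideal_carrier: "p \<in> mono_ideal n P \<Longrightarrow> p \<in> carrier (mpoly_ring n)"
  by (simp add: carrier_mpoly mono_ideal_def)

lemma ring_mpoly: "ring (mpoly_ring n :: 'k::field mpoly ring)"
proof (rule ringI)
  let ?R = "mpoly_ring n :: 'k mpoly ring"
  show "abelian_group ?R"
  proof (rule abelian_groupI)
    fix p assume "p \<in> carrier ?R"
    then show "\<exists>q\<in>carrier ?R. q \<oplus>\<^bsub>?R\<^esub> p = \<zero>\<^bsub>?R\<^esub>"
      by (intro bexI[of _ "- p"]) (simp_all add: carrier_mpoly mono_ideal_uminus)
  qed (simp_all add: carrier_mpoly mono_ideal_zero mono_ideal_add ac_simps)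
  show "monoid ?R"
    by (rule monoidI) (simp_all add: carrier_mpoly mono_ideal_mult mult.assoc, simp add:
      mono_ideal_def)
qed (simp_all add: algebra_simps)

lemma ideal_mono_ideal:
  assumes "up_closed P"
  shows "ideal (mono_ideal n P :: 'k::field mpoly set) (mpoly_ring n)"
proof (rule idealI[OF ring_mpoly])
  let ?R = "mpoly_ring n :: 'k mpoly ring"
  interpret ring ?R by (rule ring_mpoly)
  show "subgroup (mono_ideal n P) (add_monoid ?R)"
  proof (rule add.subgroupI)
    show "mono_ideal n P \<subseteq> carrier ?R" using mono_ideal_carrier by blast
    show "(mono_ideal n P :: 'k mpoly set) \<noteq> {}" using mono_ideal_zero by blast
    fix p :: "'k mpoly" assume p: "p \<in> mono_ideal n P"
    have "\<ominus>\<^bsub>?R\<^esub> p = - p"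
      by (rule minus_equality) (simp_all add: mono_ideal_carrier[OF p] mono_ideal_carrier[OF
        mono_ideal_uminus[OF p]])
    then show "\<ominus>\<^bsub>?R\<^esub> p \<in> mono_ideal n P" using mono_ideal_uminus[OF p] by simp
  qed (simp add: mono_ideal_add)
qed (simp_all add: mono_ideal_lmult[OF assms] mono_ideal_rmult[OF assms])

section \<open>Powers of the edge ideal are monomial\<close>

lemma up_closed_in_power: "up_closed (in_power E k)"
  unfolding up_closed_def using in_power_mono by blast

lemma in_power_add:
  assumes sg: "simple_graph n E" and a: "in_power E k a" and b: "in_power E 1 b"
  shows "in_power E (Suc k) (\<lambda>i. a i + b i)"
proof -
  obtain u v where uv: "{u, v} \<in> E" "0 < b u" "0 < b v" using b by auto
  have ne: "u \<noteq> v" using simple_graph_edge(1)[OF sg uv(1)] .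
  have "in_power E k ((\<lambda>i. a i + b i)(u := a u + b u - 1, v := a v + b v - 1))"
    by (rule in_power_mono[OF a]) (use uv in auto)
  then show ?thesis using uv by auto
qed

lemma single_mono_ideal:
  "Poly_Mapping.keys m \<subseteq> {1..n} \<Longrightarrow> P (Poly_Mapping.lookup m) \<Longrightarrow>
    Poly_Mapping.single m c \<in> mono_ideal n P"
  by (simp add: mono_ideal_def)

lemma edge_var: "Var u * Var v =
  (Poly_Mapping.single (Poly_Mapping.single u 1 + Poly_Mapping.single v 1) 1 :: 'k::field mpoly)"
  by (simp add: Var_def mult_single)

text \<open>The edge split off by \<open>in_power\<close> divides the monomial, and the quotient
  lies in the next lower power; by additivity the inclusion of ideals follows from this
  case.\<close>

lemma single_edge_factor:
  fixes c :: "'k::field"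
  assumes sg: "simple_graph n E"
    and m: "Poly_Mapping.keys m \<subseteq> {1..n}" "in_power E (Suc k) (Poly_Mapping.lookup m)"
  shows "\<exists>u v q. {u, v} \<in> E \<and> q \<in> mono_ideal n (in_power E k) \<and> Poly_Mapping.single m c =
    q * (Var u * Var v)"
proof -
  obtain u v where uv: "{u, v} \<in> E" "0 < Poly_Mapping.lookup m u" "0 < Poly_Mapping.lookup m v"
    and pk: "in_power E k ((Poly_Mapping.lookup m)(u := Poly_Mapping.lookup m u - 1, v := Poly_Mapping.lookup m v - 1))"
    using m(2) by auto
  have ne: "u \<noteq> v" using simple_graph_edge(1)[OF sg uv(1)] .
  define t where "t = m - (Poly_Mapping.single u 1 + Poly_Mapping.single v 1)"
  have tl: "Poly_Mapping.lookup t =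
    (Poly_Mapping.lookup m)(u := Poly_Mapping.lookup m u - 1, v := Poly_Mapping.lookup m v - 1)"
    using ne by (auto simp: t_def lookup_minus lookup_add lookup_single when_def)
  have eq: "m = t + (Poly_Mapping.single u 1 + Poly_Mapping.single v 1)"
    by (rule poly_mapping_eqI) (use ne uv in \<open>auto simp: lookup_add tl lookup_single when_def\<close>)
  have "Poly_Mapping.keys t \<subseteq> Poly_Mapping.keys m" by (auto simp: in_keys_iff tl split: if_splits)
  then have "Poly_Mapping.single t c \<in> mono_ideal n (in_power E k)"
    by (intro single_mono_ideal) (use m(1) pk tl in auto)
  moreover have "Poly_Mapping.single m c = Poly_Mapping.single t c * (Var u * Var v)"
    unfolding edge_var mult_single eq[symmetric] by (simp only: mult_1_right)
  ultimately show ?thesis using uv(1) by blast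
qed

lemma edge_mem:
  assumes "simple_graph n E" "{u, v} \<in> E"
  shows "(Var u * Var v :: 'k::field mpoly) \<in> mono_ideal n (in_power E 1)"
  unfolding edge_var
proof (rule single_mono_ideal)
  note e = simple_graph_edge[OF assms]
  show "Poly_Mapping.keys (Poly_Mapping.single u 1 + Poly_Mapping.single v (1::nat)) \<subseteq> {1..n}"
    using e(2,3) Poly_Mapping.keys_add[of "Poly_Mapping.single u 1"
      "Poly_Mapping.single v (1::nat)"] by auto
  show "in_power E 1 (Poly_Mapping.lookup (Poly_Mapping.single u 1 + Poly_Mapping.single v 1))"
    unfolding One_nat_def in_power.simps
    by (intro exI[of _ u] exI[of _ v]) (use assms(2) in \<open>simp add: lookup_add\<close>)
qed

declare in_power.simps(2) [simp del]

lemma edge_ideal_mono: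
  assumes sg: "simple_graph n E"
  shows "edge_ideal n E = (mono_ideal n (in_power E 1) :: 'k::field mpoly set)"
proof
  let ?R = "mpoly_ring n :: 'k mpoly ring"
  show "edge_ideal n E \<subseteq> (mono_ideal n (in_power E 1) :: 'k mpoly set)"
    unfolding edge_ideal_def genideal_def
      using ideal_mono_ideal[OF up_closed_in_power] edge_mem[OF sg] by blast
  show "(mono_ideal n (in_power E 1) :: 'k mpoly set) \<subseteq> edge_ideal n E"
    unfolding edge_ideal_def genideal_def
  proof (intro subsetI InterI)
    fix p :: "'k mpoly" and I
    assume p: "p \<in> mono_ideal n (in_power E 1)"
      and "I \<in> {I. ideal I ?R \<and> {Var i * Var j |i j. {i, j} \<in> E} \<subseteq> I}"
    then have I: "ideal I ?R" and gens: "\<And>i j. {i, j} \<in> E \<Longrightarrow> Var i * Var j \<in> I" by blast+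
    interpret ideal I ?R by (rule I)
    \<comment> \<open>Induction over the monomials of \<open>p\<close>, as an ideal is closed under
      binary sums.\<close>
    have "(\<Sum>m\<in>A. Poly_Mapping.single m (Poly_Mapping.lookup p m)) \<in> I" if "A \<subseteq> Poly_Mapping.keys p"
      for A
    proof -
      have "finite A" using finite_subset[OF that finite_keys] .
      then show ?thesis using that
      proof (induction A rule: finite_induct)
        case empty
        then show ?case using additive_subgroup.zero_closed[OF is_additive_subgroup] by simp
      next
        case (insert m A)
        then have m: "Poly_Mapping.keys m \<subseteq> {1..n}" "in_power E (Suc 0) (Poly_Mapping.lookup m)"
          using p unfolding mono_ideal_def by auto
        obtain u v and q :: "'k mpoly" where q: "{u, v} \<in> E" "q \<in> mono_ideal n (in_power E 0)"
          "Poly_Mapping.single m (Poly_Mapping.lookup p m) = q * (Var u * Var v)"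
          using single_edge_factor[OF sg m] by blast
        have "q * (Var u * Var v) \<in> I"
          using I_l_closed[OF gens[OF q(1)] mono_ideal_carrier[OF q(2)]] by simp
        then show ?case using insert q(3) additive_subgroup.a_closed[OF is_additive_subgroup]
          by simp
      qed
    qed
    from this[OF order_refl] show "p \<in> I" by (simp only: sum_singles)
  qed
qed

lemma ideal_prod_mono:
  assumes sg: "simple_graph n E"
  shows "ideal_prod (mpoly_ring n) (mono_ideal n (in_power E k)) (mono_ideal n (in_power E 1)) =
    (mono_ideal n (in_power E (Suc k)) :: 'k::field mpoly set)"
proof
  let ?R = "mpoly_ring n :: 'k mpoly ring"
  let ?I = "mono_ideal n (in_power E k) :: 'k mpoly set"
    and ?J = "mono_ideal n (in_power E 1) :: 'k mpoly set"
  show "ideal_prod ?R ?I ?J \<subseteq> mono_ideal n (in_power E (Suc k))"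
  proof
    fix p assume "p \<in> ideal_prod ?R ?I ?J"
    then show "p \<in> mono_ideal n (in_power E (Suc k))"
    proof (induction rule: ideal_prod.induct)
      case (prod i j)
      have "i * j \<in> mono_ideal n (in_power E (Suc k))"
        by (rule mono_ideal_mult[OF prod]) (rule in_power_add[OF sg])
      then show ?case by (simp only: mpoly_ring_simps)
    qed (simp only: mpoly_ring_simps mono_ideal_add)
  qed
  show "mono_ideal n (in_power E (Suc k)) \<subseteq> ideal_prod ?R ?I ?J"
  proof
    fix p :: "'k mpoly" assume p: "p \<in> mono_ideal n (in_power E (Suc k))"
    have "(\<Sum>m\<in>A. Poly_Mapping.single m (Poly_Mapping.lookup p m)) \<in> ideal_prod ?R ?I ?J"
      if "A \<subseteq> Poly_Mapping.keys p" for A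
    proof -
      have "finite A" using finite_subset[OF that finite_keys] .
      then show ?thesis using that
      proof (induction A rule: finite_induct)
        case empty
        have "0 \<otimes>\<^bsub>?R\<^esub> 0 \<in> ideal_prod ?R ?I ?J" by (rule ideal_prod.prod) (rule mono_ideal_zero)+
        then show ?case by simp
      next
        case (insert m A)
        then have m: "Poly_Mapping.keys m \<subseteq> {1..n}" "in_power E (Suc k) (Poly_Mapping.lookup m)"
          using p unfolding mono_ideal_def by auto
        obtain u v and q :: "'k mpoly" where q: "{u, v} \<in> E" "q \<in> ?I"
          "Poly_Mapping.single m (Poly_Mapping.lookup p m) = q * (Var u * Var v)"
          using single_edge_factor[OF sg m] by blast
        have "q \<otimes>\<^bsub>?R\<^esub> (Var u * Var v) \<in> ideal_prod ?R ?I ?J"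
          by (rule ideal_prod.prod[OF q(2) edge_mem[OF sg q(1)]])
        then have "Poly_Mapping.single m (Poly_Mapping.lookup p m) \<in> ideal_prod ?R ?I ?J" using q(3)
          by simp
        moreover have "(\<Sum>m\<in>A. Poly_Mapping.single m (Poly_Mapping.lookup p m)) \<in> ideal_prod ?R ?I ?J"
          using insert by simp
        ultimately have "Poly_Mapping.single m (Poly_Mapping.lookup p m) \<oplus>\<^bsub>?R\<^esub>
            (\<Sum>m\<in>A. Poly_Mapping.single m (Poly_Mapping.lookup p m)) \<in> ideal_prod ?R ?I ?J"
          by (rule ideal_prod.sum)
        then show ?case using insert by simp
      qed
    qed
    from this[OF order_refl] show "p \<in> ideal_prod ?R ?I ?J" by (simp only: sum_singles)
  qed
qed

lemma ideal_power_mono: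
  assumes sg: "simple_graph n E"
  shows "ideal_power n (edge_ideal n E) s = (mono_ideal n (in_power E s) :: 'k::field mpoly set)"
proof (induction s)
  case 0
  have "(\<lambda>a. True) = in_power E 0" by (rule ext) simp
  then show ?case by (simp add: ideal_power_def nat_pow_def ideals_set_def carrier_mpoly)
next
  case (Suc s)
  have "ideal_power n (edge_ideal n E) (Suc s) =
      ideal_prod (mpoly_ring n) (ideal_power n (edge_ideal n E :: 'k mpoly set) s) (edge_ideal n E)"
    by (simp add: ideal_power_def nat_pow_def ideals_set_def)
  also have "\<dots> = mono_ideal n (in_power E (Suc s))"
    unfolding Suc unfolding edge_ideal_mono[OF sg] by (rule ideal_prod_mono[OF sg])
  finally show ?case .
qed

section \<open>Localizations of a monomial ideal\<close>

definition expt :: "(nat \<Rightarrow>\<^sub>0 nat) \<Rightarrow> nat \<Rightarrow> int" where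
  "expt m i = int (Poly_Mapping.lookup m i)"

text \<open>Coefficients indexed by integer vectors, and 0 off the natural ones, so that exponents
  can be lowered freely.\<close>

definition lcoeff :: "'k::field mpoly \<Rightarrow> (nat \<Rightarrow> int) \<Rightarrow> 'k" where
  "lcoeff p e = (if e \<in> range expt then Poly_Mapping.lookup p (the_inv expt e) else 0)"

lemma inj_expt: "inj expt"
proof (rule injI)
  fix m m' assume "expt m = expt m'"
  then have "expt m i = expt m' i" for i by simp
  then show "m = m'" by (intro poly_mapping_eqI) (simp add: expt_def)
qed

lemma lcoeff_expt [simp]: "lcoeff p (expt m) = Poly_Mapping.lookup p m"
  by (simp add: lcoeff_def the_inv_f_f[OF inj_expt])

lemma lcoeff_out: "e \<notin> range expt \<Longrightarrow> lcoeff p e = 0"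
  by (simp add: lcoeff_def)

lemma lcoeff_nonzero: "lcoeff p e \<noteq> 0 \<Longrightarrow> \<exists>m\<in>Poly_Mapping.keys p. e = expt m"
  by (cases "e \<in> range expt") (auto simp: lcoeff_out in_keys_iff)

lemma lcoeff_eqI: "(\<And>e. lcoeff p e = lcoeff q e) \<Longrightarrow> p = q"
  by (rule poly_mapping_eqI) (metis lcoeff_expt)

lemma lcoeff_add: "lcoeff (p + q) e = lcoeff p e + lcoeff q e"
  by (simp add: lcoeff_def lookup_add)

lemma lcoeff_uminus: "lcoeff (- p) e = - lcoeff p e"
  by (simp add: lcoeff_def)

lemma lcoeff_zero [simp]: "lcoeff 0 e = 0"
  by (simp add: lcoeff_def)

lemma expt_add: "expt (m + m') i = expt m i + expt m' i"
  by (simp add: expt_def lookup_add)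

text \<open>Multiplication by a monomial translates exponent vectors; if \<open>e - t\<close> is not
  the exponent of a monomial, neither side has a term there.\<close>

lemma lcoeff_single_mult: "lcoeff (Poly_Mapping.single t 1 * p) e = lcoeff p (\<lambda>i. e i - expt t i)"
proof (cases "\<exists>m. (\<lambda>i. e i - expt t i) = expt m")
  case True
  then obtain m where m: "(\<lambda>i. e i - expt t i) = expt m" by blast
  have "e = expt (t + m)"
  proof
    fix i show "e i = expt (t + m) i" using fun_cong[OF m, of i] by (simp add: expt_add)
  qed
  then show ?thesis unfolding m by (simp add: lookup_single_mult_add)
next
  case False
  then have "lcoeff p (\<lambda>i. e i - expt t i) = 0" by (intro lcoeff_out) blast
  moreover have "lcoeff (Poly_Mapping.single t 1 * p) e = 0"
  proof (cases "e \<in> range expt")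
    case True
    then obtain k where k: "e = expt k" by blast
    have "k \<noteq> t + m" for m
    proof
      assume "k = t + m"
      then have "(\<lambda>i. e i - expt t i) = expt m" unfolding k by (intro ext) (simp add: expt_add)
      then show False using False by blast
    qed
    then show ?thesis unfolding k lcoeff_expt by (rule lookup_single_mult_zero)
  qed (rule lcoeff_out)
  ultimately show ?thesis by simp
qed

lemma lcoeff_single: "lcoeff (Poly_Mapping.single t c) e = (if e = expt t then c else 0)"
proof (cases "e \<in> range expt")
  case True
  then obtain k where k: "e = expt k" by blast
  then show ?thesis using inj_eq[OF inj_expt, of k t] by (auto simp: lookup_single when_def)
qed (auto simp: lcoeff_out)

section \<open>Fractions as Laurent polynomials\<close>

definition face_expt :: "nat set \<Rightarrow> nat \<Rightarrow> (nat \<Rightarrow>\<^sub>0 nat)" where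
  "face_expt \<sigma> a = Abs_poly_mapping (\<lambda>i. if i \<in> \<sigma> then a else 0)"

lemma lookup_face_expt: "finite \<sigma> \<Longrightarrow>
  Poly_Mapping.lookup (face_expt \<sigma> a) i = (if i \<in> \<sigma> then a else 0)"
  unfolding face_expt_def by (subst lookup_Abs_poly_mapping) (auto intro: finite_subset[of _ \<sigma>])

lemma expt_face_expt: "finite \<sigma> \<Longrightarrow> expt (face_expt \<sigma> a) i = (if i \<in> \<sigma> then int a else 0)"
  by (simp add: expt_def lookup_face_expt)

lemma var_prod_single: "finite \<sigma> \<Longrightarrow>
  var_prod \<sigma> = (Poly_Mapping.single (face_expt \<sigma> 1) 1 :: 'k::field mpoly)"
proof (induction \<sigma> rule: finite_induct)
  case empty
  have "face_expt {} 1 = 0" by (rule poly_mapping_eqI) (simp add: lookup_face_expt)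
  then show ?case by (simp add: var_prod_def)
next
  case (insert i \<sigma>)
  have "Poly_Mapping.single i 1 + face_expt \<sigma> 1 = face_expt (insert i \<sigma>) 1"
    by (rule poly_mapping_eqI) (use insert.hyps in \<open>auto simp: lookup_add lookup_face_expt
      lookup_single when_def\<close>)
  then have "(Var i :: 'k mpoly) * Poly_Mapping.single (face_expt \<sigma> 1) 1 =
    Poly_Mapping.single (face_expt (insert i \<sigma>) 1) 1"
    by (simp add: Var_def mult_single)
  then show ?case using insert by (simp add: var_prod_def)
qed

lemma pow_mpoly: "(p :: 'k::field mpoly) [^]\<^bsub>mpoly_ring n\<^esub> (a::nat) = p ^ a"
  unfolding nat_pow_def by (induction a) (simp_all add: mult.commute)

lemma var_prod_power:
  assumes "finite \<sigma>"
  shows "var_prod \<sigma> ^ a = (Poly_Mapping.single (face_expt \<sigma> a) 1 :: 'k::field mpoly)"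
proof (induction a)
  case 0
  have "face_expt \<sigma> 0 = 0" by (rule poly_mapping_eqI) (simp add: lookup_face_expt assms)
  then show ?case by simp
next
  case (Suc a)
  have "face_expt \<sigma> 1 + face_expt \<sigma> a = face_expt \<sigma> (Suc a)"
    by (rule poly_mapping_eqI) (simp add: lookup_face_expt assms lookup_add)
  then show ?case using Suc by (simp add: var_prod_single[OF assms] mult_single)
qed

lemma lcoeff_var_prod_mult:
  assumes "finite \<sigma>"
  shows "lcoeff (var_prod \<sigma> ^ b * u) (shift e (b + a) \<sigma>) = lcoeff u (shift e a \<sigma>)"
proof -
  have "(\<lambda>i. shift e (b + a) \<sigma> i - expt (face_expt \<sigma> b) i) = shift e a \<sigma>"
    by (rule ext) (simp add: shift_def expt_face_expt[OF assms])
  then show ?thesis unfolding var_prod_power[OF assms] lcoeff_single_mult by simp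
qed

text \<open>The fraction \<open>u / (var_prod \<sigma>)^a\<close> as a Laurent polynomial; it determines the class in the
  localization because multiplication by monomials is injective.\<close>

definition frac_coeff :: "nat set \<Rightarrow> 'k::field mpoly \<Rightarrow> nat \<Rightarrow> (nat \<Rightarrow> int) \<Rightarrow> 'k" where
  "frac_coeff \<sigma> u a = (\<lambda>e. lcoeff u (shift e a \<sigma>))"

text \<open>The class in the localization with Laurent coefficients \<open>g\<close>. It is empty if
  \<open>g\<close> is not in \<open>frac_coeffs J \<sigma>\<close>, hence the side condition on
  \<open>g\<close> in what follows.\<close>

definition frac_class :: "'k::field mpoly set \<Rightarrow> nat set \<Rightarrow> ((nat \<Rightarrow> int) \<Rightarrow> 'k) \<Rightarrow> ('k mpoly \<times> nat) set"
  where
  "frac_class J \<sigma> g = {(u, a). u \<in> J \<and> frac_coeff \<sigma> u a = g}"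

definition frac_coeffs :: "'k::field mpoly set \<Rightarrow> nat set \<Rightarrow> ((nat \<Rightarrow> int) \<Rightarrow> 'k) set" where
  "frac_coeffs J \<sigma> = {frac_coeff \<sigma> u a | u a. u \<in> J}"

lemma frac_coeff_mult: "finite \<sigma> \<Longrightarrow> frac_coeff \<sigma> (var_prod \<sigma> ^ b * u) (b + a) = frac_coeff \<sigma> u a"
  unfolding frac_coeff_def by (rule ext) (rule lcoeff_var_prod_mult)

lemma frac_coeff_add: "frac_coeff \<sigma> (u + v) a = (\<lambda>e. frac_coeff \<sigma> u a e + frac_coeff \<sigma> v a e)"
  unfolding frac_coeff_def by (rule ext) (rule lcoeff_add)

lemma frac_coeff_add_frac:
  assumes "finite \<sigma>"
  shows "frac_coeff \<sigma> (var_prod \<sigma> ^ b * u + var_prod \<sigma> ^ a * v) (a + b) =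
    (\<lambda>e. frac_coeff \<sigma> u a e + frac_coeff \<sigma> v b e)"
  unfolding frac_coeff_add using frac_coeff_mult[OF assms, of b u a] frac_coeff_mult[OF assms, of a
    v b] by (simp add: add.commute)

lemma frac_coeff_inj:
  assumes "frac_coeff \<sigma> u a = frac_coeff \<sigma> v a"
  shows "u = v"
proof (rule lcoeff_eqI)
  fix e
  have "lcoeff u (shift (\<lambda>i. e i - (if i \<in> \<sigma> then int a else 0)) a \<sigma>) =
      lcoeff v (shift (\<lambda>i. e i - (if i \<in> \<sigma> then int a else 0)) a \<sigma>)"
    using fun_cong[OF assms] unfolding frac_coeff_def .
  moreover have "shift (\<lambda>i. e i - (if i \<in> \<sigma> then int a else 0)) a \<sigma> = e"
    by (rule ext) (simp add: shift_def)
  ultimately show "lcoeff u e = lcoeff v e" by simp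
qed

text \<open>Over a common denominator, equality of the numerators means equality of the Laurent
  coefficients, for every \<open>k\<close> alike, because multiplication by a monomial is
  injective.\<close>

lemma loc_rel_iff:
  assumes "finite \<sigma>"
  shows "((u, a), (v, b)) \<in> loc_rel (mpoly_ring n) (ideal_module n J) (var_prod \<sigma>) \<longleftrightarrow>
    u \<in> J \<and> v \<in> J \<and> frac_coeff \<sigma> u a = frac_coeff \<sigma> v b"
proof -
  have "(var_prod \<sigma> ^ (k + b) * u = var_prod \<sigma> ^ (k + a) * v) \<longleftrightarrow> frac_coeff \<sigma> u a = frac_coeff \<sigma> v b"
    for k
  proof -
    have "frac_coeff \<sigma> (var_prod \<sigma> ^ (k + b) * u) (k + b + a) = frac_coeff \<sigma> u a"
      "frac_coeff \<sigma> (var_prod \<sigma> ^ (k + a) * v) (k + a + b) = frac_coeff \<sigma> v b"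
        using frac_coeff_mult[OF assms] by blast+
    moreover have "k + a + b = k + b + a" by simp
    ultimately show ?thesis using frac_coeff_inj[of \<sigma> "var_prod \<sigma> ^ (k + b) * u" "k + b + a"
      "var_prod \<sigma> ^ (k + a) * v"] by metis
  qed
  then show ?thesis unfolding loc_rel_def by (simp add: ideal_module_def pow_mpoly)
qed

lemma loc_frac_eq:
  assumes "finite \<sigma>" "u \<in> J"
  shows "loc_frac (mpoly_ring n) (ideal_module n J) (var_prod \<sigma>) u a =
    frac_class J \<sigma> (frac_coeff \<sigma> u a)"
  unfolding loc_frac_def frac_class_def using loc_rel_iff[OF assms(1)] assms(2) by fastforce

lemma frac_class_inj:
  assumes "frac_class J \<sigma> g = frac_class J \<sigma> h" "g \<in> frac_coeffs J \<sigma>"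
  shows "g = h"
proof -
  obtain u a where "u \<in> J" "g = frac_coeff \<sigma> u a" using assms(2) unfolding frac_coeffs_def by blast
  then have "(u, a) \<in> frac_class J \<sigma> g" unfolding frac_class_def by simp
  then have "(u, a) \<in> frac_class J \<sigma> h" using assms(1) by simp
  then show ?thesis using \<open>g = frac_coeff \<sigma> u a\<close> unfolding frac_class_def by simp
qed

lemma frac_class_rep:
  assumes "g \<in> frac_coeffs J \<sigma>"
  shows "\<exists>u a. (u, a) \<in> frac_class J \<sigma> g"
  using assms unfolding frac_coeffs_def frac_class_def by blast

text \<open>The operations of the localization are unions over all representatives; this evaluates
  them once each representative yields the same class.\<close>

lemma the_elem_UN:
  assumes "U \<noteq> {}" "\<And>x. x \<in> U \<Longrightarrow> F x = {y}"
  shows "the_elem (\<Union>x\<in>U. F x) = y"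
proof -
  have "(\<Union>x\<in>U. F x) = {y}" using assms by auto
  then show ?thesis by simp
qed

lemma ideal_module_simps [simp]: "smult (ideal_module n J) = (*)"
  "add (ideal_module n J) = (+)" "ring.zero (ideal_module n J) = 0" "carrier (ideal_module n J) = J"
  by (simp_all add: ideal_module_def)

text \<open>Stated for arbitrary monomial ideals, since the outcome is applied both to the edge
  ideal and to its powers.\<close>

locale monomial_ideal =
  fixes n :: nat and P :: "(nat \<Rightarrow> nat) \<Rightarrow> bool" and J :: "'k::field mpoly set"
  assumes P: "up_closed P" and J: "J = mono_ideal n P"
begin

abbreviation (input) "R \<equiv> (mpoly_ring n :: 'k mpoly ring)"
abbreviation (input) "M \<equiv> ideal_module n J"

definition loc_faces :: "(nat \<Rightarrow> int) \<Rightarrow> nat set set" where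
  "loc_faces e = {\<sigma>. \<sigma> \<subseteq> {1..n} \<and> (\<exists>m. (\<forall>i. 0 \<le> shift e m \<sigma> i) \<and> P (\<lambda>i. nat (shift e m \<sigma> i)))}"

lemma var_carrier: "\<sigma> \<subseteq> {1..n} \<Longrightarrow> (var_prod \<sigma> :: 'k mpoly) ^ a \<in> carrier R"
proof -
  assume s: "\<sigma> \<subseteq> {1..n}"
  then have f: "finite \<sigma>" by (rule finite_subset) simp
  have "Poly_Mapping.keys (face_expt \<sigma> a) \<subseteq> \<sigma>"
    by (auto simp: in_keys_iff lookup_face_expt[OF f] split: if_splits)
  then show ?thesis unfolding var_prod_power[OF f] carrier_mpoly using s
    by (intro single_mono_ideal) auto
qed

lemma J_mult: "r \<in> carrier R \<Longrightarrow> u \<in> J \<Longrightarrow> r * u \<in> J"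
  unfolding J using mono_ideal_lmult[OF P] by blast

lemma J_add: "u \<in> J \<Longrightarrow> v \<in> J \<Longrightarrow> u + v \<in> J"
  unfolding J by (rule mono_ideal_add)

lemma J_zero: "0 \<in> J"
  unfolding J by (rule mono_ideal_zero)

lemma J_uminus: "u \<in> J \<Longrightarrow> - u \<in> J"
  unfolding J by (rule mono_ideal_uminus)

lemma finite_face: "\<sigma> \<subseteq> {1..n} \<Longrightarrow> finite \<sigma>"
  by (erule finite_subset) (rule finite_atLeastAtMost)

lemma frac_coeffs_add:
  assumes "\<sigma> \<subseteq> {1..n}" "g \<in> frac_coeffs J \<sigma>" "h \<in> frac_coeffs J \<sigma>"
  shows "(\<lambda>e. g e + h e) \<in> frac_coeffs J \<sigma>"
proof -
  obtain u a v b where uv: "u \<in> J" "g = frac_coeff \<sigma> u a" "v \<in> J" "h = frac_coeff \<sigma> v b"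
    using assms(2,3) unfolding frac_coeffs_def by blast
  have "var_prod \<sigma> ^ b * u + var_prod \<sigma> ^ a * v \<in> J"
    using J_add J_mult[OF var_carrier[OF assms(1)]] uv by blast
  moreover have "(\<lambda>e. g e + h e) = frac_coeff \<sigma> (var_prod \<sigma> ^ b * u + var_prod \<sigma> ^ a * v) (a + b)"
    unfolding uv(2,4) frac_coeff_add_frac[OF finite_face[OF assms(1)]] ..
  ultimately show ?thesis unfolding frac_coeffs_def by blast
qed

lemma frac_coeffs_zero: "(\<lambda>e. 0) \<in> frac_coeffs J \<sigma>"
proof -
  have "(\<lambda>e. 0) = frac_coeff \<sigma> 0 0" by (simp add: frac_coeff_def)
  then show ?thesis unfolding frac_coeffs_def using J_zero by blast
qed

lemma frac_coeffs_uminus: "g \<in> frac_coeffs J \<sigma> \<Longrightarrow> (\<lambda>e. - g e) \<in> frac_coeffs J \<sigma>"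
proof -
  assume "g \<in> frac_coeffs J \<sigma>"
  then obtain u a where u: "u \<in> J" "g = frac_coeff \<sigma> u a" unfolding frac_coeffs_def by blast
  have "(\<lambda>e. - g e) = frac_coeff \<sigma> (- u) a" unfolding u(2) frac_coeff_def
    by (simp add: lcoeff_uminus)
  then show ?thesis unfolding frac_coeffs_def using J_uminus[OF u(1)] by blast
qed

lemma frac_coeffs_sum:
  assumes "\<sigma> \<subseteq> {1..n}" "\<And>i. i \<in> I \<Longrightarrow> f i \<in> frac_coeffs J \<sigma>"
  shows "(\<lambda>e. \<Sum>i\<in>I. f i e) \<in> frac_coeffs J \<sigma>"
  using assms(2)
proof (induction I rule: infinite_finite_induct)
  case (insert i I)
  then have "(\<lambda>e. f i e + (\<Sum>i\<in>I. f i e)) \<in> frac_coeffs J \<sigma>"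
    by (intro frac_coeffs_add[OF assms(1)]) auto
  then show ?case using insert by simp
qed (simp_all add: frac_coeffs_zero)

text \<open>Expanding a fraction by \<open>Var l\<close> leaves its Laurent coefficients unchanged,
  so the canonical maps of the Cech complex become inclusions.\<close>

lemma frac_coeff_Var_mult:
  assumes "\<tau> \<subseteq> {1..n}" "l \<in> \<tau>" "u \<in> J"
  shows "Var l ^ a * u \<in> J" "frac_coeff \<tau> (Var l ^ a * u) a = frac_coeff (\<tau> - {l}) u a"
proof -
  have v: "Var l = (var_prod {l} :: 'k mpoly)" by (simp add: var_prod_def)
  show "Var l ^ a * u \<in> J" unfolding v by (rule J_mult[OF var_carrier assms(3)]) (use assms in auto)
  show "frac_coeff \<tau> (Var l ^ a * u) a = frac_coeff (\<tau> - {l}) u a"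
  proof
    fix e
    have "(\<lambda>i. shift e a \<tau> i - expt (face_expt {l} a) i) = shift e a (\<tau> - {l})"
      by (rule ext) (use assms(2) in \<open>auto simp: shift_def expt_face_expt\<close>)
    then show "frac_coeff \<tau> (Var l ^ a * u) a e = frac_coeff (\<tau> - {l}) u a e"
      unfolding frac_coeff_def v by (simp add: var_prod_power lcoeff_single_mult)
  qed
qed

lemma loc_carrier:
  assumes "\<sigma> \<subseteq> {1..n}"
  shows "carrier (cech_loc n M \<sigma>) = frac_class J \<sigma> ` frac_coeffs J \<sigma>"
proof -
  have "carrier (cech_loc n M \<sigma>) = (\<Union>x\<in>J \<times> UNIV. {loc_rel R M (var_prod \<sigma>) `` {x}})"
    by (simp add: localization_def quotient_def)
  also have "\<dots> = (\<Union>x\<in>J \<times> UNIV. {frac_class J \<sigma> (frac_coeff \<sigma> (fst x) (snd x))})"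
  proof (rule SUP_cong[OF refl])
    fix x :: "'k mpoly \<times> nat" assume "x \<in> J \<times> UNIV"
    then obtain u a where "x = (u, a)" "u \<in> J" by auto
    then show "{loc_rel R M (var_prod \<sigma>) `` {x}} = {frac_class J \<sigma> (frac_coeff \<sigma> (fst x) (snd x))}"
      using loc_frac_eq[OF finite_face[OF assms], of u J n a] by (simp add: loc_frac_def)
  qed
  also have "\<dots> = frac_class J \<sigma> ` (\<lambda>x. frac_coeff \<sigma> (fst x) (snd x)) ` (J \<times> UNIV)" by blast
  also have "(\<lambda>x. frac_coeff \<sigma> (fst x) (snd x)) ` (J \<times> UNIV) = frac_coeffs J \<sigma>"
  proof (intro equalityI subsetI)
    fix g assume "g \<in> frac_coeffs J \<sigma>"
    then obtain u a where "u \<in> J" "g = frac_coeff \<sigma> u a" unfolding frac_coeffs_def by blast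
    then show "g \<in> (\<lambda>x. frac_coeff \<sigma> (fst x) (snd x)) ` (J \<times> UNIV)"
      by (intro image_eqI[of _ _ "(u, a)"]) auto
  qed (auto simp: frac_coeffs_def)
  finally show ?thesis .
qed

lemma loc_zero:
  assumes "\<sigma> \<subseteq> {1..n}"
  shows "\<zero>\<^bsub>cech_loc n M \<sigma>\<^esub> = frac_class J \<sigma> (\<lambda>e. 0)"
proof -
  have "frac_coeff \<sigma> (0 :: 'k mpoly) 0 = (\<lambda>e. 0)" by (simp add: frac_coeff_def)
  then show ?thesis using loc_frac_eq[OF finite_face[OF assms] J_zero, of n 0]
    by (simp add: localization_def)
qed

lemma loc_add:
  assumes s: "\<sigma> \<subseteq> {1..n}" and g: "g \<in> frac_coeffs J \<sigma>" "h \<in> frac_coeffs J \<sigma>"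
  shows "frac_class J \<sigma> g \<oplus>\<^bsub>cech_loc n M \<sigma>\<^esub> frac_class J \<sigma> h = frac_class J \<sigma> (\<lambda>e. g e + h e)"
proof -
  have inner: "(\<Union>(v, b)\<in>frac_class J \<sigma> h. {loc_frac R M (var_prod \<sigma>) (var_prod \<sigma> ^ b * u + var_prod \<sigma> ^ a * v) (a + b)}) =
      {frac_class J \<sigma> (\<lambda>e. g e + h e)}" if ua: "(u, a) \<in> frac_class J \<sigma> g" for u a
  proof -
    have "loc_frac R M (var_prod \<sigma>) (var_prod \<sigma> ^ b * u + var_prod \<sigma> ^ a * v) (a + b) =
      frac_class J \<sigma> (\<lambda>e. g e + h e)"
      if vb: "(v, b) \<in> frac_class J \<sigma> h" for v b
    proof -
      have uv: "u \<in> J" "frac_coeff \<sigma> u a = g" "v \<in> J" "frac_coeff \<sigma> v b = h" using ua vb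
        unfolding frac_class_def by auto
      have mem: "var_prod \<sigma> ^ b * u + var_prod \<sigma> ^ a * v \<in> J"
        using J_add J_mult[OF var_carrier[OF s]] uv by blast
      show ?thesis
        unfolding loc_frac_eq[OF finite_face[OF s] mem] frac_coeff_add_frac[OF finite_face[OF s]]
          uv(2,4) ..
    qed
    then show ?thesis using frac_class_rep[OF g(2)] by auto
  qed
  have "the_elem (\<Union>x\<in>frac_class J \<sigma> g. case x of (u, a) \<Rightarrow> (\<Union>(v, b)\<in>frac_class J \<sigma> h.
      {loc_frac R M (var_prod \<sigma>) (var_prod \<sigma> ^ b * u + var_prod \<sigma> ^ a * v) (a + b)})) = frac_class J
        \<sigma> (\<lambda>e. g e + h e)"
  proof (rule the_elem_UN)
    show "frac_class J \<sigma> g \<noteq> {}" using frac_class_rep[OF g(1)] by auto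
  qed (use inner in auto)
  then show ?thesis by (simp add: localization_def pow_mpoly)
qed

lemma loc_map_cls:
  assumes t: "\<tau> \<subseteq> {1..n}" and l: "l \<in> \<tau>" and g: "g \<in> frac_coeffs J (\<tau> - {l})"
  shows "loc_map R M (var_prod (\<tau> - {l})) (Var l) (frac_class J (\<tau> - {l}) g) = frac_class J \<tau> g"
    "g \<in> frac_coeffs J \<tau>"
proof -
  have v: "(var_prod (\<tau> - {l}) :: 'k mpoly) * Var l = var_prod \<tau>"
    using prod.remove[OF finite_face[OF t] l, of "\<lambda>i. Var i :: 'k mpoly"]
      by (simp add: var_prod_def mult.commute)
  have "the_elem (\<Union>x\<in>frac_class J (\<tau> - {l}) g. case x of (u, a) \<Rightarrow> {loc_frac R M (var_prod \<tau>) (Var l ^ a * u) a}) = frac_class J \<tau> g"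
  proof (rule the_elem_UN)
    show "frac_class J (\<tau> - {l}) g \<noteq> {}" using frac_class_rep[OF g] by auto
    fix x assume "x \<in> frac_class J (\<tau> - {l}) g"
    then obtain u a where x: "x = (u, a)" "u \<in> J" "frac_coeff (\<tau> - {l}) u a = g"
      unfolding frac_class_def by auto
    show "(case x of (u, a) \<Rightarrow> {loc_frac R M (var_prod \<tau>) (Var l ^ a * u) a}) = {frac_class J \<tau> g}"
      using loc_frac_eq[OF finite_face[OF t] frac_coeff_Var_mult(1)[OF t l x(2)]]
        frac_coeff_Var_mult(2)[OF t l x(2)] x by simp
  qed
  then show "loc_map R M (var_prod (\<tau> - {l})) (Var l) (frac_class J (\<tau> - {l}) g) = frac_class J \<tau> g"
    by (simp add: loc_map_def pow_mpoly v)
  obtain u a where u: "u \<in> J" "g = frac_coeff (\<tau> - {l}) u a" using g unfolding frac_coeffs_def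
    by blast
  then have "g = frac_coeff \<tau> (Var l ^ a * u) a" using frac_coeff_Var_mult(2)[OF t l] by simp
  then show "g \<in> frac_coeffs J \<tau>" unfolding frac_coeffs_def
    using frac_coeff_Var_mult(1)[OF t l u(1)] by blast
qed

lemma loc_abelian_group:
  assumes s: "\<sigma> \<subseteq> {1..n}"
  shows "abelian_group (cech_loc n M \<sigma>)"
proof (rule abelian_groupI)
  note C = loc_carrier[OF s]
  note A = loc_add[OF s]
  show "\<zero>\<^bsub>cech_loc n M \<sigma>\<^esub> \<in> carrier (cech_loc n M \<sigma>)" unfolding C loc_zero[OF s]
    using frac_coeffs_zero by blast
  fix x assume "x \<in> carrier (cech_loc n M \<sigma>)"
  then obtain g where g: "g \<in> frac_coeffs J \<sigma>" "x = frac_class J \<sigma> g" unfolding C by blast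
  show "\<zero>\<^bsub>cech_loc n M \<sigma>\<^esub> \<oplus>\<^bsub>cech_loc n M \<sigma>\<^esub> x = x"
    unfolding loc_zero[OF s] g(2) A[OF frac_coeffs_zero g(1)] by simp
  show "\<exists>y\<in>carrier (cech_loc n M \<sigma>). y \<oplus>\<^bsub>cech_loc n M \<sigma>\<^esub> x = \<zero>\<^bsub>cech_loc n M \<sigma>\<^esub>"
  proof (rule bexI)
    show "frac_class J \<sigma> (\<lambda>e. - g e) \<oplus>\<^bsub>cech_loc n M \<sigma>\<^esub> x = \<zero>\<^bsub>cech_loc n M \<sigma>\<^esub>"
      unfolding loc_zero[OF s] g(2) A[OF frac_coeffs_uminus[OF g(1)] g(1)] by simp
  qed (use frac_coeffs_uminus[OF g(1)] C in blast)
  fix y assume "y \<in> carrier (cech_loc n M \<sigma>)"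
  then obtain h where h: "h \<in> frac_coeffs J \<sigma>" "y = frac_class J \<sigma> h" unfolding C by blast
  show "x \<oplus>\<^bsub>cech_loc n M \<sigma>\<^esub> y \<in> carrier (cech_loc n M \<sigma>)"
    unfolding C g(2) h(2) A[OF g(1) h(1)] using frac_coeffs_add[OF s g(1) h(1)] by blast
  show "x \<oplus>\<^bsub>cech_loc n M \<sigma>\<^esub> y = y \<oplus>\<^bsub>cech_loc n M \<sigma>\<^esub> x"
    unfolding g(2) h(2) A[OF g(1) h(1)] A[OF h(1) g(1)] by (simp add: add.commute)
  fix z assume "z \<in> carrier (cech_loc n M \<sigma>)"
  then obtain k where k: "k \<in> frac_coeffs J \<sigma>" "z = frac_class J \<sigma> k" unfolding C by blast
  show "(x \<oplus>\<^bsub>cech_loc n M \<sigma>\<^esub> y) \<oplus>\<^bsub>cech_loc n M \<sigma>\<^esub> z = x \<oplus>\<^bsub>cech_loc n M \<sigma>\<^esub> (y \<oplus>\<^bsub>cech_loc n M \<sigma>\<^esub> z)"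
    unfolding g(2) h(2) k(2) A[OF g(1) h(1)] A[OF h(1) k(1)] A[OF g(1) frac_coeffs_add[OF s h(1)
      k(1)]]
      A[OF frac_coeffs_add[OF s g(1) h(1)] k(1)] by (simp add: add.assoc)
qed

lemma loc_uminus:
  assumes s: "\<sigma> \<subseteq> {1..n}" and g: "g \<in> frac_coeffs J \<sigma>"
  shows "\<ominus>\<^bsub>cech_loc n M \<sigma>\<^esub> frac_class J \<sigma> g = frac_class J \<sigma> (\<lambda>e. - g e)"
proof (rule abelian_group.minus_equality[OF loc_abelian_group[OF s]])
  show "frac_class J \<sigma> (\<lambda>e. - g e) \<oplus>\<^bsub>cech_loc n M \<sigma>\<^esub> frac_class J \<sigma> g = \<zero>\<^bsub>cech_loc n M \<sigma>\<^esub>"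
    unfolding loc_add[OF s frac_coeffs_uminus[OF g] g] loc_zero[OF s] by simp
qed (use g frac_coeffs_uminus[OF g] loc_carrier[OF s] in blast)+

lemma loc_finsum:
  assumes s: "\<sigma> \<subseteq> {1..n}" and fin: "finite A" and f: "\<And>l. l \<in> A \<Longrightarrow> f l \<in> frac_coeffs J \<sigma>"
  shows "finsum (cech_loc n M \<sigma>) (\<lambda>l. frac_class J \<sigma> (f l)) A = frac_class J \<sigma> (\<lambda>e. \<Sum>l\<in>A. f l e)"
  using fin f
proof (induction A rule: finite_induct)
  case empty
  then show ?case
    using abelian_monoid.finsum_empty[OF abelian_group.axioms(1)[OF loc_abelian_group[OF s]]]
    by (simp add: loc_zero[OF s])
next
  case (insert l A)
  interpret abelian_group "cech_loc n M \<sigma>" by (rule loc_abelian_group[OF s])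
  have "(\<lambda>l. frac_class J \<sigma> (f l)) \<in> A \<rightarrow> carrier (cech_loc n M \<sigma>)"
    "frac_class J \<sigma> (f l) \<in> carrier (cech_loc n M \<sigma>)" unfolding loc_carrier[OF s] using insert
      by auto
  then have "finsum (cech_loc n M \<sigma>) (\<lambda>l. frac_class J \<sigma> (f l)) (insert l A) =
      frac_class J \<sigma> (f l) \<oplus>\<^bsub>cech_loc n M \<sigma>\<^esub> frac_class J \<sigma> (\<lambda>e. \<Sum>l\<in>A. f l e)"
    using insert by (subst finsum_insert) auto
  also have "\<dots> = frac_class J \<sigma> (\<lambda>e. f l e + (\<Sum>l\<in>A. f l e))"
  proof (rule loc_add[OF s])
    show "(\<lambda>e. \<Sum>l\<in>A. f l e) \<in> frac_coeffs J \<sigma>" by (rule frac_coeffs_sum[OF s]) (use insert in simp)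
  qed (use insert in simp)
  finally show ?case using insert by simp
qed

section \<open>The Cech complex of a monomial ideal\<close>

lemma faces_sub: "\<sigma> \<in> faces n i \<Longrightarrow> \<sigma> \<subseteq> {1..n}"
  by (simp add: faces_def)

lemma faces_card: "\<sigma> \<in> faces n i \<Longrightarrow> card \<sigma> = i"
  by (simp add: faces_def)

lemma face_del: "\<tau> \<in> faces n (Suc i) \<Longrightarrow> l \<in> \<tau> \<Longrightarrow> \<tau> - {l} \<in> faces n i"
  using finite_face[OF faces_sub[of \<tau> "Suc i"]] by (auto simp: faces_def)

text \<open>Elements of the product group are undefined off \<open>faces n i\<close>, hence the
  restriction; \<open>g\<close> matters on these faces alone.\<close>

definition cochain_of :: "nat \<Rightarrow> (nat set \<Rightarrow> (nat \<Rightarrow> int) \<Rightarrow> 'k) \<Rightarrow> nat set \<Rightarrow> ('k mpoly \<times> nat) set" where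
  "cochain_of i g = (\<lambda>\<sigma>\<in>faces n i. frac_class J \<sigma> (g \<sigma>))"

definition is_cochain :: "nat \<Rightarrow> (nat set \<Rightarrow> (nat \<Rightarrow> int) \<Rightarrow> 'k) \<Rightarrow> bool" where
  "is_cochain i g \<longleftrightarrow> (\<forall>\<sigma>\<in>faces n i. g \<sigma> \<in> frac_coeffs J \<sigma>)"

lemma is_cochainD: "is_cochain i g \<Longrightarrow> \<sigma> \<in> faces n i \<Longrightarrow> g \<sigma> \<in> frac_coeffs J \<sigma>"
  by (simp add: is_cochain_def)

lemma cech_carrier: "carrier (cech n M i) = {cochain_of i g | g. is_cochain i g}"
proof (intro equalityI subsetI)
  fix c assume "c \<in> carrier (cech n M i)"
  then have c: "c \<in> (\<Pi>\<^sub>E \<sigma>\<in>faces n i. carrier (cech_loc n M \<sigma>))" by (simp add: cech_def)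
  have "\<forall>\<sigma>\<in>faces n i. \<exists>g\<in>frac_coeffs J \<sigma>. c \<sigma> = frac_class J \<sigma> g"
  proof
    fix \<sigma> assume s: "\<sigma> \<in> faces n i"
    have "c \<sigma> \<in> carrier (cech_loc n M \<sigma>)" by (rule PiE_mem[OF c s])
    then show "\<exists>g\<in>frac_coeffs J \<sigma>. c \<sigma> = frac_class J \<sigma> g" unfolding loc_carrier[OF faces_sub[OF s]]
      by blast
  qed
  then obtain g where g: "\<forall>\<sigma>\<in>faces n i. g \<sigma> \<in> frac_coeffs J \<sigma> \<and> c \<sigma> = frac_class J \<sigma> (g \<sigma>)" by metis
  have "c = cochain_of i g"
  proof
    fix \<sigma> show "c \<sigma> = cochain_of i g \<sigma>"
    proof (cases "\<sigma> \<in> faces n i")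
      case False
      then show ?thesis using PiE_arb[OF c False] by (simp add: cochain_of_def)
    qed (use g in \<open>simp add: cochain_of_def\<close>)
  qed
  then show "c \<in> {cochain_of i g | g. is_cochain i g}" using g unfolding is_cochain_def by blast
next
  fix c assume "c \<in> {cochain_of i g | g. is_cochain i g}"
  then obtain g where g: "c = cochain_of i g" "is_cochain i g" by blast
  have "cochain_of i g \<in> (\<Pi>\<^sub>E \<sigma>\<in>faces n i. carrier (cech_loc n M \<sigma>))"
    unfolding cochain_of_def
  proof (rule restrict_PiE_iff[THEN iffD2], rule ballI)
    fix \<sigma> assume s: "\<sigma> \<in> faces n i"
    show "frac_class J \<sigma> (g \<sigma>) \<in> carrier (cech_loc n M \<sigma>)"
      unfolding loc_carrier[OF faces_sub[OF s]] using is_cochainD[OF g(2) s] by blast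
  qed
  then show "c \<in> carrier (cech n M i)" unfolding g(1) by (simp add: cech_def)
qed

lemma cech_group: "group (cech n M i)"
  unfolding cech_def
proof (rule product_group)
  fix \<sigma> assume "\<sigma> \<in> faces n i"
  then show "group (add_monoid (cech_loc n M \<sigma>))"
    by (intro abelian_group.a_group loc_abelian_group faces_sub)
qed

lemma cech_one: "\<one>\<^bsub>cech n M i\<^esub> = cochain_of i (\<lambda>\<sigma> e. 0)"
  unfolding cech_def cochain_of_def by (simp add: loc_zero[OF faces_sub] cong: restrict_cong)

lemma is_cochain_zero: "is_cochain i (\<lambda>\<sigma> e. 0)"
  unfolding is_cochain_def using frac_coeffs_zero by blast

lemma is_cochain_add: "is_cochain i g \<Longrightarrow> is_cochain i h \<Longrightarrow> is_cochain i (\<lambda>\<sigma> e. g \<sigma> e + h \<sigma> e)"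
  unfolding is_cochain_def using frac_coeffs_add[OF faces_sub] by blast

lemma cech_mult:
  assumes "is_cochain i g" "is_cochain i h"
  shows "cochain_of i g \<otimes>\<^bsub>cech n M i\<^esub> cochain_of i h = cochain_of i (\<lambda>\<sigma> e. g \<sigma> e + h \<sigma> e)"
proof
  fix \<sigma>
  show "(cochain_of i g \<otimes>\<^bsub>cech n M i\<^esub> cochain_of i h) \<sigma> = cochain_of i (\<lambda>\<sigma> e. g \<sigma> e + h \<sigma> e) \<sigma>"
    using loc_add[OF faces_sub is_cochainD[OF assms(1)] is_cochainD[OF assms(2)], of \<sigma>]
    by (simp add: cech_def cochain_of_def)
qed

lemma cochain_of_eq_iff:
  assumes "is_cochain i g"
  shows "cochain_of i g = cochain_of i h \<longleftrightarrow> (\<forall>\<sigma>\<in>faces n i. g \<sigma> = h \<sigma>)"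
proof
  assume eq: "cochain_of i g = cochain_of i h"
  show "\<forall>\<sigma>\<in>faces n i. g \<sigma> = h \<sigma>"
  proof
    fix \<sigma> assume s: "\<sigma> \<in> faces n i"
    then have "frac_class J \<sigma> (g \<sigma>) = frac_class J \<sigma> (h \<sigma>)" using fun_cong[OF eq, of \<sigma>]
      by (simp add: cochain_of_def)
    then show "g \<sigma> = h \<sigma>" by (rule frac_class_inj[OF _ is_cochainD[OF assms s]])
  qed
qed (auto simp: cochain_of_def cong: restrict_cong)

text \<open>The differential acts on every exponent \<open>e\<close> separately; this is the
  splitting of the Cech complex by exponent vectors.\<close>

definition cochain_diff :: "(nat set \<Rightarrow> (nat \<Rightarrow> int) \<Rightarrow> 'k) \<Rightarrow> nat set \<Rightarrow> (nat \<Rightarrow> int) \<Rightarrow> 'k" where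
  "cochain_diff g \<tau> e = coboundary (\<lambda>\<sigma>. g \<sigma> e) \<tau>"

lemma cochain_diff_term:
  assumes g: "is_cochain i g" and t: "\<tau> \<in> faces n (Suc i)" and l: "l \<in> \<tau>"
  shows "(\<lambda>e. face_sign \<tau> l * g (\<tau> - {l}) e) \<in> frac_coeffs J \<tau>"
    "(let y = loc_map R M (var_prod (\<tau> - {l})) (Var l) (cochain_of i g (\<tau> - {l}))
      in if even (card {q\<in>\<tau>. q < l}) then y else \<ominus>\<^bsub>cech_loc n M \<tau>\<^esub> y) = frac_class J \<tau> (\<lambda>e.
        face_sign \<tau> l * g (\<tau> - {l}) e)"
proof -
  note t' = faces_sub[OF t]
  have f: "\<tau> - {l} \<in> faces n i" by (rule face_del[OF t l])
  note L = loc_map_cls[OF t' l is_cochainD[OF g f]]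
  have y: "loc_map R M (var_prod (\<tau> - {l})) (Var l) (cochain_of i g (\<tau> - {l})) =
    frac_class J \<tau> (g (\<tau> - {l}))"
    using L(1) f by (simp add: cochain_of_def)
  show "(\<lambda>e. face_sign \<tau> l * g (\<tau> - {l}) e) \<in> frac_coeffs J \<tau>"
  proof (cases "even (card {q\<in>\<tau>. q < l})")
    case True
    then show ?thesis using L(2) by (simp add: face_sign_def)
  next
    case False
    then show ?thesis using frac_coeffs_uminus[OF L(2)] by (simp add: face_sign_def)
  qed
  show "(let y = loc_map R M (var_prod (\<tau> - {l})) (Var l) (cochain_of i g (\<tau> - {l}))
      in if even (card {q\<in>\<tau>. q < l}) then y else \<ominus>\<^bsub>cech_loc n M \<tau>\<^esub> y) = frac_class J \<tau> (\<lambda>e.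
        face_sign \<tau> l * g (\<tau> - {l}) e)"
  proof (cases "even (card {q\<in>\<tau>. q < l})")
    case True
    then show ?thesis unfolding y by (simp add: face_sign_def)
  next
    case False
    then show ?thesis unfolding y Let_def loc_uminus[OF t' L(2)] by (simp add: face_sign_def)
  qed
qed

lemma is_cochain_diff: "is_cochain i g \<Longrightarrow> is_cochain (Suc i) (cochain_diff g)"
  unfolding is_cochain_def
proof
  fix \<tau> assume g: "\<forall>\<sigma>\<in>faces n i. g \<sigma> \<in> frac_coeffs J \<sigma>" and t: "\<tau> \<in> faces n (Suc i)"
  have "(\<lambda>e. \<Sum>l\<in>\<tau>. face_sign \<tau> l * g (\<tau> - {l}) e) \<in> frac_coeffs J \<tau>"
    by (rule frac_coeffs_sum[OF faces_sub[OF t]]) (rule cochain_diff_term(1)[OF _ t], use g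
      is_cochain_def in auto)
  then show "cochain_diff g \<tau> \<in> frac_coeffs J \<tau>"
    unfolding cochain_diff_def[abs_def] coboundary_def .
qed

lemma cech_diff_cochain_of:
  assumes g: "is_cochain i g"
  shows "cech_diff n M i (cochain_of i g) = cochain_of (Suc i) (cochain_diff g)"
  unfolding cech_diff_def cochain_of_def[of "Suc i"]
proof (rule restrict_ext)
  fix \<tau> assume t: "\<tau> \<in> faces n (Suc i)"
  interpret abelian_group "cech_loc n M \<tau>" by (rule loc_abelian_group[OF faces_sub[OF t]])
  have "finsum (cech_loc n M \<tau>) (\<lambda>l. let y =
    loc_map R M (var_prod (\<tau> - {l})) (Var l) (cochain_of i g (\<tau> - {l}))
      in if even (card {q\<in>\<tau>. q < l}) then y else \<ominus>\<^bsub>cech_loc n M \<tau>\<^esub> y) \<tau> =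
      finsum (cech_loc n M \<tau>) (\<lambda>l. frac_class J \<tau> (\<lambda>e. face_sign \<tau> l * g (\<tau> - {l}) e)) \<tau>"
    by (rule finsum_cong'[OF refl])
      (use cochain_diff_term[OF g t] loc_carrier[OF faces_sub[OF t]] in auto)
  also have "\<dots> = frac_class J \<tau> (\<lambda>e. \<Sum>l\<in>\<tau>. face_sign \<tau> l * g (\<tau> - {l}) e)"
    by (rule loc_finsum[OF faces_sub[OF t] finite_face[OF faces_sub[OF t]]]) (rule
      cochain_diff_term(1)[OF g t])
  also have "(\<lambda>e. \<Sum>l\<in>\<tau>. face_sign \<tau> l * g (\<tau> - {l}) e) = cochain_diff g \<tau>"
    unfolding cochain_diff_def[abs_def] coboundary_def ..
  finally show "finsum (cech_loc n M \<tau>) (\<lambda>l. let y =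
    loc_map R M (var_prod (\<tau> - {l})) (Var l) (cochain_of i g (\<tau> - {l}))
      in if even (card {q\<in>\<tau>. q < l}) then y else \<ominus>\<^bsub>cech_loc n M \<tau>\<^esub> y) \<tau> = frac_class J \<tau>
        (cochain_diff g \<tau>)" .
qed

lemma cocycle_iff:
  assumes g: "is_cochain i g"
  shows "cochain_of i g \<in> cech_cocycles n M i \<longleftrightarrow>
    (\<forall>\<tau>\<in>faces n (Suc i). \<forall>e. coboundary (\<lambda>\<sigma>. g \<sigma> e) \<tau> = 0)"
proof -
  have "cochain_of i g \<in> carrier (cech n M i)" unfolding cech_carrier using g by blast
  then have "cochain_of i g \<in> cech_cocycles n M i \<longleftrightarrow>
    cochain_of (Suc i) (cochain_diff g) = cochain_of (Suc i) (\<lambda>\<sigma> e. 0)"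
    unfolding cech_cocycles_def kernel_def cech_diff_cochain_of[OF g, symmetric] cech_one by simp
  also have "\<dots> \<longleftrightarrow> (\<forall>\<tau>\<in>faces n (Suc i). \<forall>e. coboundary (\<lambda>\<sigma>. g \<sigma> e) \<tau> = 0)"
    unfolding cochain_of_eq_iff[OF is_cochain_diff[OF g]]
      by (auto simp: cochain_diff_def fun_eq_iff)
  finally show ?thesis .
qed

lemma coboundaries_subgroup: "subgroup (cech_coboundaries n M i) (cech n M i)"
proof (cases i)
  case 0
  then show ?thesis using group.triv_subgroup[OF cech_group, of 0] by simp
next
  case (Suc p)
  have "group_hom (cech n M p) (cech n M (Suc p)) (cech_diff n M p)"
  proof (intro group_hom.intro cech_group group_hom_axioms.intro homI)
    fix c assume "c \<in> carrier (cech n M p)"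
    then obtain g where g: "c = cochain_of p g" "is_cochain p g" unfolding cech_carrier by blast
    show "cech_diff n M p c \<in> carrier (cech n M (Suc p))"
      unfolding g(1) cech_diff_cochain_of[OF g(2)] unfolding cech_carrier
        using is_cochain_diff[OF g(2)] by blast
    fix c' assume "c' \<in> carrier (cech n M p)"
    then obtain h where h: "c' = cochain_of p h" "is_cochain p h" unfolding cech_carrier by blast
    have "cochain_diff (\<lambda>\<sigma> e. g \<sigma> e + h \<sigma> e) = (\<lambda>\<tau> e. cochain_diff g \<tau> e + cochain_diff h \<tau> e)"
      unfolding cochain_diff_def[abs_def] coboundary_add ..
    then show "cech_diff n M p (c \<otimes>\<^bsub>cech n M p\<^esub> c') =
      cech_diff n M p c \<otimes>\<^bsub>cech n M (Suc p)\<^esub> cech_diff n M p c'"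
      unfolding g(1) h(1) cech_mult[OF g(2) h(2)] cech_diff_cochain_of[OF g(2)]
        cech_diff_cochain_of[OF h(2)]
        cech_diff_cochain_of[OF is_cochain_add[OF g(2) h(2)]] cech_mult[OF is_cochain_diff[OF g(2)]
          is_cochain_diff[OF h(2)]] by simp
  qed
  then show ?thesis using group_hom.img_is_subgroup Suc by fastforce
qed

text \<open>\<open>local_cohomology_gr\<close> is a set of cosets and always contains the trivial
  one, because the zero cochain is homogeneous of every degree. So it differs from the trivial set
  iff some homogeneous cocycle has a nontrivial coset, that is, is no coboundary.\<close>

lemma local_cohomology_gr_nontrivial:
  "local_cohomology_gr n M i j \<noteq> {\<one>\<^bsub>local_cohomology n M i\<^esub>} \<longleftrightarrow>
    (\<exists>c\<in>cech_cocycles n M i. (\<forall>\<sigma>\<in>faces n i. c \<sigma> \<in> cech_loc_gr n M \<sigma> j) \<and> c \<notin> cech_coboundaries n M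
      i)"
proof -
  let ?B = "cech_coboundaries n M i" and ?C = "cech n M i"
  interpret group ?C by (rule cech_group)
  note B = coboundaries_subgroup[of i]
  have one: "\<one>\<^bsub>local_cohomology n M i\<^esub> = ?B"
    by (simp add: local_cohomology_def FactGroup_def)
  have coset: "?B #>\<^bsub>?C\<^esub> c = ?B \<longleftrightarrow> c \<in> ?B" if c: "c \<in> carrier ?C" for c
  proof
    assume "?B #>\<^bsub>?C\<^esub> c = ?B"
    then show "c \<in> ?B" using rcos_self[OF c B] by simp
  next
    assume "c \<in> ?B"
    then show "?B #>\<^bsub>?C\<^esub> c = ?B" by (rule coset_join2[OF c B])
  qed
  have Z: "c \<in> carrier ?C" if "c \<in> cech_cocycles n M i" for c
    using that unfolding cech_cocycles_def kernel_def by simp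
  define A where "A = {c \<in> cech_cocycles n M i. \<forall>\<sigma>\<in>faces n i. c \<sigma> \<in> cech_loc_gr n M \<sigma> j}"
  have gr: "local_cohomology_gr n M i j = (\<lambda>c. ?B #>\<^bsub>?C\<^esub> c) ` A"
    unfolding local_cohomology_gr_def A_def by blast
  have z: "cochain_of i (\<lambda>\<sigma> e. 0) \<in> A"
    unfolding A_def
  proof (intro CollectI conjI ballI)
    show "cochain_of i (\<lambda>\<sigma> e. 0) \<in> cech_cocycles n M i"
      unfolding cocycle_iff[OF is_cochain_zero] by (auto intro: coboundary_zero)
    fix \<sigma> assume s: "\<sigma> \<in> faces n i"
    have "frac_class J \<sigma> (\<lambda>e. 0) = loc_frac R M (var_prod \<sigma>) 0 0"
      using loc_frac_eq[OF finite_face[OF faces_sub[OF s]] J_zero, of n 0]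
        by (simp add: frac_coeff_def)
    moreover have "(0 :: 'k mpoly) \<in> gr M (j + int (0 * card \<sigma>))"
      using J_zero by (simp add: ideal_module_def hom_part_def carrier_mpoly mono_ideal_zero)
    ultimately show "cochain_of i (\<lambda>\<sigma> e. 0) \<sigma> \<in> cech_loc_gr n M \<sigma> j"
      using s unfolding cech_loc_gr_def cochain_of_def
      by (intro CollectI exI[of _ "0 :: 'k mpoly"] exI[of _ "0 :: nat"]) simp
  qed
  have "(\<lambda>c. ?B #>\<^bsub>?C\<^esub> c) ` A = {?B} \<longleftrightarrow> (\<forall>c\<in>A. ?B #>\<^bsub>?C\<^esub> c = ?B)" using z by blast
  also have "\<dots> \<longleftrightarrow> (\<forall>c\<in>A. c \<in> ?B)" using coset Z unfolding A_def by blast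
  finally show ?thesis unfolding gr one A_def by blast
qed

section \<open>Decomposition by exponent vectors\<close>

lemma frac_coeffs_mem: "u \<in> J \<Longrightarrow> frac_coeff \<sigma> u a \<in> frac_coeffs J \<sigma>"
  unfolding frac_coeffs_def by blast

lemma expt_exists: "(\<forall>i. 0 \<le> e i) \<Longrightarrow> (\<forall>i. i \<notin> {1..n} \<longrightarrow> e i = 0) \<Longrightarrow>
  \<exists>t. e = expt t \<and> Poly_Mapping.keys t \<subseteq> {1..n}"
proof -
  assume e: "\<forall>i. 0 \<le> e i" "\<forall>i. i \<notin> {1..n} \<longrightarrow> e i = 0"
  have fin: "finite {i. nat (e i) \<noteq> 0}" by (rule finite_subset[of _ "{1..n}"]) (use e(2) in auto)
  define t where "t = Abs_poly_mapping (\<lambda>i. nat (e i))"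
  have t: "Poly_Mapping.lookup t i = nat (e i)" for i unfolding t_def
    by (subst lookup_Abs_poly_mapping[OF fin]) simp
  have "e = expt t" by (rule ext) (use e(1) in \<open>simp add: expt_def t\<close>)
  moreover have "Poly_Mapping.keys t \<subseteq> {1..n}" using e(2) by (auto simp: in_keys_iff t)
  ultimately show ?thesis by blast
qed

text \<open>Together with \<open>frac_coeffs_support\<close> and \<open>frac_coeffsI\<close> this
  identifies \<open>frac_coeffs J \<sigma>\<close> with the finitely supported functions on the
  exponents \<open>e\<close> in \<open>exponents n\<close> such that \<sigma> is in
  \<open>loc_faces e\<close>.\<close>

lemma frac_coeffs_point:
  assumes e: "e \<in> exponents n" and s: "\<sigma> \<in> loc_faces e"
  shows "(\<lambda>e'. if e' = e then c else 0) \<in> frac_coeffs J \<sigma>"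
proof -
  obtain m where sV: "\<sigma> \<subseteq> {1..n}" and m: "\<forall>i. 0 \<le> shift e m \<sigma> i" "P (\<lambda>i. nat (shift e m \<sigma> i))"
    using s unfolding loc_faces_def by blast
  have "\<forall>i. i \<notin> {1..n} \<longrightarrow> shift e m \<sigma> i = 0" using exponentsD[OF e] sV by (auto simp: shift_def)
  then obtain t where t: "shift e m \<sigma> = expt t" "Poly_Mapping.keys t \<subseteq> {1..n}"
    using expt_exists[OF m(1)] by blast
  have "Poly_Mapping.lookup t = (\<lambda>i. nat (shift e m \<sigma> i))" unfolding t(1) by (simp add: expt_def)
  then have "Poly_Mapping.single t c \<in> J" unfolding J using m(2) t(2)
    by (intro single_mono_ideal) simp_all
  then have "frac_coeff \<sigma> (Poly_Mapping.single t c) m \<in> frac_coeffs J \<sigma>" by (rule frac_coeffs_mem)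
  moreover have "frac_coeff \<sigma> (Poly_Mapping.single t c) m = (\<lambda>e'. if e' = e then c else 0)"
  proof
    fix e'
    have "shift e' m \<sigma> = expt t \<longleftrightarrow> e' = e" unfolding t(1)[symmetric]
      by (auto simp: shift_def fun_eq_iff)
    then show "frac_coeff \<sigma> (Poly_Mapping.single t c) m e' = (if e' = e then c else 0)"
      by (simp add: frac_coeff_def lcoeff_single)
  qed
  ultimately show ?thesis by (simp only:)
qed

lemma frac_coeffs_support:
  assumes s: "\<sigma> \<subseteq> {1..n}" and g: "g \<in> frac_coeffs J \<sigma>"
  shows "finite {e. g e \<noteq> 0}" "g e \<noteq> 0 \<Longrightarrow> e \<in> exponents n" "g e \<noteq> 0 \<Longrightarrow> \<sigma> \<in> loc_faces e"
proof -
  obtain u a where u: "u \<in> J" "g = frac_coeff \<sigma> u a" using g unfolding frac_coeffs_def by blast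
  have key: "\<exists>m\<in>Poly_Mapping.keys u. shift e a \<sigma> = expt m" if "g e \<noteq> 0" for e
    using that lcoeff_nonzero unfolding u(2) frac_coeff_def by blast
  have "{e. g e \<noteq> 0} \<subseteq> (\<lambda>m i. expt m i - (if i \<in> \<sigma> then int a else 0)) ` Poly_Mapping.keys u"
  proof
    fix e assume "e \<in> {e. g e \<noteq> 0}"
    then obtain m where m: "m \<in> Poly_Mapping.keys u" "shift e a \<sigma> = expt m" using key by blast
    have "e = (\<lambda>i. expt m i - (if i \<in> \<sigma> then int a else 0))" unfolding m(2)[symmetric]
      by (simp add: shift_def)
    then show "e \<in> (\<lambda>m i. expt m i - (if i \<in> \<sigma> then int a else 0)) ` Poly_Mapping.keys u" using m(1)
      by blast
  qed
  then show "finite {e. g e \<noteq> 0}" by (rule finite_subset) (intro finite_imageI finite_keys)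
  assume nz: "g e \<noteq> 0"
  then obtain m where m: "m \<in> Poly_Mapping.keys u" "shift e a \<sigma> = expt m" using key by blast
  have mJ: "Poly_Mapping.keys m \<subseteq> {1..n}" "P (Poly_Mapping.lookup m)" using m(1) u(1)
    unfolding J mono_ideal_def by blast+
  show "e \<in> exponents n"
    unfolding exponents_def
  proof (intro CollectI allI impI)
    fix i assume i: "i \<notin> {1..n}"
    then have "Poly_Mapping.lookup m i = 0" using mJ(1) by (auto simp: in_keys_iff)
    then have "shift e a \<sigma> i = 0" unfolding m(2) by (simp add: expt_def)
    moreover have "i \<notin> \<sigma>" using i s by blast
    ultimately show "e i = 0" by (simp add: shift_def)
  qed
  have "(\<lambda>i. nat (shift e a \<sigma> i)) = Poly_Mapping.lookup m" unfolding m(2) by (simp add: expt_def)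
  moreover have "\<forall>i. 0 \<le> shift e a \<sigma> i" unfolding m(2) by (simp add: expt_def)
  ultimately show "\<sigma> \<in> loc_faces e" unfolding loc_faces_def using s mJ(2) by auto
qed

lemma frac_coeffsI:
  assumes s: "\<sigma> \<subseteq> {1..n}" and T: "finite T"
    and nz: "\<And>e. g e \<noteq> 0 \<Longrightarrow> e \<in> T \<and> e \<in> exponents n \<and> \<sigma> \<in> loc_faces e"
  shows "g \<in> frac_coeffs J \<sigma>"
proof -
  define A where "A = {e\<in>T. g e \<noteq> 0}"
  have "(\<lambda>e'. \<Sum>e\<in>A. if e' = e then g e else 0) \<in> frac_coeffs J \<sigma>"
    by (rule frac_coeffs_sum[OF s]) (use frac_coeffs_point nz in \<open>auto simp: A_def\<close>)
  moreover have "(\<lambda>e'. \<Sum>e\<in>A. if e' = e then g e else 0) = g"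
  proof
    fix e'
    have "finite A" using T by (simp add: A_def)
    then have "(\<Sum>e\<in>A. if e' = e then g e else 0) = (if e' \<in> A then g e' else 0)" by simp
    then show "(\<Sum>e\<in>A. if e' = e then g e else 0) = g e'" using nz[of e'] by (auto simp: A_def)
  qed
  ultimately show ?thesis by simp
qed

lemma total_deg_shift: "\<sigma> \<subseteq> {1..n} \<Longrightarrow> total_deg n (shift e a \<sigma>) = total_deg n e + int (a * card \<sigma>)"
proof -
  assume s: "\<sigma> \<subseteq> {1..n}"
  have "total_deg n (shift e a \<sigma>) = total_deg n e + (\<Sum>i\<in>{1..n}. if i \<in> \<sigma> then int a else 0)"
    unfolding total_deg_def shift_def by (rule sum.distrib)
  also have "(\<Sum>i\<in>{1..n}. if i \<in> \<sigma> then int a else 0) = (\<Sum>i\<in>\<sigma>. int a)"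
    by (rule sum.mono_neutral_cong_right) (use s in auto)
  finally show ?thesis by (simp add: mult.commute)
qed

lemma total_deg_expt: "Poly_Mapping.keys m \<subseteq> {1..n} \<Longrightarrow> int (mon_degree m) = total_deg n (expt m)"
  unfolding mon_degree_def total_deg_def expt_def of_nat_sum
  by (rule sum.mono_neutral_left) (auto simp: in_keys_iff)

text \<open>Homogeneity does not depend on the representative: its denominator has degree
  \<open>a * card \<sigma>\<close>, exactly the amount that \<open>shift\<close> adds to the total
  degree.\<close>

lemma cech_loc_gr_iff:
  assumes s: "\<sigma> \<subseteq> {1..n}" and g: "g \<in> frac_coeffs J \<sigma>"
  shows "frac_class J \<sigma> g \<in> cech_loc_gr n M \<sigma> j \<longleftrightarrow> (\<forall>e. g e \<noteq> 0 \<longrightarrow> total_deg n e = j)"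
proof
  assume "frac_class J \<sigma> g \<in> cech_loc_gr n M \<sigma> j"
  then obtain u a where u: "frac_class J \<sigma> g = loc_frac R M (var_prod \<sigma>) u a" "u \<in> J"
    "u \<in> hom_part n (j + int (a * card \<sigma>))"
    unfolding cech_loc_gr_def by (auto simp: ideal_module_def)
  then have g': "g = frac_coeff \<sigma> u a"
    using frac_class_inj[OF _ g] loc_frac_eq[OF finite_face[OF s] u(2)] by metis
  show "\<forall>e. g e \<noteq> 0 \<longrightarrow> total_deg n e = j"
  proof (intro allI impI)
    fix e assume "g e \<noteq> 0"
    then obtain m where m: "m \<in> Poly_Mapping.keys u" "shift e a \<sigma> = expt m"
      using lcoeff_nonzero unfolding g' frac_coeff_def by blast
    have "Poly_Mapping.keys m \<subseteq> {1..n}" using m(1) u(2) unfolding J mono_ideal_def by blast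
    then have "total_deg n (shift e a \<sigma>) = int (mon_degree m)" unfolding m(2)
      by (simp add: total_deg_expt)
    also have "\<dots> = j + int (a * card \<sigma>)" using u(3) m(1) unfolding hom_part_def by blast
    finally show "total_deg n e = j" unfolding total_deg_shift[OF s] by simp
  qed
next
  assume deg: "\<forall>e. g e \<noteq> 0 \<longrightarrow> total_deg n e = j"
  obtain u a where u: "u \<in> J" "g = frac_coeff \<sigma> u a" using g unfolding frac_coeffs_def by blast
  have "u \<in> hom_part n (j + int (a * card \<sigma>))"
    unfolding hom_part_def
  proof (intro CollectI conjI ballI)
    show "u \<in> carrier R" using u(1) unfolding J by (rule mono_ideal_carrier)
    fix m assume m: "m \<in> Poly_Mapping.keys u"
    define e where "e = (\<lambda>i. expt m i - (if i \<in> \<sigma> then int a else 0))"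
    have sh: "shift e a \<sigma> = expt m" by (rule ext) (simp add: shift_def e_def)
    then have "g e \<noteq> 0" using m unfolding u(2) frac_coeff_def sh by (simp add: in_keys_iff)
    then have "total_deg n (expt m) = j + int (a * card \<sigma>)" using deg total_deg_shift[OF s, of e a]
      unfolding sh by simp
    moreover have "Poly_Mapping.keys m \<subseteq> {1..n}" using m u(1) unfolding J mono_ideal_def by blast
    ultimately show "int (mon_degree m) = j + int (a * card \<sigma>)" by (simp add: total_deg_expt)
  qed
  then have "u \<in> gr M (j + int (a * card \<sigma>))" using u(1) by (simp add: ideal_module_def)
  moreover have "frac_class J \<sigma> g = loc_frac R M (var_prod \<sigma>) u a"
    unfolding u(2) loc_frac_eq[OF finite_face[OF s] u(1)] ..
  ultimately show "frac_class J \<sigma> g \<in> cech_loc_gr n M \<sigma> j" unfolding cech_loc_gr_def by blast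
qed

text \<open>Inverting more variables keeps \<open>x^e\<close> in the localization.\<close>

lemma loc_faces_up:
  assumes "\<rho> \<in> loc_faces e" "\<rho> \<subseteq> \<tau>" "\<tau> \<subseteq> {1..n}"
  shows "\<tau> \<in> loc_faces e"
proof -
  obtain m where m: "\<forall>i. 0 \<le> shift e m \<rho> i" "P (\<lambda>i. nat (shift e m \<rho> i))" using assms(1)
    unfolding loc_faces_def by blast
  have le: "shift e m \<rho> i \<le> shift e m \<tau> i" for i using assms(2) by (auto simp: shift_def)
  have "P (\<lambda>i. nat (shift e m \<tau> i))" 
    using P m(2) le unfolding up_closed_def by (meson nat_mono)
  moreover have "0 \<le> shift e m \<tau> i" for i by (rule order_trans[OF m(1)[rule_format] le])
  ultimately show ?thesis unfolding loc_faces_def using assms(3) by auto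
qed

lemma loc_faces_face: "\<tau> \<in> loc_faces e \<Longrightarrow> card \<tau> = i \<Longrightarrow> \<tau> \<in> faces n i"
  by (simp add: loc_faces_def faces_def)

lemma coboundary_0: "cochain_of 0 g \<in> cech_coboundaries n M 0 \<longleftrightarrow> (\<forall>e. g {} e = 0)"
  if "is_cochain 0 g" for g
proof -
  have "faces n 0 = {{}}" using finite_face by (auto simp: faces_def)
  then show ?thesis using cochain_of_eq_iff[OF that, of "\<lambda>\<sigma> e. 0"]
    by (simp add: cech_one fun_eq_iff)
qed

text \<open>A class of the family \<open>loc_faces e\<close> is placed at the exponent
  \<open>e\<close> and extended by zero. If the result were the differential of a Cech cochain
  \<open>h\<close>, the coefficients of \<open>h\<close> at \<open>e\<close> would bound the class
  in the family.\<close>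

lemma nontrivial_if_not_acyclic:
  assumes e: "e \<in> exponents n" "total_deg n e = j" and nv: "\<not> acyclic_at TYPE('k) (loc_faces e) i"
  shows "\<exists>c\<in>cech_cocycles n M i. (\<forall>\<sigma>\<in>faces n i. c \<sigma> \<in> cech_loc_gr n M \<sigma> j) \<and>
    c \<notin> cech_coboundaries n M i"
proof -
  obtain c :: "nat set \<Rightarrow> 'k" where c: "\<And>\<sigma>. c \<sigma> \<noteq> 0 \<Longrightarrow> \<sigma> \<in> loc_faces e \<and> card \<sigma> = i"
    and dc: "\<And>\<tau>. \<tau> \<in> loc_faces e \<Longrightarrow> card \<tau> = Suc i \<Longrightarrow> coboundary c \<tau> = 0"
    and nb: "\<nexists>b. (\<forall>\<sigma>. b \<sigma> \<noteq> 0 \<longrightarrow> \<sigma> \<in> loc_faces e \<and> Suc (card \<sigma>) = i) \<and> (\<forall>\<tau>\<in>loc_faces e. card \<tau> = i \<longrightarrow>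
      coboundary b \<tau> = c \<tau>)"
    using nv unfolding acyclic_at_def by blast
  define g where "g = (\<lambda>\<sigma> e'. if e' = e then c \<sigma> else 0)"
  have ch: "is_cochain i g"
    unfolding is_cochain_def
  proof
    fix \<sigma> assume "\<sigma> \<in> faces n i"
    show "g \<sigma> \<in> frac_coeffs J \<sigma>"
    proof (cases "c \<sigma> = 0")
      case True
      then have "g \<sigma> = (\<lambda>e. 0)" by (simp add: g_def fun_eq_iff)
      then show ?thesis using frac_coeffs_zero by simp
    next
      case False
      then show ?thesis unfolding g_def using frac_coeffs_point[OF e(1)] c by blast
    qed
  qed
  have "cochain_of i g \<in> cech_cocycles n M i"
    unfolding cocycle_iff[OF ch]
  proof (intro ballI allI)
    fix \<tau> e' assume t: "\<tau> \<in> faces n (Suc i)"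
    show "coboundary (\<lambda>\<sigma>. g \<sigma> e') \<tau> = 0"
    proof (cases "e' = e \<and> \<tau> \<in> loc_faces e")
      case True
      then have "coboundary (\<lambda>\<sigma>. g \<sigma> e') \<tau> = coboundary c \<tau>" by (simp add: g_def)
      then show ?thesis using dc True faces_card[OF t] by simp
    next
      case False
      show ?thesis
      proof (rule coboundary_zero)
        fix l assume "l \<in> \<tau>"
        \<comment> \<open>The family is closed upwards, so a face outside it has all its subsets
          outside.\<close>
        have "c (\<tau> - {l}) = 0" if "\<tau> \<notin> loc_faces e"
          using c[of "\<tau> - {l}"] loc_faces_up[of "\<tau> - {l}" e \<tau>] faces_sub[OF t] that by blast
        then show "g (\<tau> - {l}) e' = 0" using False by (auto simp: g_def)
      qed
    qed
  qed
  moreover have "cochain_of i g \<sigma> \<in> cech_loc_gr n M \<sigma> j" if s: "\<sigma> \<in> faces n i" for \<sigma>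
  proof -
    have "frac_class J \<sigma> (g \<sigma>) \<in> cech_loc_gr n M \<sigma> j"
      unfolding cech_loc_gr_iff[OF faces_sub[OF s] is_cochainD[OF ch s]] using e(2)
        by (simp add: g_def)
    then show ?thesis using s by (simp add: cochain_of_def)
  qed
  moreover have "cochain_of i g \<notin> cech_coboundaries n M i"
  proof
    assume B: "cochain_of i g \<in> cech_coboundaries n M i"
    show False
    proof (cases i)
      case 0
      then have z: "g {} e = 0" using coboundary_0[of g] B ch by simp
      have "c \<sigma> = 0" for \<sigma>
      proof (rule ccontr)
        assume nz: "c \<sigma> \<noteq> 0"
        then have "\<sigma> \<in> faces n 0" using c[OF nz] 0 loc_faces_face by blast
        then have "\<sigma> = {}" using finite_face by (auto simp: faces_def)
        then show False using z nz by (simp add: g_def)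
      qed
      then show False using nb by (auto simp: coboundary_def intro!: exI[of _ "\<lambda>_. 0"])
    next
      case (Suc p)
      then obtain h where h: "is_cochain p h" "cochain_of i g = cech_diff n M p (cochain_of p h)"
        using B cech_carrier by auto
      then have eq: "\<forall>\<tau>\<in>faces n i. g \<tau> = cochain_diff h \<tau>"
        using cochain_of_eq_iff[OF ch, of "cochain_diff h"] cech_diff_cochain_of[OF h(1)] Suc
          by simp
      define b where "b = (\<lambda>\<sigma>. if \<sigma> \<in> faces n p then h \<sigma> e else 0)"
      have "\<sigma> \<in> loc_faces e \<and> Suc (card \<sigma>) = i" if "b \<sigma> \<noteq> 0" for \<sigma>
      proof -
        have s: "\<sigma> \<in> faces n p" "h \<sigma> e \<noteq> 0" using that by (auto simp: b_def split: if_splits)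
        then show ?thesis using frac_coeffs_support(3)[OF faces_sub is_cochainD[OF h(1)]] faces_card
          Suc by blast
      qed
      moreover have "coboundary b \<tau> = c \<tau>" if t: "\<tau> \<in> loc_faces e" "card \<tau> = i" for \<tau>
      proof -
        have tf: "\<tau> \<in> faces n (Suc p)" using loc_faces_face[OF t] Suc by simp
        have "coboundary b \<tau> = coboundary (\<lambda>\<sigma>. h \<sigma> e) \<tau>"
          by (rule coboundary_cong) (simp add: b_def face_del[OF tf])
        also have "\<dots> = g \<tau> e" using eq tf Suc by (simp add: cochain_diff_def)
        finally show ?thesis by (simp add: g_def)
      qed
      ultimately show False using nb by blast
    qed
  qed
  ultimately show ?thesis by blast
qed

text \<open>The equation is solved at each exponent of the cocycle separately. Only finitely many
  exponents occur, so the solutions assemble to Laurent polynomials again.\<close>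

lemma coboundary_if_acyclic:
  assumes v: "\<And>e. e \<in> exponents n \<Longrightarrow> total_deg n e = j \<Longrightarrow> acyclic_at TYPE('k) (loc_faces e) i"
    and c: "c \<in> cech_cocycles n M i" "\<And>\<sigma>. \<sigma> \<in> faces n i \<Longrightarrow> c \<sigma> \<in> cech_loc_gr n M \<sigma> j"
  shows "c \<in> cech_coboundaries n M i"
proof -
  have "c \<in> carrier (cech n M i)" using c(1) unfolding cech_cocycles_def kernel_def by simp
  then obtain g where g: "c = cochain_of i g" and ch: "is_cochain i g" unfolding cech_carrier
    by blast
  have coc: "coboundary (\<lambda>\<sigma>. g \<sigma> e) \<tau> = 0" if "\<tau> \<in> faces n (Suc i)" for \<tau> e
    using c(1) that unfolding g cocycle_iff[OF ch] by blast
  have sup: "finite {e. g \<sigma> e \<noteq> 0}" "g \<sigma> e \<noteq> 0 \<Longrightarrow> e \<in> exponents n" "g \<sigma> e \<noteq> 0 \<Longrightarrow> \<sigma> \<in> loc_faces e"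
    if "\<sigma> \<in> faces n i" for \<sigma> e
    using frac_coeffs_support[OF faces_sub[OF that] is_cochainD[OF ch that]] by blast+
  have deg: "total_deg n e = j" if "\<sigma> \<in> faces n i" "g \<sigma> e \<noteq> 0" for \<sigma> e
    using c(2)[OF that(1)] that cech_loc_gr_iff[OF faces_sub is_cochainD[OF ch]]
      unfolding g cochain_of_def by auto
  define T where "T = (\<Union>\<sigma>\<in>faces n i. {e. g \<sigma> e \<noteq> 0})"
  have "finite (faces n i)" by (rule finite_subset[of _ "Pow {1..n}"]) (auto simp: faces_def)
  then have finT: "finite T" unfolding T_def using sup(1) by blast
  have T: "e \<in> exponents n" "total_deg n e = j" if "e \<in> T" for e using that sup(2) deg
    unfolding T_def by blast+
  have "\<exists>b. (\<forall>\<sigma>. b \<sigma> \<noteq> 0 \<longrightarrow> \<sigma> \<in> loc_faces e \<and> Suc (card \<sigma>) = i) \<and>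
      (\<forall>\<tau>\<in>loc_faces e. card \<tau> = i \<longrightarrow> coboundary b \<tau> = g \<tau> e)" if e: "e \<in> T" for e
  proof -
    define ce where "ce = (\<lambda>\<sigma>. if \<sigma> \<in> faces n i then g \<sigma> e else 0)"
    have 1: "\<sigma> \<in> loc_faces e \<and> card \<sigma> = i" if "ce \<sigma> \<noteq> 0" for \<sigma>
      using that sup(3)[of \<sigma> e] faces_card[of \<sigma> i] by (auto simp: ce_def split: if_splits)
    have 2: "coboundary ce \<tau> = 0" if t: "\<tau> \<in> loc_faces e" "card \<tau> = Suc i" for \<tau>
    proof -
      have tf: "\<tau> \<in> faces n (Suc i)" by (rule loc_faces_face[OF t])
      have "coboundary ce \<tau> = coboundary (\<lambda>\<sigma>. g \<sigma> e) \<tau>"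
        by (rule coboundary_cong) (simp add: ce_def face_del[OF tf])
      then show ?thesis using coc[OF tf] by simp
    qed
    have "\<exists>b. (\<forall>\<sigma>. b \<sigma> \<noteq> 0 \<longrightarrow> \<sigma> \<in> loc_faces e \<and> Suc (card \<sigma>) = i) \<and>
      (\<forall>\<tau>\<in>loc_faces e. card \<tau> = i \<longrightarrow> coboundary b \<tau> = ce \<tau>)"
      by (rule acyclic_atD[OF v[OF T[OF e]]]) (fact 1, fact 2)
    then show ?thesis using loc_faces_face by (simp add: ce_def)
  qed
  then obtain b where b: "\<And>e \<sigma>. e \<in> T \<Longrightarrow> b e \<sigma> \<noteq> 0 \<Longrightarrow> \<sigma> \<in> loc_faces e \<and> Suc (card \<sigma>) = i"
    and db: "\<And>e \<tau>. e \<in> T \<Longrightarrow> \<tau> \<in> loc_faces e \<Longrightarrow> card \<tau> = i \<Longrightarrow> coboundary (b e) \<tau> = g \<tau> e" by metis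
  have gz: "g \<tau> e = 0" if "\<tau> \<in> faces n i" "e \<notin> T \<or> \<tau> \<notin> loc_faces e" for \<tau> e
    using that sup(3) unfolding T_def by blast
  show ?thesis
  proof (cases i)
    case 0
    have "g {} e = 0" for e
    proof (cases "e \<in> T \<and> {} \<in> loc_faces e")
      case True
      then have "g {} e = coboundary (b e) {}" using db 0 by simp
      then show ?thesis by (simp add: coboundary_def)
    next
      case False
      then show ?thesis using gz[of "{}" e] 0 by (auto simp: faces_def)
    qed
    then show ?thesis using coboundary_0[of g] ch unfolding g 0 by simp
  next
    case (Suc p)
    define h where "h = (\<lambda>\<rho> e. if e \<in> T then b e \<rho> else 0)"
    have hch: "is_cochain p h"
      unfolding is_cochain_def
    proof
      fix \<rho> assume r: "\<rho> \<in> faces n p"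
      show "h \<rho> \<in> frac_coeffs J \<rho>"
        by (rule frac_coeffsI[OF faces_sub[OF r] finT]) (use b T(1) in \<open>auto simp: h_def split:
          if_splits\<close>)
    qed
    have "g \<tau> e = cochain_diff h \<tau> e" if t: "\<tau> \<in> faces n i" for \<tau> e
    proof (cases "e \<in> T \<and> \<tau> \<in> loc_faces e")
      case True
      then show ?thesis using db[of e \<tau>] faces_card[OF t] by (simp add: cochain_diff_def h_def)
    next
      case False
      \<comment> \<open>If \<tau> is not in the family at \<open>e\<close>, none of its subsets is,
        so both sides vanish; outside \<open>T\<close> both vanish by definition.\<close>
      have "coboundary (\<lambda>\<rho>. h \<rho> e) \<tau> = 0"
      proof (rule coboundary_zero, rule ccontr)
        fix l assume "l \<in> \<tau>" and "h (\<tau> - {l}) e \<noteq> 0"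
        then have "e \<in> T" "b e (\<tau> - {l}) \<noteq> 0" by (auto simp: h_def split: if_splits)
        then have "\<tau> - {l} \<in> loc_faces e" using b by blast
        then have "\<tau> \<in> loc_faces e" using loc_faces_up faces_sub[OF t] by blast
        then show False using False \<open>e \<in> T\<close> by blast
      qed
      then show ?thesis using gz[OF t] False by (auto simp: cochain_diff_def)
    qed
    then have "c = cech_diff n M p (cochain_of p h)"
      unfolding g cech_diff_cochain_of[OF hch] Suc[symmetric] cochain_of_eq_iff[OF ch] by blast
    moreover have "cochain_of p h \<in> carrier (cech n M p)" unfolding cech_carrier using hch by blast
    ultimately show ?thesis unfolding Suc by simp
  qed
qed

lemma reg_eq_Greatest:
  "reg n M = (GREATEST r. \<exists>q. \<exists>e\<in>exponents n. r = int q + total_deg n e \<and>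
    \<not> acyclic_at TYPE('k) (loc_faces e) q)"
proof -
  have nt: "local_cohomology_gr n M i j \<noteq> {\<one>\<^bsub>local_cohomology n M i\<^esub>} \<longleftrightarrow>
      (\<exists>e\<in>exponents n. total_deg n e = j \<and> \<not> acyclic_at TYPE('k) (loc_faces e) i)" for i j
    unfolding local_cohomology_gr_nontrivial using nontrivial_if_not_acyclic coboundary_if_acyclic
      by blast
  have "(\<lambda>r. \<exists>i j. r = int i + j \<and> (\<exists>e\<in>exponents n. total_deg n e = j \<and>
    \<not> acyclic_at TYPE('k) (loc_faces e) i)) =
      (\<lambda>r. \<exists>q. \<exists>e\<in>exponents n. r = int q + total_deg n e \<and> \<not> acyclic_at TYPE('k) (loc_faces e) q)"
    by (rule ext) blast
  then show ?thesis unfolding reg_def nt by (simp only:)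
qed

end

lemma ideal_reg_mono:
  "ideal_reg n (mono_ideal n (in_power E s) :: 'k::field mpoly set) =
    (GREATEST r. r \<in> reg_values TYPE('k) n E s)"
proof -
  interpret monomial_ideal n "in_power E s" "mono_ideal n (in_power E s) :: 'k mpoly set"
    by unfold_locales (rule up_closed_in_power, rule refl)
  \<comment> \<open>For the predicate \<open>in_power E s\<close> the two families of faces have
    literally the same definition.\<close>
  have "loc_faces = power_faces n E s" unfolding loc_faces_def[abs_def] power_faces_def[abs_def] ..
  then show ?thesis using reg_eq_Greatest unfolding reg_values_def by simp
qed

theorem theorem1p3:
  fixes n s :: nat and E :: "nat set set"
  assumes "simple_graph n E" and "E \<noteq> {}" and "gap_free E"
    and "s \<in> {2, 3}"
  shows "ideal_reg n (ideal_power n (edge_ideal n E :: 'k::field mpoly set) s) =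
    max (ideal_reg n (edge_ideal n E :: 'k mpoly set) + int s - 1) (2 * int s)"
  unfolding ideal_power_mono[OF assms(1)] unfolding edge_ideal_mono[OF assms(1)] ideal_reg_mono
  by (rule Greatest_reg_values[OF assms(1,3,2,4)])

end
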